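(* Let $\alpha>1$. As $t\to\infty$, $$\frac{1}{U(t)}\sum_{z\in\Omega_t}u(t,z)\to 1\qquad\text{in probability}.$$ Moreover, as $t\to\infty$, $$\mathrm{Prob}(\mathfrak{D}_t)\to\frac{p}{2-p}.$$
   Context: Fix $p\in(0,1)$ and $\alpha>0$. Let $(\xi_0(z))_{z\in\mathbb Z}$ be independent random variables with the Pareto distribution function $F(x)=1-x^{-\alpha}$, $x\ge 1$. Define the random potential $\xi:\mathbb Z\to[1,\infty)$ by $\xi(n)=\xi_0(n)$ for $n\in\mathbb N_0=\{0,1,2,\dots\}$ and, independently for each $n\in\mathbb N=\{1,2,\dots\}$ (and independently of $\xi_0$), $\xi(-n)=\xi_0(n)$ with probability $p$ and $\xi(-n)=\xi_0(-n)$ otherwise. $\mathrm{Prob}$ denotes the probability governing $\xi$. The parabolic Anderson model with potential $\xi$ is the solution $u$ of $\partial_t u(t,z)=(\Delta u)(t,z)+\xi(z)u(t,z)$ for $(t,z)\in(0,\infty)\times\mathbb Z$, $u(0,z)=\mathbf 1_{\{0\}}(z)$, where $(\Delta f)(z)=\sum_{|y-z|=1}(f(y)-f(z))$. For $\alpha>1$ it exists and is given by $u(t,z)=\mathbb E\big[\exp\{\int_0^t\xi(X_s)\,ds\}\mathbf 1\{X_t=z\}\big]$, where $(X_s)_{s\ge0}$ is the continuous-time random walk on $\mathbb Z$ with generator $\Delta$ started at $0$ (independent of $\xi$) and $\mathbb E$ is expectation over the walk only. $U(t)=\sum_{z\in\mathbb Z}u(t,z)$. For $t>0$, $z\in\mathbb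 Z$ let $\Psi_t(z)=\xi(z)-\frac{|z|}{t}\log\xi(z)$, let $\Omega_t$ be the set of maximisers of $\Psi_t$ over $\mathbb Z$, and let $\mathfrak D_t=\{|\Omega_t|=2\}$. *)

theory Defs
  imports "HOL-Probability.Probability"
begin

section \<open>The duplicated Pareto potential\<close>

text \<open>
  \<open>\<xi>0 z\<close> are the Pareto variables and \<open>dup n\<close>, for \<open>n \<ge> 1\<close>, is the event that the value at
  \<open>-n\<close> is copied from \<open>n\<close> (\<open>dup 0\<close> is irrelevant). All the \<open>\<xi>0 z\<close> and the indicators of all
  the \<open>dup n\<close> are jointly independent, as one family indexed by the disjoint sum of the two index
  sets.
\<close>

locale duplicated_pareto = prob_space M
  for M :: "'a measure" +
  fixes p \<alpha> :: real
    and \<xi>0 :: "int \<Rightarrow> 'a \<Rightarrow> real"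
    and dup :: "nat \<Rightarrow> 'a \<Rightarrow> bool"
  assumes p_range: "0 < p" "p < 1"
    and alpha_pos: "0 < \<alpha>"
    and pareto: "\<And>z x. 1 \<le> x \<Longrightarrow> prob {\<omega> \<in> space M. \<xi>0 z \<omega> \<le> x} = 1 - x powr (- \<alpha>)"
    and dup_prob: "\<And>n. 1 \<le> n \<Longrightarrow> prob {\<omega> \<in> space M. dup n \<omega>} = p"
    and indep: "indep_vars (\<lambda>_. borel)
      (case_sum \<xi>0 (\<lambda>n \<omega>. of_bool (dup n \<omega>) :: real)) (UNIV <+> {1..})"

definition potential :: "(int \<Rightarrow> 'a \<Rightarrow> real) \<Rightarrow> (nat \<Rightarrow> 'a \<Rightarrow> bool) \<Rightarrow> 'a \<Rightarrow> int \<Rightarrow> real" where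
  "potential \<xi>0 dup \<omega> z = (if z < 0 \<and> dup (nat (- z)) \<omega> then \<xi>0 (- z) \<omega> else \<xi>0 z \<omega>)"

section \<open>The parabolic Anderson model\<close>

definition laplacian :: "(int \<Rightarrow> real) \<Rightarrow> int \<Rightarrow> real" where
  "laplacian f z = (\<Sum>y | \<bar>y - z\<bar> = 1. f y - f z)"

definition anderson_solution :: "(int \<Rightarrow> real) \<Rightarrow> (real \<Rightarrow> int \<Rightarrow> real) \<Rightarrow> bool" where
  "anderson_solution \<xi> u \<longleftrightarrow>
     (\<forall>t>0. \<forall>z. ((\<lambda>s. u s z) has_real_derivative laplacian (u t) z + \<xi> z * u t z) (at t)) \<and>
     (\<forall>z. u 0 z = indicator {0} z) \<and>
     (\<forall>z. continuous_on {0..} (\<lambda>t. u t z))"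

text \<open>
  The continuous-time random walk with generator \<^const>\<open>laplacian\<close> jumps to each of the two
  neighbours at rate 1: its holding times are independent and exponential with parameter 2, and
  its steps are independent and uniform on \<open>{-1, 1}\<close>. A sample point is a pair of the sequence of
  holding times and the sequence of steps; the walk has made \<open>card {n. \<Sum>k\<le>n. hold k \<le> s}\<close> jumps
  by time \<open>s\<close> (this set is almost surely finite).
\<close>

definition walk_space :: "((nat \<Rightarrow> real) \<times> (nat \<Rightarrow> int)) measure" where
  "walk_space =
     PiM UNIV (\<lambda>_. density lborel (exponential_density 2)) \<Otimes>\<^sub>M
     PiM UNIV (\<lambda>_. measure_pmf (pmf_of_set {-1, 1}))"

definition walk :: "(nat \<Rightarrow> real) \<times> (nat \<Rightarrow> int) \<Rightarrow> real \<Rightarrow> int" where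
  "walk = (\<lambda>(hold, step) s. \<Sum>i<card {n. (\<Sum>k\<le>n. hold k) \<le> s}. step i)"

definition feynman_kac :: "(int \<Rightarrow> real) \<Rightarrow> (real \<Rightarrow> int \<Rightarrow> real) \<Rightarrow> bool" where
  "feynman_kac \<xi> u \<longleftrightarrow>
     (\<forall>t\<ge>0. \<forall>z. has_bochner_integral walk_space
        (\<lambda>X. exp (LBINT s:{0..t}. \<xi> (walk X s)) * indicator {X. walk X t = z} X) (u t z))"

text \<open>
  For an unbounded potential the Cauchy problem alone does not determine \<open>u\<close> (there is no growth
  condition at infinity); the solution meant is the one given by the Feynman--Kac formula.
\<close>

definition parabolic_anderson_model :: "(int \<Rightarrow> real) \<Rightarrow> (real \<Rightarrow> int \<Rightarrow> real) \<Rightarrow> bool" where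
  "parabolic_anderson_model \<xi> u \<longleftrightarrow> anderson_solution \<xi> u \<and> feynman_kac \<xi> u"

definition total_mass :: "(real \<Rightarrow> int \<Rightarrow> real) \<Rightarrow> real \<Rightarrow> real" where
  "total_mass u t = (\<Sum>\<^sub>\<infinity>z\<in>UNIV. u t z)"

section \<open>The maximisers\<close>

definition \<Psi> :: "(int \<Rightarrow> real) \<Rightarrow> real \<Rightarrow> int \<Rightarrow> real" where
  "\<Psi> \<xi> t z = \<xi> z - \<bar>real_of_int z\<bar> / t * ln (\<xi> z)"

definition maximisers :: "(int \<Rightarrow> real) \<Rightarrow> real \<Rightarrow> int set" where
  "maximisers \<xi> t = {z. \<forall>y. \<Psi> \<xi> t y \<le> \<Psi> \<xi> t z}"

section \<open>Convergence in probability\<close>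

text \<open>
  Measurability is part of the definition, since \<^const>\<open>measure\<close> is 0 on non-measurable sets.
\<close>

definition tendsto_in_prob :: "'a measure \<Rightarrow> ('b \<Rightarrow> 'a \<Rightarrow> real) \<Rightarrow> real \<Rightarrow> 'b filter \<Rightarrow> bool" where
  "tendsto_in_prob M X c F \<longleftrightarrow>
     (\<forall>\<^sub>F t in F. X t \<in> borel_measurable M) \<and>
     (\<forall>\<epsilon>>0. ((\<lambda>t. measure M {\<omega> \<in> space M. \<epsilon> < \<bar>X t \<omega> - c\<bar>}) \<longlongrightarrow> 0) F)"

end

theory Submission
  imports Defs "HOL-Real_Asymp.Real_Asymp"
begin

text \<open>
Why the mass sits on the maximisers. In the Feynman--Kac formula a path whose largest potential value
is \<open>\<xi> y\<close> carries at most the weight \<open>exp (t * \<xi> y)\<close>, and to see \<open>y\<close> it has to make \<open>\<bar>y\<bar>\<close> jumps before time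
\<open>t\<close>, which has probability at most \<open>(2 * exp 1 * t / \<bar>y\<bar>) ^ \<bar>y\<bar>\<close>. For the sites that matter
\<open>\<bar>y\<bar> / t\<close> equals \<open>\<xi> y\<close> up to a logarithmic factor, so the product is \<open>exp (t * \<Psi> \<xi> t y)\<close> up to
lower order. Conversely a path that runs straight to \<open>z\<close>, spending about \<open>1 / \<xi> z\<close> at each site, and
then waits contributes \<open>exp (t * \<Psi> \<xi> t z)\<close> up to lower order (\<open>fk_mass_maximiser_ge\<close>). Hence, as
soon as the score \<open>\<Psi>\<close> has a gap \<open>D\<close> between its maximisers \<open>\<Omega>\<close> and the other sites, all paths whose
potential comes within a small \<open>g\<close> of its largest value at a site outside \<open>\<Omega>\<close> are negligible. On
every other path the potential is below the value on \<open>\<Omega>\<close> by at least \<open>g\<close> wherever the path is outside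
\<open>\<Omega>\<close>. If such a path does not end in \<open>\<Omega>\<close>, consider its last visit to \<open>\<Omega>\<close>: staying there
would have earned a factor growing like \<open>exp (g * s)\<close> in the time \<open>s\<close> spent outside, and integrating
over the moment of departure shows that all these paths together carry at most \<open>2 / (g - 2)\<close> times
the mass on \<open>\<Omega>\<close> (\<open>fk_mass_outside_le\<close>, by redrawing the holding time at the last visit,
\<open>nn_integral_resample_hold\<close>). The result for a fixed potential is \<open>localisation_in_environment\<close>.

Why the potential is good enough. Let \<open>a = (t / ln t) powr (1 / (\<alpha> - 1))\<close> and \<open>r = a powr \<alpha>\<close>, so that
\<open>t * a = ln t * r\<close>. Potential values of order \<open>a\<close> occur at distances of order \<open>r\<close>, and there both terms
of the score are of order \<open>a\<close>. With \<open>l = ln (ln t)\<close> as slowly growing margin, a union bound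
(\<open>prob_not_typical_le\<close>) shows that with probability tending to 1 the best score is at least \<open>a / l\<close>,
all sites with such a score have \<open>\<bar>z\<bar> \<le> l * r\<close>, and any two competitive scores of different
Pareto variables differ by at least \<open>a\<close> times a power of \<open>1 / l\<close>. The lower order terms above are at most
\<open>t * a\<close> times a power of \<open>l\<close> over \<open>ln t\<close>, hence small compared with \<open>t\<close> times the gap.

Why the limit is \<open>p / (2 - p)\<close>. Let \<open>q\<close> be the sum over \<open>n \<ge> 1\<close> of the probability that the score of the
Pareto variable with index \<open>n\<close> exceeds all scores at sites other than \<open>n\<close> and \<open>-n\<close>. This event is
independent of whether \<open>n\<close> is duplicated, and has the same probability with index \<open>-n\<close> in place of \<open>n\<close>.
Apart from vanishing probabilities the best score belongs either to a duplicated pair (total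
probability \<open>p * q\<close>), or to one of the two sites of a pair that is not duplicated (total probability
\<open>2 * (1 - p) * q\<close>). These exhaust everything, so \<open>q\<close> tends to \<open>1 / (2 - p)\<close>, and \<open>p * q\<close> is the probability of
two maximisers (\<open>prob_two_maximisers_bounds\<close>).
\<close>

section \<open>Jump times and positions of the walk\<close>

definition jump_time :: "(nat \<Rightarrow> real) \<Rightarrow> nat \<Rightarrow> real" where
  "jump_time h k = (\<Sum>i<k. h i)"

definition position :: "(nat \<Rightarrow> int) \<Rightarrow> nat \<Rightarrow> int" where
  "position d k = (\<Sum>i<k. d i)"

text \<open>
The potential accumulated along the path up to its \<open>k\<close>-th jump.
\<close>

definition collected :: "(int \<Rightarrow> real) \<Rightarrow> (nat \<Rightarrow> real) \<Rightarrow> (nat \<Rightarrow> int) \<Rightarrow> nat \<Rightarrow> real" where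
  "collected \<xi> h d k = (\<Sum>i<k. h i * \<xi> (position d i))"

abbreviation hold_law :: "real measure" where
  "hold_law \<equiv> density lborel (exponential_density 2)"

abbreviation hold_space :: "(nat \<Rightarrow> real) measure" where
  "hold_space \<equiv> PiM UNIV (\<lambda>_. hold_law)"

abbreviation step_space :: "(nat \<Rightarrow> int) measure" where
  "step_space \<equiv> PiM UNIV (\<lambda>_. measure_pmf (pmf_of_set {-1, 1}))"

lemma jump_time_Suc: "jump_time h (Suc k) = jump_time h k + h k"
  by (simp add: jump_time_def)

lemma position_Suc: "position d (Suc k) = position d k + d k"
  by (simp add: position_def)

lemma collected_Suc: "collected \<xi> h d (Suc k) = collected \<xi> h d k + h k * \<xi> (position d k)"
  by (simp add: collected_def)

lemma jump_time_0 [simp]: "jump_time h 0 = 0"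
  by (simp add: jump_time_def)

lemma strict_mono_jump_time:
  assumes "\<And>i. 0 < h i"
  shows "strict_mono (jump_time h)"
  unfolding strict_mono_Suc_iff by (simp add: jump_time_Suc assms)

lemma walk_eq_position:
  assumes pos: "\<And>i. 0 < h i" and s: "jump_time h k \<le> s" "s < jump_time h (Suc k)"
  shows "walk (h, d) s = position d k"
proof -
  note mono = strict_mono_jump_time[of h, OF pos]
  have "{n. (\<Sum>i\<le>n. h i) \<le> s} = {..<k}"
  proof (intro set_eqI iffI)
    fix n assume "n \<in> {n. (\<Sum>i\<le>n. h i) \<le> s}"
    then have "jump_time h (Suc n) < jump_time h (Suc k)"
      using s by (simp add: jump_time_def lessThan_Suc_atMost)
    then show "n \<in> {..<k}" using strict_mono_less[OF mono] by simp
  next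
    fix n assume "n \<in> {..<k}"
    then have "jump_time h (Suc n) \<le> jump_time h k" using strict_mono_less_eq[OF mono] by simp
    then show "n \<in> {n. (\<Sum>i\<le>n. h i) \<le> s}"
      using s by (simp add: jump_time_def lessThan_Suc_atMost)
  qed
  then show ?thesis by (simp add: walk_def position_def)
qed

lemma ex_jump_interval:
  assumes "\<And>i. 0 < h i" "0 \<le> s" "s < jump_time h k"
  shows "\<exists>n<k. jump_time h n \<le> s \<and> s < jump_time h (Suc n)"
  using assms(3)
proof (induction k)
  case 0 then show ?case using assms by simp
next
  case (Suc k)
  then show ?case by (cases "s < jump_time h k") (auto intro: less_SucI)
qed

lemma jump_interval_unique:
  assumes "\<And>i. 0 < h i" "jump_time h n \<le> s" "s < jump_time h (Suc n)"
    and "jump_time h m \<le> s" "s < jump_time h (Suc m)"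
  shows "n = m"
proof -
  note mono = strict_mono_jump_time[of h, OF assms(1)]
  have "jump_time h n < jump_time h (Suc m)" "jump_time h m < jump_time h (Suc n)"
    using assms by auto
  then have "n < Suc m" "m < Suc n" by (simp_all add: strict_mono_less[OF mono])
  then show ?thesis by simp
qed

text \<open>
The integrand is constant on each holding interval, so the time integral is a finite sum, with the
interval that contains \<open>t\<close> cut off at \<open>t\<close>.
\<close>

lemma action_eq_collected:
  assumes pos: "\<And>i. 0 < h i" and t: "jump_time h k \<le> t" "t < jump_time h (Suc k)"
  shows "(LBINT s:{0..t}. \<xi> (walk (h, d) s)) =
    collected \<xi> h d k + (t - jump_time h k) * \<xi> (position d k)"
proof -
  note mono = strict_mono_jump_time[of h, OF pos]
  have t0: "0 \<le> t" using t(1) strict_mono_less_eq[OF mono, of 0 k] by simp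
  define f where "f s = (\<Sum>i<k. \<xi> (position d i) * indicator {jump_time h i..<jump_time h (Suc i)} s)
      + \<xi> (position d k) * indicator {jump_time h k..t} s" for s
  have eq: "indicator {0..t} s *\<^sub>R \<xi> (walk (h, d) s) = f s" for s
  proof (cases "s \<in> {0..t}")
    case False
    have "s \<notin> {jump_time h i..<jump_time h (Suc i)}" if "i < k" for i
    proof -
      have "jump_time h 0 \<le> jump_time h i" "jump_time h (Suc i) \<le> jump_time h k"
        using that strict_mono_less_eq[OF mono, of 0 i] strict_mono_less_eq[OF mono, of "Suc i" k] by auto
      then show ?thesis using False t by auto
    qed
    moreover have "s \<notin> {jump_time h k..t}"
      using False strict_mono_less_eq[OF mono, of 0 k] by auto
    ultimately show ?thesis using False by (simp add: f_def)
  next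
    case True
    with t obtain n where n: "n < Suc k" "jump_time h n \<le> s" "s < jump_time h (Suc n)"
      using ex_jump_interval[of h s "Suc k", OF pos] by auto
    have uniq: "s \<in> {jump_time h i..<jump_time h (Suc i)} \<longleftrightarrow> i = n" for i
      using jump_interval_unique[of h n s i, OF pos n(2,3)] n by auto
    have "f s = \<xi> (position d n)"
    proof (cases "n = k")
      case True
      then have "f s = (\<Sum>i<k. 0) + \<xi> (position d k)"
        unfolding f_def using n \<open>s \<in> {0..t}\<close>
        by (intro arg_cong2[where f="(+)"] sum.cong refl)
           (use uniq in \<open>auto simp: indicator_def\<close>)
      then show ?thesis using True by simp
    next
      case False
      then have "n < k" using n by simp
      then have "s \<notin> {jump_time h k..t}"
        using n(3) strict_mono_less_eq[OF mono, of "Suc n" k] by auto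
      moreover have "(\<Sum>i<k. \<xi> (position d i) * indicator {jump_time h i..<jump_time h (Suc i)} s)
          = (\<Sum>i<k. if i = n then \<xi> (position d n) else 0)"
        by (intro sum.cong refl) (use uniq in \<open>auto simp: indicator_def\<close>)
      ultimately show ?thesis using \<open>n < k\<close> by (simp add: f_def)
    qed
    then show ?thesis using True walk_eq_position[of h n s d, OF pos n(2,3)] by simp
  qed
  have "(LBINT s:{0..t}. \<xi> (walk (h, d) s)) = (LBINT s. f s)"
    unfolding set_lebesgue_integral_def using eq by simp
  also have "\<dots> = (\<Sum>i<k. \<xi> (position d i) * h i) + \<xi> (position d k) * (t - jump_time h k)"
  proof -
    have int1: "integrable lborel (\<lambda>s. c * indicator {a..<b} s)" for a b c :: real
      by (intro integrable_mult_right integrable_real_indicator) (cases "a \<le> b"; simp)+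
    have int2: "integrable lborel (\<lambda>s. c * indicator {a..b} s)" for a b c :: real
      by (intro integrable_mult_right integrable_real_indicator) (cases "a \<le> b"; simp)+
    have "(LBINT s. f s) = (LBINT s. (\<Sum>i<k. \<xi> (position d i) * indicator {jump_time h i..<jump_time h (Suc i)} s))
       + (LBINT s. \<xi> (position d k) * indicator {jump_time h k..t} s)"
      unfolding f_def by (intro Bochner_Integration.integral_add Bochner_Integration.integrable_sum int1 int2)
    also have "(LBINT s. (\<Sum>i<k. \<xi> (position d i) * indicator {jump_time h i..<jump_time h (Suc i)} s))
       = (\<Sum>i<k. LBINT s. \<xi> (position d i) * indicator {jump_time h i..<jump_time h (Suc i)} s)"
      by (intro Bochner_Integration.integral_sum int1)
    also have "\<dots> = (\<Sum>i<k. \<xi> (position d i) * h i)"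
      by (intro sum.cong refl) (use pos in \<open>simp add: jump_time_Suc less_imp_le\<close>)
    also have "(LBINT s. \<xi> (position d k) * indicator {jump_time h k..t} s)
       = \<xi> (position d k) * (t - jump_time h k)"
      using t by simp
    finally show ?thesis .
  qed
  finally show ?thesis by (simp add: collected_def mult.commute)
qed

lemma prob_space_hold_law: "prob_space hold_law"
  by (rule prob_space_exponential_density) simp

lemma prob_space_hold_space: "prob_space hold_space"
  by (rule prob_space_PiM) (rule prob_space_hold_law)

lemma prob_space_step_space: "prob_space step_space"
  by (rule prob_space_PiM) (rule prob_space_measure_pmf)

lemma walk_space_eq: "walk_space = hold_space \<Otimes>\<^sub>M step_space"
  by (simp add: walk_space_def)

lemma measurable_jump_time [measurable]: "(\<lambda>h. jump_time h k) \<in> borel_measurable hold_space"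
  unfolding jump_time_def by measurable

lemma measurable_int_add:
  fixes f g :: "'b \<Rightarrow> int"
  assumes [measurable]: "f \<in> N \<rightarrow>\<^sub>M count_space UNIV" "g \<in> N \<rightarrow>\<^sub>M count_space UNIV"
  shows "(\<lambda>x. f x + g x) \<in> N \<rightarrow>\<^sub>M count_space UNIV"
  by measurable

lemma measurable_position [measurable]: "(\<lambda>d. position d k) \<in> step_space \<rightarrow>\<^sub>M count_space UNIV"
proof -
  have [measurable]: "(\<lambda>d. d i) \<in> step_space \<rightarrow>\<^sub>M count_space UNIV" for i
    using measurable_component_singleton[of i UNIV "\<lambda>_. measure_pmf (pmf_of_set {-1, 1::int})"]
    by (simp cong: measurable_cong_sets)
  show ?thesis
  proof (induction k)
    case 0 show ?case by (simp add: position_def)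
  next
    case (Suc k) then show ?case unfolding position_Suc by (intro measurable_int_add) auto
  qed
qed

lemma measurable_collected [measurable]:
  "(\<lambda>X. collected \<xi> (fst X) (snd X) k) \<in> borel_measurable (hold_space \<Otimes>\<^sub>M step_space)"
  unfolding collected_def by measurable

text \<open>
Replacing one holding time by an independent copy does not change the law of the sequence. Averages
over the path can therefore be computed by first averaging over a single exponential variable with
everything else frozen.
\<close>

lemma nn_integral_resample_hold:
  assumes [measurable]: "F \<in> borel_measurable hold_space"
  shows "(\<integral>\<^sup>+h. F h \<partial>hold_space) = (\<integral>\<^sup>+h. \<integral>\<^sup>+x. F (h(k := x)) \<partial>hold_law \<partial>hold_space)"
proof -
  interpret E: prob_space hold_law by (rule prob_space_hold_law)
  interpret H: prob_space hold_space by (rule prob_space_hold_space)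
  interpret P: pair_sigma_finite hold_law hold_space ..
  have [measurable]: "(\<lambda>(x, h). h(k := x)) \<in> hold_law \<Otimes>\<^sub>M hold_space \<rightarrow>\<^sub>M hold_space"
    using measurable_fun_upd[where J="UNIV :: nat set" and I=UNIV and i=k] by measurable
  have "hold_space = distr (hold_law \<Otimes>\<^sub>M hold_space) hold_space (\<lambda>(x, h). h(k := x))"
    using distr_pair_PiM_eq_PiM[of UNIV "\<lambda>_. hold_law" k] prob_space_hold_law by simp
  then have "(\<integral>\<^sup>+h. F h \<partial>hold_space) = (\<integral>\<^sup>+h. F h \<partial>distr (hold_law \<Otimes>\<^sub>M hold_space) hold_space (\<lambda>(x, h). h(k := x)))"
    by simp
  also have "\<dots> = (\<integral>\<^sup>+(x, h). F (h(k := x)) \<partial>(hold_law \<Otimes>\<^sub>M hold_space))"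
    by (subst nn_integral_distr) (simp_all add: case_prod_unfold)
  also have "\<dots> = (\<integral>\<^sup>+h. \<integral>\<^sup>+x. F (h(k := x)) \<partial>hold_law \<partial>hold_space)"
    by (subst P.nn_integral_snd[symmetric]) (simp_all add: case_prod_unfold)
  finally show ?thesis .
qed

section \<open>Exponential holding times\<close>

text \<open>
The integrand times the density is \<open>2 / (2 + \<theta>)\<close> times the exponential density with parameter
\<open>2 + \<theta>\<close>.
\<close>

lemma nn_integral_hold_law_exp:
  assumes "0 \<le> \<theta>"
  shows "(\<integral>\<^sup>+x. ennreal (exp (- \<theta> * x)) \<partial>hold_law) = ennreal (2 / (2 + \<theta>))"
proof -
  interpret E: prob_space "density lborel (exponential_density (2 + \<theta>))"
    by (rule prob_space_exponential_density) (use assms in simp)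
  have "(\<integral>\<^sup>+x. ennreal (exp (- \<theta> * x)) \<partial>hold_law)
     = (\<integral>\<^sup>+x. ennreal (exponential_density 2 x) * ennreal (exp (- \<theta> * x)) \<partial>lborel)"
    by (subst nn_integral_density) auto
  also have "\<dots> = (\<integral>\<^sup>+x. ennreal (2 / (2 + \<theta>)) * ennreal (exponential_density (2 + \<theta>) x) \<partial>lborel)"
    using assms
    by (intro nn_integral_cong)
       (auto simp: exponential_density_def ennreal_mult[symmetric] mult_exp_exp field_simps)
  also have "\<dots> = ennreal (2 / (2 + \<theta>)) * (\<integral>\<^sup>+x. ennreal (exponential_density (2 + \<theta>) x) \<partial>lborel)"
    by (rule nn_integral_cmult) auto
  also have "(\<integral>\<^sup>+x. ennreal (exponential_density (2 + \<theta>) x) \<partial>lborel) = 1"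
    using E.emeasure_space_1 by (simp add: emeasure_density)
  finally show ?thesis by simp
qed

lemma emeasure_hold_law_greater:
  assumes "0 \<le> \<tau>"
  shows "emeasure hold_law {x. \<tau> < x} = ennreal (exp (- 2 * \<tau>))"
proof -
  interpret E: prob_space hold_law by (rule prob_space_hold_law)
  have "emeasure hold_law {..\<tau>} = ennreal (1 - exp (- 2 * \<tau>))"
    using emeasure_erlang_density[of 2 0 \<tau>] assms by (simp add: erlang_CDF_0)
  then have "measure hold_law {..\<tau>} = 1 - exp (- 2 * \<tau>)"
    using assms by (simp add: measure_def)
  moreover have "{x. \<tau> < x} = space hold_law - {..\<tau>}" by auto
  ultimately show ?thesis
    using E.prob_compl[of "{..\<tau>}"] by (simp add: E.emeasure_eq_measure)
qed

text \<open>
With time \<open>\<tau>\<close> left and a loss of rate \<open>g\<close> after departure, this compares leaving a site at some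
time \<open>x \<le> \<tau>\<close> with staying, which contributes \<open>exp (g * \<tau>)\<close> times the probability \<open>exp (- 2 * \<tau>)\<close>. The
departures near the end of the time interval dominate, whence the small factor \<open>2 / (g - 2)\<close>.
\<close>

lemma nn_integral_hold_law_growing_exp:
  assumes "2 < g"
  shows "(\<integral>\<^sup>+x. ennreal (exp (g * x)) * indicator {..\<tau>} x \<partial>hold_law) \<le> ennreal (2 / (g - 2) * exp ((g - 2) * \<tau>))"
proof (cases "0 \<le> \<tau>")
  case False
  have "(\<integral>\<^sup>+x. ennreal (exp (g * x)) * indicator {..\<tau>} x \<partial>hold_law)
     = (\<integral>\<^sup>+x. ennreal (exponential_density 2 x) * (ennreal (exp (g * x)) * indicator {..\<tau>} x) \<partial>lborel)"
    by (subst nn_integral_density) auto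
  also have "\<dots> = (\<integral>\<^sup>+x. 0 \<partial>(lborel::real measure))"
    using False by (intro nn_integral_cong) (auto simp: exponential_density_def indicator_def)
  finally show ?thesis by simp
next
  case True
  have "(\<integral>\<^sup>+x. ennreal (exp (g * x)) * indicator {..\<tau>} x \<partial>hold_law)
     = (\<integral>\<^sup>+x. ennreal (exponential_density 2 x) * (ennreal (exp (g * x)) * indicator {..\<tau>} x) \<partial>lborel)"
    by (subst nn_integral_density) auto
  also have "\<dots> = (\<integral>\<^sup>+x. ennreal (2 * exp ((g - 2) * x)) * indicator {0..\<tau>} x \<partial>lborel)"
    by (intro nn_integral_cong)
       (auto simp: exponential_density_def indicator_def ennreal_mult[symmetric] mult_exp_exp algebra_simps)
  also have "\<dots> = ennreal (2 / (g - 2) * exp ((g - 2) * \<tau>) - 2 / (g - 2) * exp ((g - 2) * 0))"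
  proof (rule nn_integral_FTC_Icc)
    fix x
    have "((\<lambda>x. c * exp (k * x)) has_real_derivative c * k * exp (k * x)) (at x)" for c k
      by (auto intro!: derivative_eq_intros)
    moreover have "2 / (g - 2) * (g - 2) = 2" using assms by (simp only: times_divide_eq_left nonzero_mult_div_cancel_right)
    ultimately have "((\<lambda>x. 2 / (g - 2) * exp ((g - 2) * x)) has_real_derivative 2 * exp ((g - 2) * x)) (at x)"
      by metis
    then show "((\<lambda>x. 2 / (g - 2) * exp ((g - 2) * x)) has_real_derivative 2 * exp ((g - 2) * x)) (at x)" .
  qed (use True in auto)
  also have "\<dots> \<le> ennreal (2 / (g - 2) * exp ((g - 2) * \<tau>))"
    using assms by (intro ennreal_leI) auto
  finally show ?thesis .
qed

lemma jump_time_upd [simp]: "n \<le> k \<Longrightarrow> jump_time (h(k := x)) n = jump_time h n"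
  by (simp add: jump_time_def)

lemma collected_upd [simp]: "n \<le> k \<Longrightarrow> collected \<xi> (h(k := x)) d n = collected \<xi> h d n"
  by (simp add: collected_def)

text \<open>
Each further holding time contributes an independent factor; redrawing the last one isolates it.
\<close>

lemma nn_integral_exp_jump_time:
  assumes "0 \<le> \<theta>"
  shows "(\<integral>\<^sup>+h. ennreal (exp (- \<theta> * jump_time h n)) \<partial>hold_space) = ennreal ((2 / (2 + \<theta>)) ^ n)"
proof (induction n)
  case 0
  interpret H: prob_space hold_space by (rule prob_space_hold_space)
  show ?case by (simp add: H.emeasure_space_1)
next
  case (Suc n)
  have "(\<integral>\<^sup>+h. ennreal (exp (- \<theta> * jump_time h (Suc n))) \<partial>hold_space)
    = (\<integral>\<^sup>+h. \<integral>\<^sup>+x. ennreal (exp (- \<theta> * jump_time (h(n := x)) (Suc n))) \<partial>hold_law \<partial>hold_space)"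
    by (rule nn_integral_resample_hold) measurable
  also have "\<dots> = (\<integral>\<^sup>+h. ennreal (exp (- \<theta> * jump_time h n)) * ennreal (2 / (2 + \<theta>)) \<partial>hold_space)"
  proof (intro nn_integral_cong)
    fix h
    have "(\<integral>\<^sup>+x. ennreal (exp (- \<theta> * jump_time (h(n := x)) (Suc n))) \<partial>hold_law)
      = (\<integral>\<^sup>+x. ennreal (exp (- \<theta> * jump_time h n)) * ennreal (exp (- \<theta> * x)) \<partial>hold_law)"
      by (intro nn_integral_cong)
         (simp add: jump_time_Suc ennreal_mult[symmetric] mult_exp_exp algebra_simps)
    also have "\<dots> = ennreal (exp (- \<theta> * jump_time h n)) * ennreal (2 / (2 + \<theta>))"
      by (subst nn_integral_cmult) (simp_all only: nn_integral_hold_law_exp[OF assms], auto)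
    finally show "(\<integral>\<^sup>+x. ennreal (exp (- \<theta> * jump_time (h(n := x)) (Suc n))) \<partial>hold_law)
      = ennreal (exp (- \<theta> * jump_time h n)) * ennreal (2 / (2 + \<theta>))" .
  qed
  also have "\<dots> = (\<integral>\<^sup>+h. ennreal (exp (- \<theta> * jump_time h n)) \<partial>hold_space) * ennreal (2 / (2 + \<theta>))"
    by (rule nn_integral_multc) measurable
  also have "\<dots> = ennreal ((2 / (2 + \<theta>)) ^ n) * ennreal (2 / (2 + \<theta>))"
    by (simp only: Suc.IH)
  also have "\<dots> = ennreal ((2 / (2 + \<theta>)) ^ Suc n)"
    using assms by (subst ennreal_mult[symmetric]) (auto simp: mult.commute)
  finally show ?case .
qed

text \<open>
Exponential Chebyshev inequality.
\<close>

lemma prob_jump_time_le: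
  assumes "0 < n" "0 < t"
  shows "emeasure hold_space {h \<in> space hold_space. jump_time h n \<le> t} \<le> ennreal ((2 * exp 1 * t / n) ^ n)"
proof -
  \<comment> \<open>Optimal up to a bounded factor per jump; the exponential of \<theta> * t becomes the n-th power of exp 1.\<close>
  define \<theta> where "\<theta> = n / t"
  have \<theta>: "0 < \<theta>" using assms by (simp add: \<theta>_def)
  have "emeasure hold_space {h \<in> space hold_space. jump_time h n \<le> t}
    = (\<integral>\<^sup>+h. indicator {h \<in> space hold_space. jump_time h n \<le> t} h \<partial>hold_space)"
    by (rule nn_integral_indicator[symmetric]) measurable
  also have "\<dots> \<le> (\<integral>\<^sup>+h. ennreal (exp (\<theta> * t)) * ennreal (exp (- \<theta> * jump_time h n)) \<partial>hold_space)"
    using \<theta> by (intro nn_integral_mono)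
       (auto simp: indicator_def ennreal_mult[symmetric] mult_exp_exp)
  also have "\<dots> = ennreal (exp (\<theta> * t)) * ennreal ((2 / (2 + \<theta>)) ^ n)"
    using \<theta> by (subst nn_integral_cmult) (simp_all only: nn_integral_exp_jump_time less_imp_le, auto)
  also have "\<dots> = ennreal (exp (\<theta> * t) * (2 / (2 + \<theta>)) ^ n)"
    using \<theta> by (intro ennreal_mult[symmetric]) auto
  also have "\<dots> \<le> ennreal ((2 * exp 1 * t / n) ^ n)"
  proof (intro ennreal_leI)
    have "exp (\<theta> * t) = exp 1 ^ n"
      using assms by (simp add: \<theta>_def exp_of_nat_mult[symmetric])
    moreover have "(2 / (2 + \<theta>)) ^ n \<le> (2 / \<theta>) ^ n"
      using \<theta> by (intro power_mono divide_left_mono) auto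
    ultimately have "exp (\<theta> * t) * (2 / (2 + \<theta>)) ^ n \<le> (exp 1 * (2 / \<theta>)) ^ n"
      unfolding power_mult_distrib[of "exp 1" "2 / \<theta>"] by (simp add: mult_left_mono)
    then show "exp (\<theta> * t) * (2 / (2 + \<theta>)) ^ n \<le> (2 * exp 1 * t / n) ^ n"
      by (simp add: \<theta>_def mult_ac)
  qed
  finally show ?thesis .
qed

section \<open>Feynman--Kac weights as functions of jump times and positions\<close>

text \<open>
The last clause says that the path makes only finitely many jumps up to time \<open>t\<close>.
\<close>

definition proper_path :: "real \<Rightarrow> (nat \<Rightarrow> real) \<times> (nat \<Rightarrow> int) \<Rightarrow> bool" where
  "proper_path t X \<longleftrightarrow>
     (\<forall>i. 0 < fst X i) \<and> (\<forall>i. snd X i \<in> {-1, 1}) \<and> (\<exists>k. t < jump_time (fst X) k)"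

text \<open>
The Feynman--Kac weight of a path on the event that it has made exactly \<open>k\<close> jumps by time \<open>t\<close> and is
then in \<open>B\<close>. Writing the weight as a sum over \<open>k\<close> makes it an explicit function of jump times and
positions, so measurability and the exchange of sums and integrals are immediate.
\<close>

definition path_mass :: "(int \<Rightarrow> real) \<Rightarrow> real \<Rightarrow> int set \<Rightarrow> nat \<Rightarrow> (nat \<Rightarrow> real) \<times> (nat \<Rightarrow> int) \<Rightarrow> ennreal" where
  "path_mass \<xi> t B k X =
     ennreal (exp (collected \<xi> (fst X) (snd X) k + (t - jump_time (fst X) k) * \<xi> (position (snd X) k)))
     * indicator {X. jump_time (fst X) k \<le> t \<and> t < jump_time (fst X) (Suc k) \<and> position (snd X) k \<in> B} X"

definition fk_mass :: "(int \<Rightarrow> real) \<Rightarrow> real \<Rightarrow> int set \<Rightarrow> ennreal" where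
  "fk_mass \<xi> t B = (\<integral>\<^sup>+X. (\<Sum>k. path_mass \<xi> t B k X) \<partial>walk_space)"

lemma measurable_fst_jump_time [measurable]:
  "(\<lambda>X. jump_time (fst X) k) \<in> borel_measurable (hold_space \<Otimes>\<^sub>M step_space)"
  by measurable

lemma measurable_snd_position [measurable]:
  "(\<lambda>X. position (snd X) k) \<in> hold_space \<Otimes>\<^sub>M step_space \<rightarrow>\<^sub>M count_space UNIV"
  by (rule measurable_compose[OF measurable_snd measurable_position])

lemma measurable_path_mass [measurable]:
  "path_mass \<xi> t B k \<in> borel_measurable (hold_space \<Otimes>\<^sub>M step_space)"
proof -
  have [measurable]: "(\<lambda>X. \<xi> (position (snd X) k)) \<in> borel_measurable (hold_space \<Otimes>\<^sub>M step_space)"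
    by (rule measurable_compose[OF measurable_snd_position]) simp
  have [measurable]: "Measurable.pred (hold_space \<Otimes>\<^sub>M step_space) (\<lambda>X. position (snd X) k \<in> B)"
    by (rule measurable_compose[OF measurable_snd_position]) simp
  show ?thesis unfolding path_mass_def by measurable
qed

lemma fk_mass_eq_suminf: "fk_mass \<xi> t B = (\<Sum>k. \<integral>\<^sup>+X. path_mass \<xi> t B k X \<partial>walk_space)"
  unfolding fk_mass_def walk_space_eq by (rule nn_integral_suminf) measurable

lemma AE_walk_space_fst:
  assumes "AE h in hold_space. P h"
  shows "AE X in walk_space. P (fst X)"
proof -
  interpret H: prob_space hold_space by (rule prob_space_hold_space)
  interpret S: prob_space step_space by (rule prob_space_step_space)
  obtain N where N: "N \<in> null_sets hold_space" "{h \<in> space hold_space. \<not> P h} \<subseteq> N"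
    using assms unfolding eventually_ae_filter by auto
  have "emeasure walk_space (N \<times> space step_space) = 0"
    using N unfolding walk_space_eq by (subst S.emeasure_pair_measure_Times) auto
  moreover have "N \<times> space step_space \<in> sets walk_space"
    using N unfolding walk_space_eq by auto
  ultimately show ?thesis
    using N(2) unfolding eventually_ae_filter
    by (intro bexI[of _ "N \<times> space step_space"]) (auto simp: walk_space_eq space_pair_measure)
qed

lemma AE_walk_space_snd:
  assumes "AE d in step_space. P d"
  shows "AE X in walk_space. P (snd X)"
proof -
  interpret S: prob_space step_space by (rule prob_space_step_space)
  obtain N where N: "N \<in> null_sets step_space" "{d \<in> space step_space. \<not> P d} \<subseteq> N"
    using assms unfolding eventually_ae_filter by auto
  have "emeasure walk_space (space hold_space \<times> N) = 0"
    using N unfolding walk_space_eq by (subst S.emeasure_pair_measure_Times) auto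
  moreover have "space hold_space \<times> N \<in> sets walk_space"
    using N unfolding walk_space_eq by auto
  ultimately show ?thesis
    using N(2) unfolding eventually_ae_filter
    by (intro bexI[of _ "space hold_space \<times> N"]) (auto simp: walk_space_eq space_pair_measure)
qed

lemma AE_hold_law_pos: "AE x in hold_law. 0 < x"
proof -
  have "AE x in (lborel::real measure). x \<noteq> 0" by (rule AE_lborel_singleton)
  then show ?thesis
    by (subst AE_density) (auto elim!: eventually_mono simp: exponential_density_def)
qed

text \<open>
The probability that the \<open>n\<close>-th jump occurs before \<open>t\<close> tends to 0, and infinitely many jumps before \<open>t\<close>
would make all these events occur.
\<close>

lemma AE_jump_time_unbounded:
  assumes "0 < t"
  shows "AE h in hold_space. \<exists>k. t < jump_time h k"
proof -
  interpret H: prob_space hold_space by (rule prob_space_hold_space)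
  define A where "A n = {h \<in> space hold_space. jump_time h n \<le> t}" for n
  have [measurable]: "A n \<in> sets hold_space" for n unfolding A_def by measurable
  have le: "measure hold_space (\<Inter>n. A n) \<le> (2 * exp 1 * t / n) ^ n" if "0 < n" for n
  proof -
    have "measure hold_space (\<Inter>n. A n) \<le> measure hold_space (A n)"
      by (intro H.finite_measure_mono) auto
    also have "\<dots> \<le> (2 * exp 1 * t / n) ^ n"
      using prob_jump_time_le[OF that assms] assms
      by (simp add: A_def H.emeasure_eq_measure)
    finally show ?thesis .
  qed
  have lim: "(\<lambda>n. (1 / 2 :: real) ^ n) \<longlonglongrightarrow> 0" by (rule LIMSEQ_realpow_zero) auto
  have "measure hold_space (\<Inter>n. A n) \<le> 0"
  proof (rule tendsto_lowerbound[OF lim])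
    show "\<forall>\<^sub>F n in sequentially. measure hold_space (\<Inter>n. A n) \<le> (1 / 2) ^ n"
      using eventually_ge_at_top[of "nat \<lceil>4 * exp 1 * t\<rceil> + 1"]
    proof eventually_elim
      case (elim n)
      then have n: "0 < n" "4 * exp 1 * t \<le> n" by linarith+
      then have "(2 * exp 1 * t / n) ^ n \<le> (1 / 2) ^ n"
        using assms by (intro power_mono) (auto simp: field_simps)
      with le[OF n(1)] show ?case by linarith
    qed
  qed simp
  then have "measure hold_space (\<Inter>n. A n) = 0"
    by (simp add: measure_le_0_iff)
  then have "(\<Inter>n. A n) \<in> null_sets hold_space"
    by (intro null_setsI) (auto simp: H.emeasure_eq_measure)
  then show ?thesis
    by (rule AE_I') (auto simp: A_def not_less)
qed

lemma AE_proper_path: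
  assumes "0 < t"
  shows "AE X in walk_space. proper_path t X"
proof -
  have "AE h in hold_space. \<forall>i. 0 < h i"
    unfolding AE_all_countable
    by (intro allI AE_PiM_component[OF prob_space_hold_law _ AE_hold_law_pos]) auto
  moreover have "AE d in step_space. \<forall>i. d i \<in> {-1, 1::int}"
    unfolding AE_all_countable
    by (intro allI AE_PiM_component[OF prob_space_measure_pmf]) (auto simp: AE_measure_pmf_iff)
  ultimately show ?thesis
    using AE_walk_space_fst[OF AE_jump_time_unbounded[OF assms]]
      AE_walk_space_fst[of "\<lambda>h. \<forall>i. 0 < h i"] AE_walk_space_snd[of "\<lambda>d. \<forall>i. d i \<in> {-1, 1}"]
    unfolding proper_path_def by auto
qed

lemma proper_path_jump_interval:
  assumes "proper_path t X" "0 < t"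
  obtains k where "jump_time (fst X) k \<le> t" "t < jump_time (fst X) (Suc k)"
proof -
  obtain m where "\<And>i. 0 < fst X i" "t < jump_time (fst X) m"
    using assms unfolding proper_path_def by auto
  with ex_jump_interval[of "fst X" t m] assms(2) that show thesis by auto
qed

lemma suminf_path_mass:
  assumes "proper_path t X" "jump_time (fst X) k \<le> t" "t < jump_time (fst X) (Suc k)"
  shows "(\<Sum>j. path_mass \<xi> t B j X) =
    ennreal (exp (collected \<xi> (fst X) (snd X) k + (t - jump_time (fst X) k) * \<xi> (position (snd X) k)))
    * indicator B (position (snd X) k)"
proof -
  have "path_mass \<xi> t B j X = 0" if "j \<notin> {k}" for j
    using that jump_interval_unique[of "fst X" k t j] assms
    by (auto simp: path_mass_def proper_path_def indicator_def)
  then have "(\<Sum>j. path_mass \<xi> t B j X) = (\<Sum>j\<in>{k}. path_mass \<xi> t B j X)"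
    by (intro suminf_finite) auto
  then show ?thesis using assms by (simp add: path_mass_def indicator_def)
qed

lemma fk_mass_singleton:
  assumes "feynman_kac \<xi> u" "0 < t"
  shows "0 \<le> u t z" "ennreal (u t z) = fk_mass \<xi> t {z}"
proof -
  define F where "F X = exp (LBINT s:{0..t}. \<xi> (walk X s)) * indicator {X. walk X t = z} X" for X
  have F: "has_bochner_integral walk_space F (u t z)"
    using assms unfolding feynman_kac_def F_def[abs_def] by auto
  have nn: "0 \<le> F X" for X by (simp add: F_def)
  have int: "integrable walk_space F" "integral\<^sup>L walk_space F = u t z"
    using F by (simp_all add: has_bochner_integral_iff)
  show "0 \<le> u t z"
    using int(2) nn by (metis Bochner_Integration.integral_nonneg)
  have "AE X in walk_space. ennreal (F X) = (\<Sum>j. path_mass \<xi> t {z} j X)"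
    using AE_proper_path[OF assms(2)]
  proof eventually_elim
    case (elim X)
    obtain k where k: "jump_time (fst X) k \<le> t" "t < jump_time (fst X) (Suc k)"
      by (rule proper_path_jump_interval[OF elim assms(2)])
    have pos: "\<And>i. 0 < fst X i" using elim by (simp add: proper_path_def)
    show ?case
      using action_eq_collected[of "fst X" k t \<xi> "snd X", OF pos k]
        walk_eq_position[of "fst X" k t "snd X", OF pos k]
      by (simp add: suminf_path_mass[OF elim k] F_def indicator_def)
  qed
  then have "fk_mass \<xi> t {z} = (\<integral>\<^sup>+X. ennreal (F X) \<partial>walk_space)"
    unfolding fk_mass_def by (intro nn_integral_cong_AE) auto
  also have "\<dots> = ennreal (u t z)"
    using nn_integral_eq_integral[of walk_space F] int nn by simp
  finally show "ennreal (u t z) = fk_mass \<xi> t {z}" by simp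
qed

lemma fk_mass_eq_sum: "fk_mass \<xi> t B = (\<integral>\<^sup>+z. fk_mass \<xi> t {z} * indicator B z \<partial>count_space UNIV)"
proof -
  have "(\<Sum>k. path_mass \<xi> t B k X) = (\<integral>\<^sup>+z. (\<Sum>k. path_mass \<xi> t {z} k X) * indicator B z \<partial>count_space UNIV)" for X
  proof -
    have pm: "path_mass \<xi> t B k X = (\<integral>\<^sup>+z. path_mass \<xi> t {z} k X * indicator B z \<partial>count_space UNIV)" for k
    proof -
      have "(\<integral>\<^sup>+z. path_mass \<xi> t {z} k X * indicator B z \<partial>count_space UNIV)
        = (\<integral>\<^sup>+z. path_mass \<xi> t B k X * indicator {position (snd X) k} z \<partial>count_space UNIV)"
        by (intro nn_integral_cong) (auto simp: path_mass_def indicator_def)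
      then show ?thesis by simp
    qed
    have "(\<Sum>k. path_mass \<xi> t B k X) = (\<integral>\<^sup>+z. (\<Sum>k. path_mass \<xi> t {z} k X * indicator B z) \<partial>count_space UNIV)"
      unfolding pm by (subst nn_integral_suminf) auto
    then show ?thesis by simp
  qed
  then have "fk_mass \<xi> t B = (\<integral>\<^sup>+X. (\<integral>\<^sup>+z. (\<Sum>k. path_mass \<xi> t {z} k X) * indicator B z \<partial>count_space UNIV) \<partial>walk_space)"
    by (simp add: fk_mass_def)
  also have "\<dots> = (\<integral>\<^sup>+z. (\<integral>\<^sup>+X. (\<Sum>k. path_mass \<xi> t {z} k X) * indicator B z \<partial>walk_space) \<partial>count_space UNIV)"
    unfolding walk_space_eq by (rule nn_integral_count_space_nn_integral) auto
  also have "\<dots> = (\<integral>\<^sup>+z. fk_mass \<xi> t {z} * indicator B z \<partial>count_space UNIV)"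
    unfolding fk_mass_def walk_space_eq by (intro nn_integral_cong nn_integral_multc) auto
  finally show ?thesis .
qed

section \<open>Upper and lower bounds for the Feynman--Kac mass\<close>

lemma abs_position_le:
  assumes "\<And>i. d i \<in> {-1, 1}"
  shows "\<bar>position d n\<bar> \<le> int n"
proof (induction n)
  case 0 show ?case by (simp add: position_def)
next
  case (Suc n)
  have "\<bar>d n\<bar> = 1" using assms[of n] by auto
  then show ?case using Suc by (simp add: position_Suc)
qed

text \<open>
Between the jumps \<open>k\<close> and \<open>n\<close> the path sees at most \<open>c\<close> per unit of time.
\<close>

lemma collected_le:
  assumes pos: "\<And>i. 0 < h i" and kn: "k \<le> n"
    and le: "\<And>i. k \<le> i \<Longrightarrow> i < n \<Longrightarrow> \<xi> (position d i) \<le> c"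
  shows "collected \<xi> h d n \<le> collected \<xi> h d k + (jump_time h n - jump_time h k) * c"
  using kn le
proof (induction n rule: dec_induct)
  case base then show ?case by simp
next
  case (step n)
  have "h n * \<xi> (position d n) \<le> h n * c"
    using step pos[of n] by (intro mult_left_mono) auto
  moreover have "collected \<xi> h d n \<le> collected \<xi> h d k + (jump_time h n - jump_time h k) * c"
    using step by auto
  ultimately show ?case
    by (simp add: collected_Suc jump_time_Suc algebra_simps)
qed

text \<open>
An upper bound for the weight of a path that leaves \<open>\<Omega>\<close> for the last time at its \<open>(k + 1)\<close>-st jump, when
the potential is \<open>m\<close> on \<open>\<Omega>\<close> and at most \<open>m - g\<close> at all later positions.
\<close>

definition detour_mass :: "(int \<Rightarrow> real) \<Rightarrow> real \<Rightarrow> int set \<Rightarrow> real \<Rightarrow> real \<Rightarrow> nat \<Rightarrow> (nat \<Rightarrow> real) \<times> (nat \<Rightarrow> int) \<Rightarrow> ennreal" where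
  "detour_mass \<xi> t \<Omega> m g k X =
     ennreal (exp (collected \<xi> (fst X) (snd X) k + fst X k * m + (t - jump_time (fst X) (Suc k)) * (m - g)))
     * indicator {X. jump_time (fst X) k \<le> t \<and> jump_time (fst X) (Suc k) \<le> t \<and> position (snd X) k \<in> \<Omega>} X"

lemma measurable_detour_mass [measurable]:
  "detour_mass \<xi> t \<Omega> m g k \<in> borel_measurable (hold_space \<Otimes>\<^sub>M step_space)"
proof -
  have [measurable]: "Measurable.pred (hold_space \<Otimes>\<^sub>M step_space) (\<lambda>X. position (snd X) k \<in> \<Omega>)"
    by (rule measurable_compose[OF measurable_snd_position]) simp
  show ?thesis unfolding detour_mass_def by measurable
qed

text \<open>
The dichotomy for paths that end outside \<open>\<Omega>\<close>. Either the path visits a site \<open>y\<close> outside \<open>\<Omega>\<close> whose value is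
within \<open>g\<close> of the largest value seen; then its weight is at most \<open>exp (t * (\<xi> y + g))\<close>, and reaching \<open>y\<close>
took at least \<open>\<bar>y\<bar>\<close> jumps. Or the largest value is attained in \<open>\<Omega>\<close> and the path sees less than
\<open>m - g\<close> whenever it is outside \<open>\<Omega>\<close>; then the weight is cut at the last visit to \<open>\<Omega>\<close>.
\<close>

lemma outside_mass_path_bound:
  assumes X: "proper_path t X" and t: "0 < t" and g: "0 \<le> g"
    and \<Omega>: "\<And>z. z \<in> \<Omega> \<Longrightarrow> \<xi> z = m"
  shows "(\<Sum>k. path_mass \<xi> t (- \<Omega>) k X) \<le>
    (\<integral>\<^sup>+y. ennreal (exp (t * (\<xi> y + g))) * indicator {X. jump_time (fst X) (nat \<bar>y\<bar>) \<le> t} X * indicator (- \<Omega>) y \<partial>count_space UNIV)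
    + (\<Sum>k. detour_mass \<xi> t \<Omega> m g k X)"
proof -
  define h where "h = fst X"
  define d where "d = snd X"
  have pos: "\<And>i. 0 < h i" and steps: "\<And>i. d i \<in> {-1, 1}"
    using X by (simp_all add: proper_path_def h_def d_def)
  obtain n where n: "jump_time h n \<le> t" "t < jump_time h (Suc n)"
    using proper_path_jump_interval[OF X t] unfolding h_def by blast
  note mono = strict_mono_less_eq[OF strict_mono_jump_time[of h, OF pos]]
  define A where "A = collected \<xi> h d n + (t - jump_time h n) * \<xi> (position d n)"
  have lhs: "(\<Sum>k. path_mass \<xi> t (- \<Omega>) k X) = ennreal (exp A) * indicator (- \<Omega>) (position d n)"
    using suminf_path_mass[OF X, of n \<xi> "- \<Omega>"] n by (simp add: h_def d_def A_def)
  show ?thesis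
  proof (cases "position d n \<in> \<Omega>")
    case True then show ?thesis by (simp add: lhs)
  next
    case out: False
    define V where "V = \<xi> ` position d ` {..n}"
    have fin: "finite V" "V \<noteq> {}" by (auto simp: V_def)
    have Max_le: "\<xi> (position d i) \<le> Max V" if "i \<le> n" for i
      using that fin by (intro Max_ge) (auto simp: V_def)
    show ?thesis
    proof (cases "\<exists>i\<le>n. position d i \<notin> \<Omega> \<and> Max V - g \<le> \<xi> (position d i)")
      case True
      then obtain i where i: "i \<le> n" "position d i \<notin> \<Omega>" "Max V - g \<le> \<xi> (position d i)" by auto
      define y where "y = position d i"
      have "A \<le> jump_time h n * Max V + (t - jump_time h n) * Max V"
        unfolding A_def using collected_le[of h 0 n \<xi> d "Max V", OF pos] Max_le n(1)
        by (intro add_mono mult_left_mono) (auto simp: collected_def)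
      also have "\<dots> = t * Max V" by (simp add: algebra_simps)
      also have "\<dots> \<le> t * (\<xi> y + g)" using t i by (intro mult_left_mono) (auto simp: y_def)
      finally have A: "A \<le> t * (\<xi> y + g)" .
      have "nat \<bar>y\<bar> \<le> n" using abs_position_le[of d i, OF steps] i by (simp add: y_def)
      then have "jump_time h (nat \<bar>y\<bar>) \<le> t" using mono[of "nat \<bar>y\<bar>" n] n by simp
      then have "(\<Sum>k. path_mass \<xi> t (- \<Omega>) k X) \<le>
        ennreal (exp (t * (\<xi> y + g))) * indicator {X. jump_time (fst X) (nat \<bar>y\<bar>) \<le> t} X * indicator (- \<Omega>) y"
        using A i(2) out by (simp add: lhs h_def y_def indicator_def ennreal_leI)
      also have "\<dots> \<le> (\<integral>\<^sup>+y. ennreal (exp (t * (\<xi> y + g))) * indicator {X. jump_time (fst X) (nat \<bar>y\<bar>) \<le> t} X * indicator (- \<Omega>) y \<partial>count_space UNIV)"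
        by (rule nn_integral_ge_point[of y UNIV "\<lambda>y. ennreal (exp (t * (\<xi> y + g))) * indicator {X. jump_time (fst X) (nat \<bar>y\<bar>) \<le> t} X * indicator (- \<Omega>) y"]) simp
      finally show ?thesis by (rule order_trans) simp
    next
      case False
      then have small: "\<xi> (position d i) < Max V - g" if "i \<le> n" "position d i \<notin> \<Omega>" for i
        using that by force
      have "\<forall>x\<in>V. \<exists>j\<le>n. \<xi> (position d j) = x" by (auto simp: V_def)
      then obtain j where j: "j \<le> n" "\<xi> (position d j) = Max V" using Max_in[OF fin] by blast
      then have j\<Omega>: "position d j \<in> \<Omega>" using small[of j] g by auto
      then have m: "Max V = m" using \<Omega> j by auto
      \<comment> \<open>The indices of the visits to \<open>\<Omega>\<close>; the last of them is the point where the path is cut.\<close>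
      define K where "K = {i. i \<le> n \<and> position d i \<in> \<Omega>}"
      have K: "finite K" "j \<in> K" using j j\<Omega> by (auto simp: K_def)
      define k where "k = Max K"
      have "k \<in> K" unfolding k_def using K by (intro Max_in) auto
      then have k: "k \<le> n" "position d k \<in> \<Omega>" by (auto simp: K_def)
      with out have kn: "k < n" by (metis le_neq_implies_less)
      have after: "\<xi> (position d i) \<le> m - g" if "k < i" "i \<le> n" for i
      proof -
        have "i \<notin> K" using that Max_ge[OF K(1), of i] by (auto simp: k_def)
        then show ?thesis using small[of i] that m by (auto simp: K_def)
      qed
      have "A \<le> collected \<xi> h d (Suc k) + (jump_time h n - jump_time h (Suc k)) * (m - g)
          + (t - jump_time h n) * (m - g)"
        unfolding A_def using collected_le[of h "Suc k" n \<xi> d "m - g", OF pos] kn after n(1)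
        by (intro add_mono mult_left_mono) auto
      also have "\<dots> = collected \<xi> h d k + h k * m + (t - jump_time h (Suc k)) * (m - g)"
        using \<Omega>[OF k(2)] by (simp add: collected_Suc algebra_simps)
      finally have A: "A \<le> collected \<xi> h d k + h k * m + (t - jump_time h (Suc k)) * (m - g)" .
      have "jump_time h k \<le> t" "jump_time h (Suc k) \<le> t"
        using mono[of k n] mono[of "Suc k" n] kn n by auto
      then have "(\<Sum>k. path_mass \<xi> t (- \<Omega>) k X) \<le> detour_mass \<xi> t \<Omega> m g k X"
        using A k out by (simp add: lhs detour_mass_def h_def d_def indicator_def ennreal_leI)
      also have "\<dots> \<le> (\<Sum>k. detour_mass \<xi> t \<Omega> m g k X)"
        using sum_le_suminf[of "\<lambda>k. detour_mass \<xi> t \<Omega> m g k X" "{k}"] by (simp add: summableI)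
      finally show ?thesis by (rule order_trans) simp
    qed
  qed
qed

text \<open>
Both sides are averaged over the holding time at the \<open>k\<close>-th position only, everything before being
frozen: on the left this position is left before \<open>t\<close> and the remaining time is charged at \<open>m - g\<close>,
on the right the path is still there at time \<open>t\<close>.
\<close>

lemma detour_mass_le:
  assumes g: "2 < g" and \<Omega>: "\<And>z. z \<in> \<Omega> \<Longrightarrow> \<xi> z = m"
  shows "(\<integral>\<^sup>+X. detour_mass \<xi> t \<Omega> m g k X \<partial>walk_space)
    \<le> ennreal (2 / (g - 2)) * (\<integral>\<^sup>+X. path_mass \<xi> t \<Omega> k X \<partial>walk_space)"
proof -
  interpret H: prob_space hold_space by (rule prob_space_hold_space)
  interpret S: prob_space step_space by (rule prob_space_step_space)
  interpret P: pair_sigma_finite hold_space step_space ..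
  have fub: "(\<integral>\<^sup>+X. F X \<partial>walk_space) = (\<integral>\<^sup>+d. \<integral>\<^sup>+h. \<integral>\<^sup>+x. F (h(k := x), d) \<partial>hold_law \<partial>hold_space \<partial>step_space)"
    if [measurable]: "F \<in> borel_measurable (hold_space \<Otimes>\<^sub>M step_space)" for F
  proof -
    have "(\<integral>\<^sup>+X. F X \<partial>walk_space) = (\<integral>\<^sup>+d. \<integral>\<^sup>+h. F (h, d) \<partial>hold_space \<partial>step_space)"
      unfolding walk_space_eq by (rule P.nn_integral_snd[symmetric]) measurable
    also have "\<dots> = (\<integral>\<^sup>+d. \<integral>\<^sup>+h. \<integral>\<^sup>+x. F (h(k := x), d) \<partial>hold_law \<partial>hold_space \<partial>step_space)"
      by (rule nn_integral_cong, rule nn_integral_resample_hold) measurable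
    finally show ?thesis .
  qed
  have main: "(\<integral>\<^sup>+x. detour_mass \<xi> t \<Omega> m g k (h(k := x), d) \<partial>hold_law)
    \<le> ennreal (2 / (g - 2)) * (\<integral>\<^sup>+x. path_mass \<xi> t \<Omega> k (h(k := x), d) \<partial>hold_law)" for h d
  proof (cases "jump_time h k \<le> t \<and> position d k \<in> \<Omega>")
    case False
    then have "detour_mass \<xi> t \<Omega> m g k (h(k := x), d) = 0" for x
      by (auto simp: detour_mass_def)
    then show ?thesis by simp
  next
    case True
    define \<tau> where "\<tau> = t - jump_time h k"
    define Q where "Q = collected \<xi> h d k"
    have \<tau>: "0 \<le> \<tau>" using True by (simp add: \<tau>_def)
    have "(\<integral>\<^sup>+x. detour_mass \<xi> t \<Omega> m g k (h(k := x), d) \<partial>hold_law)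
      = (\<integral>\<^sup>+x. ennreal (exp (Q + \<tau> * (m - g))) * (ennreal (exp (g * x)) * indicator {..\<tau>} x) \<partial>hold_law)"
      using True
      by (intro nn_integral_cong)
         (auto simp: detour_mass_def jump_time_Suc Q_def \<tau>_def indicator_def
           ennreal_mult[symmetric] mult_exp_exp algebra_simps)
    also have "\<dots> = ennreal (exp (Q + \<tau> * (m - g))) * (\<integral>\<^sup>+x. ennreal (exp (g * x)) * indicator {..\<tau>} x \<partial>hold_law)"
      by (rule nn_integral_cmult) measurable
    also have "\<dots> \<le> ennreal (exp (Q + \<tau> * (m - g))) * ennreal (2 / (g - 2) * exp ((g - 2) * \<tau>))"
      by (intro mult_left_mono nn_integral_hold_law_growing_exp g) auto
    also have "\<dots> = ennreal (exp (Q + \<tau> * (m - g)) * (2 / (g - 2) * exp ((g - 2) * \<tau>)))"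
      using g by (intro ennreal_mult[symmetric]) auto
    also have "exp (Q + \<tau> * (m - g)) * (2 / (g - 2) * exp ((g - 2) * \<tau>))
      = 2 / (g - 2) * (exp (Q + \<tau> * (m - g)) * exp ((g - 2) * \<tau>))" by simp
    also have "exp (Q + \<tau> * (m - g)) * exp ((g - 2) * \<tau>) = exp (Q + \<tau> * m) * exp (- 2 * \<tau>)"
      by (simp add: mult_exp_exp algebra_simps)
    also have "ennreal (2 / (g - 2) * (exp (Q + \<tau> * m) * exp (- 2 * \<tau>)))
      = ennreal (2 / (g - 2)) * (ennreal (exp (Q + \<tau> * m)) * ennreal (exp (- 2 * \<tau>)))"
      using g by (subst ennreal_mult, simp, simp, subst ennreal_mult, simp_all)
    also have "ennreal (exp (Q + \<tau> * m)) * ennreal (exp (- 2 * \<tau>))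
      = (\<integral>\<^sup>+x. ennreal (exp (Q + \<tau> * m)) * indicator {x. \<tau> < x} x \<partial>hold_law)"
      using emeasure_hold_law_greater[OF \<tau>] by (subst nn_integral_cmult_indicator) auto
    also have "\<dots> = (\<integral>\<^sup>+x. path_mass \<xi> t \<Omega> k (h(k := x), d) \<partial>hold_law)"
      using True \<Omega>
      by (intro nn_integral_cong)
         (auto simp: path_mass_def jump_time_Suc Q_def \<tau>_def indicator_def)
    finally show ?thesis .
  qed
  have "(\<integral>\<^sup>+X. detour_mass \<xi> t \<Omega> m g k X \<partial>walk_space)
    \<le> (\<integral>\<^sup>+d. \<integral>\<^sup>+h. ennreal (2 / (g - 2)) * (\<integral>\<^sup>+x. path_mass \<xi> t \<Omega> k (h(k := x), d) \<partial>hold_law) \<partial>hold_space \<partial>step_space)"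
    by (subst fub) (auto intro!: nn_integral_mono main)
  also have "\<dots> = (\<integral>\<^sup>+d. \<integral>\<^sup>+h. \<integral>\<^sup>+x. ennreal (2 / (g - 2)) * path_mass \<xi> t \<Omega> k (h(k := x), d) \<partial>hold_law \<partial>hold_space \<partial>step_space)"
  proof (intro nn_integral_cong nn_integral_cmult[symmetric])
    fix h d
    assume "d \<in> space step_space" "h \<in> space hold_space"
    then have [measurable]: "(\<lambda>x. (h(k := x), d)) \<in> hold_law \<rightarrow>\<^sub>M hold_space \<Otimes>\<^sub>M step_space"
      by (intro measurable_Pair measurable_fun_upd[where J=UNIV]) auto
    show "(\<lambda>x. path_mass \<xi> t \<Omega> k (h(k := x), d)) \<in> borel_measurable hold_law"
      by measurable
  qed
  also have "\<dots> = (\<integral>\<^sup>+X. ennreal (2 / (g - 2)) * path_mass \<xi> t \<Omega> k X \<partial>walk_space)"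
    by (rule fub[symmetric]) measurable
  also have "\<dots> = ennreal (2 / (g - 2)) * (\<integral>\<^sup>+X. path_mass \<xi> t \<Omega> k X \<partial>walk_space)"
    unfolding walk_space_eq by (rule nn_integral_cmult) measurable
  finally show ?thesis .
qed

lemma borel_measurable_nn_integral_count_space_int:
  fixes f :: "int \<Rightarrow> 'b \<Rightarrow> ennreal"
  assumes [measurable]: "\<And>y. f y \<in> borel_measurable N"
  shows "(\<lambda>x. \<integral>\<^sup>+y. f y x \<partial>count_space UNIV) \<in> borel_measurable N"
proof -
  have "(\<integral>\<^sup>+y. f y x \<partial>count_space UNIV) = (\<Sum>n. f (int_decode n) x)" for x
    using nn_integral_bij_count_space[OF bij_int_decode, of "\<lambda>y. f y x"]
    by (simp add: nn_integral_count_space_nat)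
  then show ?thesis by simp
qed

text \<open>
The integral over \<open>y\<close> bounds the first kind of paths of the dichotomy, the multiple of the mass on \<open>\<Omega>\<close> the
second kind: for each \<open>k\<close> the detours are compared with the paths that end in their \<open>k\<close>-th position in \<open>\<Omega>\<close>,
and these events are disjoint for different \<open>k\<close>.
\<close>

theorem fk_mass_outside_le:
  assumes t: "0 < t" and g: "2 < g" and \<Omega>: "\<And>z. z \<in> \<Omega> \<Longrightarrow> \<xi> z = m"
  shows "fk_mass \<xi> t (- \<Omega>) \<le>
    (\<integral>\<^sup>+y. ennreal (exp (t * (\<xi> y + g))) * emeasure hold_space {h \<in> space hold_space. jump_time h (nat \<bar>y\<bar>) \<le> t}
        * indicator (- \<Omega>) y \<partial>count_space UNIV)
    + ennreal (2 / (g - 2)) * fk_mass \<xi> t \<Omega>"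
proof -
  interpret H: prob_space hold_space by (rule prob_space_hold_space)
  interpret S: prob_space step_space by (rule prob_space_step_space)
  let ?f = "\<lambda>y X. ennreal (exp (t * (\<xi> y + g))) * indicator {X. jump_time (fst X) (nat \<bar>y\<bar>) \<le> t} X * indicator (- \<Omega>) y"
  have [measurable]: "?f y \<in> borel_measurable (hold_space \<Otimes>\<^sub>M step_space)" for y :: int
    by measurable
  have [measurable]: "(\<lambda>X. \<integral>\<^sup>+y. ?f y X \<partial>count_space UNIV) \<in> borel_measurable (hold_space \<Otimes>\<^sub>M step_space)"
    by (rule borel_measurable_nn_integral_count_space_int) measurable
  have "fk_mass \<xi> t (- \<Omega>) \<le> (\<integral>\<^sup>+X. (\<integral>\<^sup>+y. ?f y X \<partial>count_space UNIV) + (\<Sum>k. detour_mass \<xi> t \<Omega> m g k X) \<partial>walk_space)"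
    unfolding fk_mass_def
  proof (rule nn_integral_mono_AE, use AE_proper_path[OF t] in eventually_elim)
    fix X assume "proper_path t X"
    then show "(\<Sum>k. path_mass \<xi> t (- \<Omega>) k X) \<le> (\<integral>\<^sup>+y. ?f y X \<partial>count_space UNIV) + (\<Sum>k. detour_mass \<xi> t \<Omega> m g k X)"
      by (rule outside_mass_path_bound) (use t g \<Omega> in auto)
  qed
  also have "\<dots> = (\<integral>\<^sup>+X. (\<integral>\<^sup>+y. ?f y X \<partial>count_space UNIV) \<partial>walk_space) + (\<integral>\<^sup>+X. (\<Sum>k. detour_mass \<xi> t \<Omega> m g k X) \<partial>walk_space)"
    unfolding walk_space_eq by (rule nn_integral_add) (auto intro!: borel_measurable_suminf)
  also have "(\<integral>\<^sup>+X. (\<integral>\<^sup>+y. ?f y X \<partial>count_space UNIV) \<partial>walk_space) = (\<integral>\<^sup>+y. (\<integral>\<^sup>+X. ?f y X \<partial>walk_space) \<partial>count_space UNIV)"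
    unfolding walk_space_eq by (rule nn_integral_count_space_nn_integral) auto
  also have "\<dots> = (\<integral>\<^sup>+y. ennreal (exp (t * (\<xi> y + g))) * emeasure hold_space {h \<in> space hold_space. jump_time h (nat \<bar>y\<bar>) \<le> t}
        * indicator (- \<Omega>) y \<partial>count_space UNIV)"
  proof (rule nn_integral_cong)
    fix y :: int
    let ?B = "{h \<in> space hold_space. jump_time h (nat \<bar>y\<bar>) \<le> t}"
    have [measurable]: "?B \<in> sets hold_space" by measurable
    have "(\<integral>\<^sup>+X. ?f y X \<partial>walk_space) = (\<integral>\<^sup>+X. (ennreal (exp (t * (\<xi> y + g))) * indicator (- \<Omega>) y) * indicator (?B \<times> space step_space) X \<partial>walk_space)"
      by (intro nn_integral_cong) (auto simp: indicator_def walk_space_eq space_pair_measure)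
    also have "\<dots> = (ennreal (exp (t * (\<xi> y + g))) * indicator (- \<Omega>) y) * emeasure walk_space (?B \<times> space step_space)"
      unfolding walk_space_eq by (rule nn_integral_cmult_indicator) auto
    also have "emeasure walk_space (?B \<times> space step_space) = emeasure hold_space ?B"
      unfolding walk_space_eq by (subst S.emeasure_pair_measure_Times) (auto simp: S.emeasure_space_1)
    finally show "(\<integral>\<^sup>+X. ?f y X \<partial>walk_space) = ennreal (exp (t * (\<xi> y + g))) * emeasure hold_space ?B * indicator (- \<Omega>) y"
      by (simp add: mult_ac)
  qed
  also have "(\<integral>\<^sup>+X. (\<Sum>k. detour_mass \<xi> t \<Omega> m g k X) \<partial>walk_space) \<le> ennreal (2 / (g - 2)) * fk_mass \<xi> t \<Omega>"
  proof -
    have "(\<integral>\<^sup>+X. (\<Sum>k. detour_mass \<xi> t \<Omega> m g k X) \<partial>walk_space) = (\<Sum>k. \<integral>\<^sup>+X. detour_mass \<xi> t \<Omega> m g k X \<partial>walk_space)"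
      unfolding walk_space_eq by (rule nn_integral_suminf) measurable
    also have "\<dots> \<le> (\<Sum>k. ennreal (2 / (g - 2)) * (\<integral>\<^sup>+X. path_mass \<xi> t \<Omega> k X \<partial>walk_space))"
      by (intro suminf_le detour_mass_le g \<Omega>) (auto simp: summableI)
    finally show ?thesis by (simp add: fk_mass_eq_suminf)
  qed
  finally show ?thesis by (simp add: add_left_mono)
qed

text \<open>
The paths that take their first \<open>\<bar>z\<bar>\<close> steps towards \<open>z\<close>, hold at most \<open>\<theta>\<close> before each of them, and then stay
at \<open>z\<close> longer than \<open>t\<close>, have the probability given by the second and third factor; they spend at least the time \<open>t - \<bar>z\<bar> * \<theta>\<close> at \<open>z\<close>,
and the potential seen before only helps.
\<close>

lemma fk_mass_ge:
  assumes t: "0 < t" and \<theta>: "0 < \<theta>" "real (nat \<bar>z\<bar>) * \<theta> \<le> t" and \<xi>: "\<And>y. 0 \<le> \<xi> y"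
  shows "ennreal (exp ((t - real (nat \<bar>z\<bar>) * \<theta>) * \<xi> z) * ((1 - exp (- 2 * \<theta>)) / 2) ^ nat \<bar>z\<bar> * exp (- 2 * t))
    \<le> fk_mass \<xi> t {z}"
proof -
  interpret H: prob_space hold_space by (rule prob_space_hold_space)
  interpret S: prob_space step_space by (rule prob_space_step_space)
  interpret E: prob_space hold_law by (rule prob_space_hold_law)
  interpret HP: product_prob_space "\<lambda>_. hold_law" "UNIV :: nat set"
    by (rule product_prob_spaceI) (rule prob_space_hold_law)
  interpret SP: product_prob_space "\<lambda>_. measure_pmf (pmf_of_set {-1, 1::int})" "UNIV :: nat set"
    by (rule product_prob_spaceI) (rule prob_space_measure_pmf)
  define n where "n = nat \<bar>z\<bar>"
  define s :: int where "s = (if z < 0 then -1 else 1)"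
  define J where "J i = (if i < n then {..\<theta>} else {x. t < x})" for i
  have [measurable]: "J i \<in> sets borel" for i unfolding J_def by auto
  define B where "B = {h \<in> space hold_space. \<forall>i\<in>{..n}. h i \<in> J i}"
  define D where "D = {d \<in> space step_space. \<forall>i\<in>{..<n}. d i \<in> {s}}"
  have [measurable]: "B \<in> sets hold_space" unfolding B_def by measurable
  have [measurable]: "D \<in> sets step_space" unfolding D_def
    by (rule sets.sets_Collect_finite_All) (rule sets_Collect_single', auto)
  have le\<theta>: "emeasure hold_law {..\<theta>} = ennreal (1 - exp (- 2 * \<theta>))"
    using emeasure_erlang_density[of 2 0 \<theta>] \<theta> by (simp add: erlang_CDF_0)
  have "emeasure hold_space B = (\<Prod>i\<in>{..n}. emeasure hold_law (J i))"
    unfolding B_def by (rule HP.emeasure_PiM_Collect) (auto simp: J_def)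
  also have "{..n} = insert n {..<n}" by auto
  also have "(\<Prod>i\<in>insert n {..<n}. emeasure hold_law (J i)) = emeasure hold_law {x. t < x} * (\<Prod>i<n. emeasure hold_law {..\<theta>})"
    by (subst prod.insert) (auto simp: J_def)
  also have "\<dots> = ennreal (exp (- 2 * t)) * ennreal ((1 - exp (- 2 * \<theta>)) ^ n)"
    using \<theta> t by (simp only: emeasure_hold_law_greater le\<theta> less_imp_le) (simp add: ennreal_power)
  finally have B: "emeasure hold_space B = ennreal (exp (- 2 * t)) * ennreal ((1 - exp (- 2 * \<theta>)) ^ n)" .
  have "emeasure step_space D = (\<Prod>i\<in>{..<n}. emeasure (measure_pmf (pmf_of_set {-1, 1::int})) {s})"
    unfolding D_def by (rule SP.emeasure_PiM_Collect) auto
  also have "emeasure (measure_pmf (pmf_of_set {-1, 1::int})) {s} = ennreal (1 / 2)"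
    by (simp add: emeasure_pmf_single s_def)
  also have "(\<Prod>i\<in>{..<n}. ennreal (1 / 2)) = ennreal ((1 / 2) ^ n)"
    by (subst prod_ennreal) simp_all
  finally have D: "emeasure step_space D = ennreal ((1 / 2) ^ n)" .
  define c where "c = exp ((t - n * \<theta>) * \<xi> z)"
  have "ennreal c * emeasure walk_space (B \<times> D) = (\<integral>\<^sup>+X. ennreal c * indicator (B \<times> D) X \<partial>walk_space)"
    unfolding walk_space_eq by (rule nn_integral_cmult_indicator[symmetric]) auto
  also have "\<dots> \<le> fk_mass \<xi> t {z}"
    unfolding fk_mass_def
  proof (rule nn_integral_mono_AE, use AE_proper_path[OF t] in eventually_elim)
    fix X assume X: "proper_path t X"
    show "ennreal c * indicator (B \<times> D) X \<le> (\<Sum>k. path_mass \<xi> t {z} k X)"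
    proof (cases "X \<in> B \<times> D")
      case True
      define h where "h = fst X"
      define d where "d = snd X"
      have h: "\<And>i. 0 < h i" "\<And>i. i < n \<Longrightarrow> h i \<le> \<theta>" "t < h n"
        using True X by (auto simp: proper_path_def h_def B_def J_def split: if_splits)
      have d: "\<And>i. i < n \<Longrightarrow> d i = s" using True by (auto simp: d_def D_def)
      have Tn: "jump_time h n \<le> n * \<theta>"
        unfolding jump_time_def using sum_bounded_above[of "{..<n}" h \<theta>] h by simp
      moreover have "0 \<le> jump_time h n" unfolding jump_time_def using h by (intro sum_nonneg) (simp add: less_imp_le)
      ultimately have n: "jump_time h n \<le> t" "t < jump_time h (Suc n)"
        using \<theta> h by (auto simp: n_def jump_time_Suc)
      have "position d n = (\<Sum>i<n. s)" unfolding position_def by (intro sum.cong) (auto simp: d)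
      then have z: "position d n = z" by (auto simp: s_def n_def)
      have "0 \<le> collected \<xi> h d n"
        unfolding collected_def using h \<xi> by (intro sum_nonneg mult_nonneg_nonneg) (auto simp: less_imp_le)
      moreover have "(t - n * \<theta>) * \<xi> z \<le> (t - jump_time h n) * \<xi> z"
        using Tn \<xi> by (intro mult_right_mono) auto
      ultimately have "c \<le> exp (collected \<xi> h d n + (t - jump_time h n) * \<xi> (position d n))"
        by (simp add: c_def z)
      then show ?thesis
        using suminf_path_mass[OF X, of n \<xi> "{z}"] n True z by (simp add: h_def d_def ennreal_leI)
    qed simp
  qed
  also have "ennreal c * emeasure walk_space (B \<times> D)
    = ennreal c * (ennreal (exp (- 2 * t)) * ennreal ((1 - exp (- 2 * \<theta>)) ^ n) * ennreal ((1 / 2) ^ n))"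
    unfolding walk_space_eq by (subst S.emeasure_pair_measure_Times) (auto simp: B D)
  also have "\<dots> = ennreal (c * (exp (- 2 * t) * (1 - exp (- 2 * \<theta>)) ^ n * (1 / 2) ^ n))"
    using \<theta> by (simp add: ennreal_mult c_def)
  also have "c * (exp (- 2 * t) * (1 - exp (- 2 * \<theta>)) ^ n * (1 / 2) ^ n)
    = exp ((t - real (nat \<bar>z\<bar>) * \<theta>) * \<xi> z) * ((1 - exp (- 2 * \<theta>)) / 2) ^ nat \<bar>z\<bar> * exp (- 2 * t)"
    by (simp add: c_def n_def power_divide)
  finally show ?thesis .
qed

section \<open>Localisation in a fixed potential\<close>

text \<open>
Sums of the solution are sums of nonnegative terms, hence integrals over counting measure; this
carries the bounds for the extended nonnegative masses over to the real infinite sums, which would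
silently be 0 without summability.
\<close>

lemma infsum_eq_fk_mass:
  assumes fk: "feynman_kac \<xi> u" and t: "0 < t" and fin: "fk_mass \<xi> t B < \<infinity>"
  shows "u t summable_on B" "ennreal (\<Sum>\<^sub>\<infinity>z\<in>B. u t z) = fk_mass \<xi> t B"
proof -
  have nn: "0 \<le> u t z" and eq: "ennreal (u t z) = fk_mass \<xi> t {z}" for z
    using fk_mass_singleton[OF fk t] by auto
  have mass: "fk_mass \<xi> t B = (\<integral>\<^sup>+z. ennreal (u t z) \<partial>count_space B)"
    unfolding fk_mass_eq_sum[of \<xi> t B] eq[symmetric]
    by (simp add: nn_integral_count_space_indicator)
  have "integrable (count_space B) (u t)"
    by (rule integrableI_nonneg) (use nn mass fin in auto)
  then have abs: "Infinite_Set_Sum.abs_summable_on (u t) B"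
    by (simp add: Infinite_Set_Sum.abs_summable_on_def)
  then have abs': "(\<lambda>z. norm (u t z)) summable_on B"
    using abs_summable_equivalent by blast
  then show "u t summable_on B" using nn by simp
  have "(\<Sum>\<^sub>\<infinity>z\<in>B. u t z) = infsetsum (u t) B"
    using infsetsum_infsum[OF abs] by simp
  then show "ennreal (\<Sum>\<^sub>\<infinity>z\<in>B. u t z) = fk_mass \<xi> t B"
    using nn_integral_conv_infsetsum[OF abs] nn mass by simp
qed

lemma fk_mass_mono: "A \<subseteq> B \<Longrightarrow> fk_mass \<xi> t A \<le> fk_mass \<xi> t B"
  unfolding fk_mass_eq_sum[of \<xi> t A] fk_mass_eq_sum[of \<xi> t B]
  by (intro nn_integral_mono) (auto simp: indicator_def)

lemma fk_mass_finite:
  assumes fk: "feynman_kac \<xi> u" and t: "0 < t" and "finite B"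
  shows "fk_mass \<xi> t B < \<infinity>"
proof -
  have "fk_mass \<xi> t B = (\<Sum>z\<in>B. fk_mass \<xi> t {z})"
    unfolding fk_mass_eq_sum[of \<xi> t B] using assms(3)
    by (simp add: nn_integral_indicator_finite)
  also have "\<dots> < \<infinity>"
    using assms(3) fk_mass_singleton(2)[OF fk t, symmetric] by simp
  finally show ?thesis .
qed

text \<open>
If \<open>S\<close> is the mass on \<open>\<Omega>\<close> and \<open>R \<le> \<kappa> * S\<close> the mass outside, then \<open>S / (S + R)\<close> differs from 1 by
\<open>R / (S + R) \<le> \<kappa>\<close>.
\<close>

lemma mass_ratio_bound:
  assumes fk: "feynman_kac \<xi> u" and t: "0 < t" and \<Omega>: "finite \<Omega>" "z \<in> \<Omega>"
    and \<kappa>: "0 \<le> \<kappa>" and pos: "0 < u t z"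
    and le: "fk_mass \<xi> t (- \<Omega>) \<le> ennreal \<kappa> * fk_mass \<xi> t \<Omega>"
  shows "\<bar>1 / total_mass u t * (\<Sum>\<^sub>\<infinity>z\<in>\<Omega>. u t z) - 1\<bar> \<le> \<kappa>"
proof -
  have fin1: "fk_mass \<xi> t \<Omega> < \<infinity>" by (rule fk_mass_finite[OF fk t \<Omega>(1)])
  then have "ennreal \<kappa> * fk_mass \<xi> t \<Omega> < \<infinity>" by (simp add: ennreal_mult_less_top)
  then have fin2: "fk_mass \<xi> t (- \<Omega>) < \<infinity>" using le by (rule le_less_trans[rotated])
  have nn: "0 \<le> u t y" for y using fk_mass_singleton[OF fk t] by auto
  define S where "S = (\<Sum>\<^sub>\<infinity>z\<in>\<Omega>. u t z)"
  define R where "R = (\<Sum>\<^sub>\<infinity>z\<in>-\<Omega>. u t z)"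
  have S: "ennreal S = fk_mass \<xi> t \<Omega>" and R: "ennreal R = fk_mass \<xi> t (- \<Omega>)"
    unfolding S_def R_def using infsum_eq_fk_mass[OF fk t] fin1 fin2 by auto
  have R0: "0 \<le> R" unfolding R_def by (rule infsum_nonneg) (rule nn)
  have "u t z \<le> S" unfolding S_def using \<Omega> nn by (simp add: member_le_sum)
  with pos have S0: "0 < S" by simp
  have RS: "R \<le> \<kappa> * S"
    using le \<kappa> S0 R0 unfolding S[symmetric] R[symmetric] by (simp add: ennreal_mult'[symmetric])
  have "total_mass u t = (\<Sum>\<^sub>\<infinity>z\<in>\<Omega> \<union> -\<Omega>. u t z)" by (simp add: total_mass_def)
  also have "\<dots> = S + R" unfolding S_def R_def
    by (rule infsum_Un_disjoint) (use infsum_eq_fk_mass[OF fk t] fin1 fin2 in auto)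
  finally have tot: "total_mass u t = S + R" .
  have "1 / total_mass u t * S - 1 = - (R / (S + R))"
    using S0 R0 by (simp add: tot field_simps)
  then have "\<bar>1 / total_mass u t * S - 1\<bar> = R / (S + R)"
    using S0 R0 by simp
  also have "\<dots> \<le> \<kappa>"
  proof -
    have "R \<le> \<kappa> * (S + R)" using RS \<kappa> R0 by (simp add: algebra_simps add_increasing)
    then show ?thesis using S0 R0 by (simp add: divide_le_eq)
  qed
  finally show ?thesis by (simp add: S_def)
qed

text \<open>
The holding time \<open>\<theta> = 1 / \<xi> z\<close> balances the loss \<open>\<theta> * \<xi> z\<close> per step against the cost \<open>ln \<theta>\<close> of hurrying; the
latter adds up to the second term of the score.
\<close>

lemma fk_mass_maximiser_ge:
  assumes t: "0 < t" and \<xi>: "\<And>y. 1 \<le> \<xi> y" and z: "\<bar>real_of_int z\<bar> \<le> t * \<xi> z"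
  shows "ennreal (exp (t * \<Psi> \<xi> t z - 3 * \<bar>real_of_int z\<bar> - 2 * t)) \<le> fk_mass \<xi> t {z}"
proof -
  define n where "n = nat \<bar>z\<bar>"
  have n: "real n = \<bar>real_of_int z\<bar>" by (simp add: n_def)
  define \<theta> where "\<theta> = 1 / \<xi> z"
  have \<xi>z: "1 \<le> \<xi> z" by (rule \<xi>)
  have \<theta>: "0 < \<theta>" "\<theta> \<le> 1" using \<xi>z by (auto simp: \<theta>_def)
  have base: "\<theta> * exp (- 2) \<le> (1 - exp (- 2 * \<theta>)) / 2"
  proof -
    have "2 * \<theta> \<le> exp (2 * \<theta>) - 1" using exp_ge_add_one_self[of "2 * \<theta>"] by linarith
    then have "exp (- 2 * \<theta>) * (2 * \<theta>) \<le> exp (- 2 * \<theta>) * (exp (2 * \<theta>) - 1)"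
      by (intro mult_left_mono) auto
    also have "\<dots> = 1 - exp (- 2 * \<theta>)" by (simp add: algebra_simps mult_exp_exp)
    finally have "exp (- 2 * \<theta>) * \<theta> \<le> (1 - exp (- 2 * \<theta>)) / 2" by simp
    moreover have "exp (- 2) * \<theta> \<le> exp (- 2 * \<theta>) * \<theta>" using \<theta> by (intro mult_right_mono) auto
    ultimately show ?thesis by (simp add: mult.commute)
  qed
  have th: "\<theta> = exp (- ln (\<xi> z))" using \<xi>z by (simp add: \<theta>_def exp_minus field_simps)
  have "exp (t * \<Psi> \<xi> t z - 3 * \<bar>real_of_int z\<bar> - 2 * t)
    = exp ((t - n * \<theta>) * \<xi> z) * (\<theta> * exp (- 2)) ^ n * exp (- 2 * t)"
  proof -
    have e1: "(\<theta> * exp (- 2)) ^ n = exp (real n * (- ln (\<xi> z) - 2))"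
      unfolding th by (simp add: mult_exp_exp exp_of_nat_mult[symmetric])
    have "\<theta> * \<xi> z = 1" using \<xi>z by (simp add: \<theta>_def)
    then have e2: "(t - n * \<theta>) * \<xi> z = t * \<xi> z - n" by (simp add: left_diff_distrib)
    have e3: "t * \<Psi> \<xi> t z = t * \<xi> z - n * ln (\<xi> z)"
      using t by (simp add: \<Psi>_def n field_simps)
    show ?thesis unfolding e1 e2 e3 mult_exp_exp by (simp add: n algebra_simps)
  qed
  also have "\<dots> \<le> exp ((t - n * \<theta>) * \<xi> z) * ((1 - exp (- 2 * \<theta>)) / 2) ^ n * exp (- 2 * t)"
    using \<theta> base by (intro mult_right_mono mult_left_mono power_mono) auto
  finally have "ennreal (exp (t * \<Psi> \<xi> t z - 3 * \<bar>real_of_int z\<bar> - 2 * t))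
    \<le> ennreal (exp ((t - n * \<theta>) * \<xi> z) * ((1 - exp (- 2 * \<theta>)) / 2) ^ n * exp (- 2 * t))"
    by (rule ennreal_leI)
  also have "\<dots> \<le> fk_mass \<xi> t {z}"
    unfolding n_def
  proof (rule fk_mass_ge[OF t \<theta>(1)])
    show "real (nat \<bar>z\<bar>) * \<theta> \<le> t"
      using z \<xi>z by (simp add: n[unfolded n_def] \<theta>_def divide_le_eq)
    show "\<And>y. 0 \<le> \<xi> y" using \<xi> by (meson order.trans zero_le_one)
  qed
  finally show ?thesis .
qed

text \<open>
Two geometric series with ratio \<open>exp (- 1) \<le> 1 / 2\<close>.
\<close>

lemma nn_integral_exp_abs_int: "(\<integral>\<^sup>+y. ennreal (exp (- \<bar>real_of_int y\<bar>)) \<partial>count_space UNIV) \<le> 4"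
proof -
  have half: "(\<integral>\<^sup>+y. ennreal (exp (- \<bar>real_of_int y\<bar>)) * indicator (range (\<lambda>n::nat. c * int n)) y \<partial>count_space UNIV) \<le> 2"
    if c: "\<bar>c\<bar> = 1" for c
  proof -
    have inj: "inj (\<lambda>n::nat. c * int n)" using c by (auto simp: inj_on_def)
    have "(\<integral>\<^sup>+y. ennreal (exp (- \<bar>real_of_int y\<bar>)) * indicator (range (\<lambda>n::nat. c * int n)) y \<partial>count_space UNIV)
      = (\<integral>\<^sup>+y. ennreal (exp (- \<bar>real_of_int y\<bar>)) \<partial>count_space (range (\<lambda>n::nat. c * int n)))"
      by (simp add: nn_integral_count_space_indicator)
    also have "\<dots> = (\<integral>\<^sup>+n. ennreal (exp (- \<bar>real_of_int (c * int n)\<bar>)) \<partial>count_space UNIV)"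
      by (rule nn_integral_bij_count_space[symmetric]) (simp add: bij_betw_def inj)
    also have "\<dots> = (\<Sum>n. ennreal (exp (- 1) ^ n))"
    proof -
      have "\<bar>real_of_int c\<bar> = 1" using c by linarith
      then show ?thesis
        by (simp add: nn_integral_count_space_nat abs_mult exp_of_nat_mult[symmetric])
    qed
    also have "\<dots> = ennreal (1 / (1 - exp (- 1)))"
      by (subst suminf_ennreal2) (auto simp: suminf_geometric intro!: summable_geometric)
    also have "\<dots> \<le> ennreal 2"
    proof (rule ennreal_leI)
      have "2 \<le> exp (1::real)" using exp_ge_add_one_self[of 1] by simp
      then have "exp (- 1) \<le> (1 / 2 :: real)" by (simp add: exp_minus field_simps)
      then show "1 / (1 - exp (- 1)) \<le> (2::real)" by (simp add: divide_le_eq)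
    qed
    finally show ?thesis by simp
  qed
  have cover: "y \<in> range (\<lambda>n::nat. 1 * int n) \<or> y \<in> range (\<lambda>n::nat. -1 * int n)" for y :: int
  proof (cases "0 \<le> y")
    case True then have "y = 1 * int (nat y)" by simp
    then show ?thesis by blast
  next
    case False then have "y = - 1 * int (nat (- y))" by simp
    then show ?thesis by blast
  qed
  have "(\<integral>\<^sup>+y. ennreal (exp (- \<bar>real_of_int y\<bar>)) \<partial>count_space UNIV)
    \<le> (\<integral>\<^sup>+y. ennreal (exp (- \<bar>real_of_int y\<bar>)) * indicator (range (\<lambda>n::nat. 1 * int n)) y
        + ennreal (exp (- \<bar>real_of_int y\<bar>)) * indicator (range (\<lambda>n::nat. -1 * int n)) y \<partial>count_space UNIV)"
  proof (rule nn_integral_mono)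
    fix y :: int
    show "ennreal (exp (- \<bar>real_of_int y\<bar>)) \<le> ennreal (exp (- \<bar>real_of_int y\<bar>)) * indicator (range (\<lambda>n::nat. 1 * int n)) y
        + ennreal (exp (- \<bar>real_of_int y\<bar>)) * indicator (range (\<lambda>n::nat. -1 * int n)) y"
      using cover[of y] by (auto simp del: mult_1 mult_minus1)
  qed
  also have "\<dots> = (\<integral>\<^sup>+y. ennreal (exp (- \<bar>real_of_int y\<bar>)) * indicator (range (\<lambda>n::nat. 1 * int n)) y \<partial>count_space UNIV)
        + (\<integral>\<^sup>+y. ennreal (exp (- \<bar>real_of_int y\<bar>)) * indicator (range (\<lambda>n::nat. -1 * int n)) y \<partial>count_space UNIV)"
    by (rule nn_integral_add) auto
  also have "\<dots> \<le> 2 + 2" by (intro add_mono half) auto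
  finally show ?thesis by simp
qed

lemma int_box_eq: "{y::int. \<bar>real_of_int y\<bar> \<le> R} = {- \<lfloor>R\<rfloor>..\<lfloor>R\<rfloor>}"
  by (auto simp: le_floor_iff abs_le_iff minus_le_iff)

lemma finite_int_box [simp]: "finite {y::int. \<bar>real_of_int y\<bar> \<le> R}"
  by (simp add: int_box_eq)

lemma card_int_box_le:
  assumes "0 \<le> R"
  shows "real (card {y::int. \<bar>real_of_int y\<bar> \<le> R}) \<le> 2 * R + 1"
  unfolding int_box_eq using assms by simp

text \<open>
Sites outside \<open>\<Omega>\<close> are split into those in the box of radius \<open>R\<close>, where the score gap \<open>D\<close> is used, and the
far ones, which by \<open>far\<close> contribute at most \<open>exp (- \<bar>y\<bar>)\<close> each. The first two error terms are these
contributions divided by the lower bound for the mass at the maximiser \<open>z\<close>; the term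
\<open>R * ln (2 * exp 1 * B * t / r) + r\<close> is the price for replacing the jump probability
\<open>(2 * exp 1 * t / \<bar>y\<bar>) ^ \<bar>y\<bar>\<close> by the factor \<open>exp (- \<bar>y\<bar> * ln (\<xi> y))\<close> of the score, with \<open>\<xi> y \<le> B\<close>
and \<open>r\<close> a free reference scale for \<open>\<bar>y\<bar>\<close>. The last term comes from the detours.
\<close>

lemma localisation_in_environment:
  assumes fk: "feynman_kac \<xi> u" and t: "0 < t" and \<xi>: "\<And>y. 1 \<le> \<xi> y"
    and \<Omega>: "finite \<Omega>" "z \<in> \<Omega>" "\<And>y. y \<in> \<Omega> \<Longrightarrow> \<xi> y = \<xi> z"
    and z: "\<bar>real_of_int z\<bar> \<le> R" "R \<le> t * \<xi> z"
    and gap: "\<And>y. \<bar>real_of_int y\<bar> \<le> R \<Longrightarrow> y \<notin> \<Omega> \<Longrightarrow> \<Psi> \<xi> t y \<le> \<Psi> \<xi> t z - D"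
    and bound: "\<And>y. \<bar>real_of_int y\<bar> \<le> R \<Longrightarrow> \<xi> y \<le> B"
    and far: "\<And>y. R < \<bar>real_of_int y\<bar> \<Longrightarrow>
      t * \<xi> y + t * g + \<bar>real_of_int y\<bar> \<le> \<bar>real_of_int y\<bar> * ln (\<bar>real_of_int y\<bar> / (2 * exp 1 * t))"
    and r: "0 < r" "1 \<le> 2 * exp 1 * B * t / r" and g: "2 < g"
  shows "\<bar>1 / total_mass u t * (\<Sum>\<^sub>\<infinity>z\<in>\<Omega>. u t z) - 1\<bar> \<le>
    (2 * R + 1) * exp (- t * D + t * g + R * ln (2 * exp 1 * B * t / r) + r + 3 * R + 2 * t)
    + 4 * exp (- t * \<Psi> \<xi> t z + 3 * R + 2 * t) + 2 / (g - 2)"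
proof -
  interpret H: prob_space hold_space by (rule prob_space_hold_space)
  have R0: "0 \<le> R" using z(1) by linarith
  define S where "S = R * ln (2 * exp 1 * B * t / r) + r"
  define E where "E = exp (t * (\<Psi> \<xi> t z - D) + t * g + S)"
  define l where "l = exp (t * \<Psi> \<xi> t z - 3 * R - 2 * t)"
  let ?p = "\<lambda>y::int. emeasure hold_space {h \<in> space hold_space. jump_time h (nat \<bar>y\<bar>) \<le> t}"
  let ?box = "{y::int. \<bar>real_of_int y\<bar> \<le> R}"
  have p: "?p y \<le> ennreal ((2 * exp 1 * t / \<bar>real_of_int y\<bar>) ^ nat \<bar>y\<bar>)" if "y \<noteq> 0" for y
    using prob_jump_time_le[of "nat \<bar>y\<bar>" t] t that by simp
  have pe: "(2 * exp 1 * t / \<bar>real_of_int y\<bar>) ^ nat \<bar>y\<bar> = exp (- \<bar>real_of_int y\<bar> * ln (\<bar>real_of_int y\<bar> / (2 * exp 1 * t)))"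
    if "y \<noteq> 0" for y
  proof -
    have "(2 * exp 1 * t / \<bar>real_of_int y\<bar>) ^ nat \<bar>y\<bar> = exp (real (nat \<bar>y\<bar>) * ln (2 * exp 1 * t / \<bar>real_of_int y\<bar>))"
      unfolding exp_of_nat_mult using t that by simp
    also have "ln (2 * exp 1 * t / \<bar>real_of_int y\<bar>) = - ln (\<bar>real_of_int y\<bar> / (2 * exp 1 * t))"
      using t that by (simp add: ln_div)
    finally show ?thesis by simp
  qed
  have term_bound: "ennreal (exp (t * (\<xi> y + g))) * ?p y * indicator (- \<Omega>) y
      \<le> ennreal E * indicator ?box y + ennreal (exp (- \<bar>real_of_int y\<bar>))" for y
  proof (cases "y \<in> \<Omega>")
    case True then show ?thesis by simp
  next
    case out: False
    show ?thesis
    proof (cases "\<bar>real_of_int y\<bar> \<le> R")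
      case True
      have "ennreal (exp (t * (\<xi> y + g))) * ?p y \<le> ennreal E"
      proof (cases "y = 0")
        case y: True
        have "\<xi> y \<le> \<Psi> \<xi> t z - D" using gap[OF True out] y by (simp add: \<Psi>_def)
        then have "t * \<xi> y \<le> t * (\<Psi> \<xi> t z - D)" using t by (intro mult_left_mono) auto
        moreover have "0 \<le> S" unfolding S_def using R0 r by simp
        ultimately have E: "exp (t * (\<xi> y + g)) \<le> E" by (simp add: E_def algebra_simps)
        have "ennreal (exp (t * (\<xi> y + g))) * ?p y \<le> ennreal (exp (t * (\<xi> y + g))) * 1"
          by (intro mult_left_mono H.emeasure_le_1) auto
        also have "\<dots> \<le> ennreal E" using E by (simp add: ennreal_leI)
        finally show ?thesis .
      next
        case y: False
        define n where "n = \<bar>real_of_int y\<bar>"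
        have n: "0 < n" "n \<le> R" using y True by (auto simp: n_def)
        have \<xi>y: "1 \<le> \<xi> y" by (rule \<xi>)
        have ln1: "ln (n / (2 * exp 1 * t)) = ln n - ln (2 * exp 1 * t)"
          using t n by (simp add: ln_div)
        have ln2: "ln (2 * exp 1 * B * t / r) = ln (2 * exp 1 * t) + ln B - ln r"
        proof -
          have "0 < B" using bound[OF True] \<xi>y by linarith
          then show ?thesis using t r by (simp add: ln_div ln_mult)
        qed
        \<comment> \<open>This removes the dependence on n from the logarithm, also for n much smaller than r.\<close>
        have "n * ln (r / n) \<le> n * (r / n - 1)" using n r by (intro mult_left_mono ln_le_minus_one) auto
        also have "\<dots> \<le> r" using n by (simp add: field_simps)
        finally have "n * (ln r - ln n) \<le> r" using n r by (simp add: ln_div)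
        moreover have "n * ln (2 * exp 1 * B * t / r) \<le> R * ln (2 * exp 1 * B * t / r)"
          using n r by (intro mult_right_mono) auto
        moreover have "n * ln (\<xi> y) \<le> n * ln B"
          using n bound[OF True] \<xi>y by (intro mult_left_mono) auto
        ultimately have "n * ln (\<xi> y) - n * ln (n / (2 * exp 1 * t)) \<le> S"
          unfolding S_def ln1 ln2 by (simp add: algebra_simps)
        moreover have "t * \<Psi> \<xi> t y = t * \<xi> y - n * ln (\<xi> y)"
          using t by (simp add: \<Psi>_def n_def field_simps)
        moreover have "t * \<Psi> \<xi> t y \<le> t * (\<Psi> \<xi> t z - D)"
          using gap[OF True out] t by (intro mult_left_mono) auto
        ultimately have le: "t * (\<xi> y + g) + - n * ln (n / (2 * exp 1 * t)) \<le> t * (\<Psi> \<xi> t z - D) + t * g + S"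
          by (simp add: algebra_simps)
        have "ennreal (exp (t * (\<xi> y + g))) * ?p y \<le> ennreal (exp (t * (\<xi> y + g))) * ennreal (exp (- n * ln (n / (2 * exp 1 * t))))"
          unfolding n_def pe[OF y, symmetric] by (intro mult_left_mono p y) auto
        also have "\<dots> = ennreal (exp (t * (\<xi> y + g) + - n * ln (n / (2 * exp 1 * t))))"
          by (simp add: ennreal_mult[symmetric] mult_exp_exp)
        also have "\<dots> \<le> ennreal E" unfolding E_def using le by (intro ennreal_leI) simp
        finally show ?thesis .
      qed
      then show ?thesis using True out by (simp add: add_increasing2)
    next
      case False
      then have y: "y \<noteq> 0" using R0 by auto
      have "ennreal (exp (t * (\<xi> y + g))) * ?p y \<le> ennreal (exp (t * (\<xi> y + g))) * ennreal (exp (- \<bar>real_of_int y\<bar> * ln (\<bar>real_of_int y\<bar> / (2 * exp 1 * t))))"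
        unfolding pe[OF y, symmetric] by (intro mult_left_mono p y) auto
      also have "\<dots> = ennreal (exp (t * (\<xi> y + g) + - \<bar>real_of_int y\<bar> * ln (\<bar>real_of_int y\<bar> / (2 * exp 1 * t))))"
        by (simp add: ennreal_mult[symmetric] mult_exp_exp)
      also have "\<dots> \<le> ennreal (exp (- \<bar>real_of_int y\<bar>))"
        using far[of y] False by (intro ennreal_leI) (simp add: algebra_simps)
      finally show ?thesis using out False by simp
    qed
  qed
  have card: "real (card ?box) \<le> 2 * R + 1" by (rule card_int_box_le[OF R0])
  have "(\<integral>\<^sup>+y. ennreal (exp (t * (\<xi> y + g))) * ?p y * indicator (- \<Omega>) y \<partial>count_space UNIV)
    \<le> (\<integral>\<^sup>+y. ennreal E * indicator ?box y + ennreal (exp (- \<bar>real_of_int y\<bar>)) \<partial>count_space UNIV)"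
    by (intro nn_integral_mono term_bound)
  also have "\<dots> = (\<integral>\<^sup>+y. ennreal E * indicator ?box y \<partial>count_space UNIV) + (\<integral>\<^sup>+y. ennreal (exp (- \<bar>real_of_int y\<bar>)) \<partial>count_space UNIV)"
    by (rule nn_integral_add) auto
  also have "(\<integral>\<^sup>+y. ennreal E * indicator ?box y \<partial>count_space UNIV) = ennreal E * emeasure (count_space UNIV) ?box"
    by (rule nn_integral_cmult_indicator) auto
  also have "emeasure (count_space UNIV) ?box = ennreal (real (card ?box))"
    by (simp add: ennreal_of_nat_eq_real_of_nat)
  also have "ennreal E * ennreal (real (card ?box)) + (\<integral>\<^sup>+y. ennreal (exp (- \<bar>real_of_int y\<bar>)) \<partial>count_space UNIV)
    \<le> ennreal E * ennreal (2 * R + 1) + ennreal 4"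
    using card nn_integral_exp_abs_int by (intro add_mono mult_left_mono ennreal_leI) auto
  also have "\<dots> = ennreal (E * (2 * R + 1) + 4)"
    using R0 by (simp add: ennreal_mult E_def)
  finally have sum_bound: "(\<integral>\<^sup>+y. ennreal (exp (t * (\<xi> y + g))) * ?p y * indicator (- \<Omega>) y \<partial>count_space UNIV)
    \<le> ennreal (E * (2 * R + 1) + 4)" .
  have "ennreal l \<le> ennreal (exp (t * \<Psi> \<xi> t z - 3 * \<bar>real_of_int z\<bar> - 2 * t))"
    unfolding l_def using z by (intro ennreal_leI) auto
  also have "\<dots> \<le> fk_mass \<xi> t {z}"
    by (rule fk_mass_maximiser_ge) (use t \<xi> z in auto)
  finally have lz: "ennreal l \<le> fk_mass \<xi> t {z}" .
  have l\<Omega>: "ennreal l \<le> fk_mass \<xi> t \<Omega>"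
    using lz by (rule order.trans) (use \<Omega> in \<open>auto intro!: fk_mass_mono\<close>)
  have l0: "0 < l" by (simp add: l_def)
  have uz: "0 < u t z"
    using lz l0 fk_mass_singleton[OF fk t, of z] by (metis ennreal_le_iff ennreal_less_zero_iff less_le_trans not_less)
  define \<rho> where "\<rho> = (E * (2 * R + 1) + 4) / l"
  have \<rho>0: "0 \<le> \<rho>" unfolding \<rho>_def using l0 R0 by (simp add: E_def)
  have "fk_mass \<xi> t (- \<Omega>) \<le> ennreal (E * (2 * R + 1) + 4) + ennreal (2 / (g - 2)) * fk_mass \<xi> t \<Omega>"
    by (rule order.trans[OF fk_mass_outside_le[OF t g \<Omega>(3)]]) (use sum_bound in \<open>auto intro: add_right_mono\<close>)
  also have "ennreal (E * (2 * R + 1) + 4) = ennreal \<rho> * ennreal l"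
    using l0 \<rho>0 by (simp add: ennreal_mult'[symmetric] \<rho>_def)
  also have "ennreal \<rho> * ennreal l + ennreal (2 / (g - 2)) * fk_mass \<xi> t \<Omega>
    \<le> ennreal \<rho> * fk_mass \<xi> t \<Omega> + ennreal (2 / (g - 2)) * fk_mass \<xi> t \<Omega>"
    by (intro add_right_mono mult_left_mono l\<Omega>) auto
  also have "\<dots> = ennreal (\<rho> + 2 / (g - 2)) * fk_mass \<xi> t \<Omega>"
    using \<rho>0 g by (simp add: distrib_right)
  finally have "\<bar>1 / total_mass u t * (\<Sum>\<^sub>\<infinity>z\<in>\<Omega>. u t z) - 1\<bar> \<le> \<rho> + 2 / (g - 2)"
    by (intro mass_ratio_bound[OF fk t \<Omega>(1,2) _ uz]) (use \<rho>0 g in auto)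
  also have "\<rho> = (2 * R + 1) * (E / l) + 4 * (1 / l)" by (simp add: \<rho>_def add_divide_distrib)
  also have "E / l = exp (- t * D + t * g + R * ln (2 * exp 1 * B * t / r) + r + 3 * R + 2 * t)"
    unfolding E_def l_def exp_diff[symmetric] S_def by (simp add: algebra_simps)
  also have "1 / l = exp (- t * \<Psi> \<xi> t z + 3 * R + 2 * t)"
    unfolding l_def by (simp add: exp_minus[symmetric] divide_inverse algebra_simps)
  finally show ?thesis .
qed

section \<open>Pareto variables\<close>

lemma powr_minus_diff_le:
  fixes \<alpha> :: real
  assumes "0 < \<alpha>" "0 < u" "u \<le> v"
  shows "u powr (- \<alpha>) - v powr (- \<alpha>) \<le> (v - u) * (\<alpha> * u powr (- \<alpha> - 1))"
proof (cases "u = v")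
  case False
  then have uv: "u < v" using assms by simp
  have "\<exists>z>u. z < v \<and> v powr (- \<alpha>) - u powr (- \<alpha>) = (v - u) * (- \<alpha> * z powr (- \<alpha> - 1))"
  proof (rule MVT2[OF uv])
    fix x assume "u \<le> x" "x \<le> v"
    then show "((\<lambda>z. z powr (- \<alpha>)) has_real_derivative - \<alpha> * x powr (- \<alpha> - 1)) (at x)"
      using assms by (intro has_real_derivative_powr) auto
  qed
  then obtain z where z: "u < z" "z < v"
    "v powr (- \<alpha>) - u powr (- \<alpha>) = (v - u) * (- \<alpha> * z powr (- \<alpha> - 1))" by auto
  have "z powr (- \<alpha> - 1) \<le> u powr (- \<alpha> - 1)"
    using z assms by (intro powr_mono2') auto
  then have "(v - u) * (\<alpha> * z powr (- \<alpha> - 1)) \<le> (v - u) * (\<alpha> * u powr (- \<alpha> - 1))"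
    using uv assms by (intro mult_left_mono) auto
  then show ?thesis using z(3) by (simp add: algebra_simps)
qed simp

text \<open>
Each term is at most the increment of \<open>x powr (1 - \<alpha>) / (1 - \<alpha>)\<close> over the unit interval to its left;
these increments telescope.
\<close>

lemma powr_tail_sum:
  fixes \<alpha> :: real and N :: nat
  assumes "1 < \<alpha>" "1 \<le> N"
  shows "summable (\<lambda>i. real (N + 1 + i) powr (- \<alpha>))"
    and "(\<Sum>i. real (N + 1 + i) powr (- \<alpha>)) \<le> real N powr (1 - \<alpha>) / (\<alpha> - 1)"
proof -
  define f where "f i = real (N + i) powr (1 - \<alpha>) / (\<alpha> - 1)" for i
  have "((\<lambda>i. real (N + i) powr (1 - \<alpha>)) \<longlonglongrightarrow> 0)"
    by (rule tendsto_neg_powr) (use assms in simp, real_asymp)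
  then have "f \<longlonglongrightarrow> 0 / (\<alpha> - 1)" unfolding f_def by (intro tendsto_divide tendsto_const) (use assms in auto)
  then have tel: "(\<lambda>i. f i - f (Suc i)) sums f 0" using telescope_sums'[of f 0] by simp
  have le: "real (N + 1 + i) powr (- \<alpha>) \<le> f i - f (Suc i)" for i
  proof -
    have "\<exists>z>real (N + i). z < real (N + i) + 1 \<and> (real (N + i) + 1) powr (1 - \<alpha>) - real (N + i) powr (1 - \<alpha>)
      = (real (N + i) + 1 - real (N + i)) * ((1 - \<alpha>) * z powr (1 - \<alpha> - 1))"
    proof (rule MVT2)
      fix x assume "real (N + i) \<le> x"
      then show "((\<lambda>z. z powr (1 - \<alpha>)) has_real_derivative (1 - \<alpha>) * x powr (1 - \<alpha> - 1)) (at x)"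
        using assms by (intro has_real_derivative_powr) auto
    qed simp
    then obtain z where z: "real (N + i) < z" "z < real (N + i) + 1"
      "(real (N + i) + 1) powr (1 - \<alpha>) - real (N + i) powr (1 - \<alpha>) = (1 - \<alpha>) * z powr (- \<alpha>)"
      by auto
    have "real (N + 1 + i) powr (- \<alpha>) \<le> z powr (- \<alpha>)"
      using z assms by (intro powr_mono2') auto
    also have "z powr (- \<alpha>) = (real (N + i) powr (1 - \<alpha>) - (real (N + i) + 1) powr (1 - \<alpha>)) / (\<alpha> - 1)"
      using z(3) assms by (simp add: field_simps)
    finally show ?thesis by (simp add: f_def diff_divide_distrib add_ac)
  qed
  show sm: "summable (\<lambda>i. real (N + 1 + i) powr (- \<alpha>))"
    by (rule summable_comparison_test'[of "\<lambda>i. f i - f (Suc i)" 0]) (use tel le in \<open>auto simp: sums_iff\<close>)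
  have "(\<Sum>i. real (N + 1 + i) powr (- \<alpha>)) \<le> f 0"
    using suminf_le[OF le sm] tel by (auto simp: sums_iff)
  then show "(\<Sum>i. real (N + 1 + i) powr (- \<alpha>)) \<le> real N powr (1 - \<alpha>) / (\<alpha> - 1)"
    by (simp add: f_def)
qed

context duplicated_pareto
begin

lemma measurable_pareto [measurable]: "\<xi>0 z \<in> borel_measurable M"
proof -
  have "Inl z \<in> UNIV <+> {1..}" by auto
  then have "random_variable borel (case_sum \<xi>0 (\<lambda>n \<omega>. of_bool (dup n \<omega>) :: real) (Inl z))"
    using indep unfolding indep_vars_def by (rule bspec[OF conjunct1, rotated])
  then show ?thesis by simp
qed

lemma measurable_dup:
  assumes "1 \<le> n"
  shows "Measurable.pred M (dup n)"
proof -
  have "Inr n \<in> UNIV <+> {1..}" using assms by auto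
  then have "random_variable borel (case_sum \<xi>0 (\<lambda>n \<omega>. of_bool (dup n \<omega>) :: real) (Inr n))"
    using indep unfolding indep_vars_def by (rule bspec[OF conjunct1, rotated])
  then have "(\<lambda>\<omega>. of_bool (dup n \<omega>) :: real) \<in> borel_measurable M"
    by (simp only: sum.case)
  then have "(\<lambda>\<omega>. of_bool (dup n \<omega>) :: real) -` {1} \<inter> space M \<in> sets M"
    by (rule measurable_sets) simp
  then show ?thesis by (simp add: pred_def vimage_def Int_def conj_commute)
qed

lemma prob_pareto_greater:
  assumes "1 \<le> x"
  shows "prob {\<omega> \<in> space M. x < \<xi>0 z \<omega>} = x powr (- \<alpha>)"
proof -
  have "{\<omega> \<in> space M. x < \<xi>0 z \<omega>} = space M - {\<omega> \<in> space M. \<xi>0 z \<omega> \<le> x}" by auto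
  then show ?thesis using prob_compl[of "{\<omega> \<in> space M. \<xi>0 z \<omega> \<le> x}"] pareto[OF assms, of z] by simp
qed

lemma prob_pareto_ge:
  assumes "2 \<le> x"
  shows "prob {\<omega> \<in> space M. x \<le> \<xi>0 z \<omega>} \<le> (x / 2) powr (- \<alpha>)"
proof -
  have "prob {\<omega> \<in> space M. x \<le> \<xi>0 z \<omega>} \<le> prob {\<omega> \<in> space M. x / 2 < \<xi>0 z \<omega>}"
    using assms by (intro finite_measure_mono) auto
  then show ?thesis using prob_pareto_greater[of "x / 2" z] assms by simp
qed

lemma AE_pareto_ge_1: "AE \<omega> in M. \<forall>z. 1 < \<xi>0 z \<omega>"
  unfolding AE_all_countable
proof
  fix z
  have "prob {\<omega> \<in> space M. 1 < \<xi>0 z \<omega>} = 1" using prob_pareto_greater[of 1 z] by simp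
  then have "AE \<omega> in M. \<omega> \<in> {\<omega> \<in> space M. 1 < \<xi>0 z \<omega>}" by (subst (asm) prob_eq_1) auto
  then show "AE \<omega> in M. 1 < \<xi>0 z \<omega>" by auto
qed

text \<open>
The density of a Pareto variable is at most \<open>\<alpha> * (b / 2) powr (- \<alpha> - 1)\<close> beyond \<open>b / 2\<close>.
\<close>

lemma prob_pareto_short_set:
  assumes T: "\<And>x. x \<in> T \<Longrightarrow> b \<le> x" "\<And>x y. x \<in> T \<Longrightarrow> y \<in> T \<Longrightarrow> \<bar>x - y\<bar> \<le> h"
    and h: "0 < h" "4 * h \<le> b" "2 \<le> b"
  shows "prob {\<omega> \<in> space M. \<xi>0 z \<omega> \<in> T} \<le> 4 * h * \<alpha> * (b / 2) powr (- \<alpha> - 1)"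
proof (cases "T = {}")
  case True then show ?thesis using h alpha_pos by simp
next
  case False
  then obtain x where x: "x \<in> T" by auto
  have bx: "b \<le> x" using T x by auto
  \<comment> \<open>The distribution function gives the probability of half-open intervals, so the window extends strictly below T.\<close>
  have near: "x - 2 * h < y \<and> y \<le> x + 2 * h" if "y \<in> T" for y
    using T(2)[OF x that] h by linarith
  have "prob {\<omega> \<in> space M. \<xi>0 z \<omega> \<in> T} \<le> prob ({\<omega> \<in> space M. \<xi>0 z \<omega> \<le> x + 2 * h} - {\<omega> \<in> space M. \<xi>0 z \<omega> \<le> x - 2 * h})"
    by (intro finite_measure_mono) (auto dest!: near)
  also have "\<dots> = prob {\<omega> \<in> space M. \<xi>0 z \<omega> \<le> x + 2 * h} - prob {\<omega> \<in> space M. \<xi>0 z \<omega> \<le> x - 2 * h}"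
    using h by (intro finite_measure_Diff) auto
  also have "\<dots> = (x - 2 * h) powr (- \<alpha>) - (x + 2 * h) powr (- \<alpha>)"
    using h bx by (subst (1 2) pareto) auto
  also have "\<dots> \<le> (x + 2 * h - (x - 2 * h)) * (\<alpha> * (x - 2 * h) powr (- \<alpha> - 1))"
    by (rule powr_minus_diff_le) (use alpha_pos h bx in auto)
  also have "\<dots> = 4 * h * \<alpha> * (x - 2 * h) powr (- \<alpha> - 1)" by simp
  also have "\<dots> \<le> 4 * h * \<alpha> * (b / 2) powr (- \<alpha> - 1)"
    using alpha_pos h bx by (intro mult_left_mono powr_mono2') auto
  finally show ?thesis .
qed

lemma indep_events_pareto:
  assumes "finite J" "J \<noteq> {}" "\<And>i. i \<in> J \<Longrightarrow> A i \<in> sets borel"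
  shows "prob {\<omega> \<in> space M. \<forall>i\<in>J. \<xi>0 i \<omega> \<in> A i} = (\<Prod>i\<in>J. prob {\<omega> \<in> space M. \<xi>0 i \<omega> \<in> A i})"
proof -
  let ?X = "case_sum \<xi>0 (\<lambda>n \<omega>. of_bool (dup n \<omega>) :: real)"
  have "prob (\<Inter>i\<in>Inl ` J. ?X i -` (case_sum A (\<lambda>_. UNIV) i) \<inter> space M)
    = (\<Prod>i\<in>Inl ` J. prob (?X i -` (case_sum A (\<lambda>_. UNIV) i) \<inter> space M))"
    by (rule indep_varsD[OF indep]) (use assms in auto)
  moreover have "(\<Inter>i\<in>Inl ` J. ?X i -` (case_sum A (\<lambda>_. UNIV) i) \<inter> space M) = {\<omega> \<in> space M. \<forall>i\<in>J. \<xi>0 i \<omega> \<in> A i}"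
    using assms(2) by auto
  moreover have "(\<Prod>i\<in>Inl ` J. prob (?X i -` (case_sum A (\<lambda>_. UNIV) i) \<inter> space M)) = (\<Prod>i\<in>J. prob {\<omega> \<in> space M. \<xi>0 i \<omega> \<in> A i})"
    by (subst prod.reindex) (auto simp: vimage_def Int_def conj_commute intro!: prod.cong arg_cong[where f=prob])
  ultimately show ?thesis by simp
qed

lemma distr_pareto_pair:
  assumes "i \<noteq> j"
  shows "distr M borel (\<xi>0 i) \<Otimes>\<^sub>M distr M borel (\<xi>0 j) = distr M (borel \<Otimes>\<^sub>M borel) (\<lambda>\<omega>. (\<xi>0 i \<omega>, \<xi>0 j \<omega>))"
proof -
  interpret I: prob_space "distr M borel (\<xi>0 i)" by (rule prob_space_distr) simp
  interpret J: prob_space "distr M borel (\<xi>0 j)" by (rule prob_space_distr) simp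
  show ?thesis
  proof (rule pair_measure_eqI)
    show "sigma_finite_measure (distr M borel (\<xi>0 i))" "sigma_finite_measure (distr M borel (\<xi>0 j))" ..
    show "sets (distr M borel (\<xi>0 i) \<Otimes>\<^sub>M distr M borel (\<xi>0 j)) = sets (distr M (borel \<Otimes>\<^sub>M borel) (\<lambda>\<omega>. (\<xi>0 i \<omega>, \<xi>0 j \<omega>)))"
      by (simp cong: sets_pair_measure_cong)
    fix A B assume AB: "A \<in> sets (distr M borel (\<xi>0 i))" "B \<in> sets (distr M borel (\<xi>0 j))"
    then have [measurable]: "A \<in> sets borel" "B \<in> sets borel" by auto
    have "emeasure (distr M (borel \<Otimes>\<^sub>M borel) (\<lambda>\<omega>. (\<xi>0 i \<omega>, \<xi>0 j \<omega>))) (A \<times> B)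
      = prob {\<omega> \<in> space M. \<forall>k\<in>{i, j}. \<xi>0 k \<omega> \<in> (if k = i then A else B)}"
      using assms by (subst emeasure_distr) (auto simp: emeasure_eq_measure intro!: arg_cong[where f=prob])
    also have "\<dots> = prob {\<omega> \<in> space M. \<xi>0 i \<omega> \<in> A} * prob {\<omega> \<in> space M. \<xi>0 j \<omega> \<in> B}"
      using assms by (subst indep_events_pareto) auto
    also have "\<dots> = emeasure (distr M borel (\<xi>0 i)) A * emeasure (distr M borel (\<xi>0 j)) B"
      by (subst (1 2) emeasure_distr)
         (auto simp: emeasure_eq_measure ennreal_mult vimage_def Int_def conj_commute)
    finally show "emeasure (distr M borel (\<xi>0 i)) A * emeasure (distr M borel (\<xi>0 j)) B
      = emeasure (distr M (borel \<Otimes>\<^sub>M borel) (\<lambda>\<omega>. (\<xi>0 i \<omega>, \<xi>0 j \<omega>))) (A \<times> B)" by simp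
  qed
qed

text \<open>
By independence the probability is the average of that of the slice over the second variable, and a slice is
empty below \<open>b\<close>.
\<close>

lemma prob_pareto_pair_le:
  assumes ij: "i \<noteq> j" and A[measurable]: "A \<in> sets (borel \<Otimes>\<^sub>M borel)"
    and C: "\<And>y. prob {\<omega> \<in> space M. (\<xi>0 i \<omega>, y) \<in> A} \<le> C" and b: "\<And>x y. (x, y) \<in> A \<Longrightarrow> b \<le> y"
  shows "prob {\<omega> \<in> space M. (\<xi>0 i \<omega>, \<xi>0 j \<omega>) \<in> A} \<le> C * prob {\<omega> \<in> space M. b \<le> \<xi>0 j \<omega>}"
proof -
  interpret I: prob_space "distr M borel (\<xi>0 i)" by (rule prob_space_distr) simp
  interpret J: prob_space "distr M borel (\<xi>0 j)" by (rule prob_space_distr) simp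
  interpret P: pair_sigma_finite "distr M borel (\<xi>0 i)" "distr M borel (\<xi>0 j)" ..
  have C0: "0 \<le> C" using C[of 0] measure_nonneg by (rule order.trans[rotated])
  have "ennreal (prob {\<omega> \<in> space M. (\<xi>0 i \<omega>, \<xi>0 j \<omega>) \<in> A})
     = emeasure (distr M (borel \<Otimes>\<^sub>M borel) (\<lambda>\<omega>. (\<xi>0 i \<omega>, \<xi>0 j \<omega>))) A"
    by (subst emeasure_distr) (auto simp: emeasure_eq_measure vimage_def Int_def conj_commute)
  also have "\<dots> = (\<integral>\<^sup>+y. emeasure (distr M borel (\<xi>0 i)) ((\<lambda>x. (x, y)) -` A) \<partial>distr M borel (\<xi>0 j))"
    unfolding distr_pareto_pair[OF ij, symmetric]
    by (rule P.emeasure_pair_measure_alt2) (simp cong: sets_pair_measure_cong)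
  also have "\<dots> \<le> (\<integral>\<^sup>+y. ennreal C * indicator {b..} y \<partial>distr M borel (\<xi>0 j))"
  proof (rule nn_integral_mono)
    fix y
    show "emeasure (distr M borel (\<xi>0 i)) ((\<lambda>x. (x, y)) -` A) \<le> ennreal C * indicator {b..} y"
    proof (cases "b \<le> y")
      case True
      have "emeasure (distr M borel (\<xi>0 i)) ((\<lambda>x. (x, y)) -` A) = ennreal (prob {\<omega> \<in> space M. (\<xi>0 i \<omega>, y) \<in> A})"
        by (subst emeasure_distr) (auto simp: emeasure_eq_measure vimage_def Int_def conj_commute)
      then show ?thesis using C[of y] True by (simp add: ennreal_leI)
    next
      case False
      then have "(\<lambda>x. (x, y)) -` A = {}" using b by auto
      then show ?thesis by simp
    qed
  qed
  also have "\<dots> = ennreal C * emeasure (distr M borel (\<xi>0 j)) {b..}"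
    by (rule nn_integral_cmult_indicator) auto
  also have "emeasure (distr M borel (\<xi>0 j)) {b..} = ennreal (prob {\<omega> \<in> space M. b \<le> \<xi>0 j \<omega>})"
    by (subst emeasure_distr) (auto simp: emeasure_eq_measure vimage_def Int_def conj_commute)
  finally show ?thesis using C0 by (simp add: ennreal_mult'[symmetric])
qed

end

section \<open>Typical potentials\<close>

text \<open>
In order: beyond the box the potential grows at most linearly; some site near the origin has
a large value, so that the best score is at least \<open>b\<close>; any two competitive scores in the box differ
by at least \<open>D\<close>; the potential in the box is bounded; the origin is not competitive; and no two mirror sites in the
box are both large. The predicate is applied to the Pareto variables themselves, before duplication, where
different sites are independent.
\<close>

definition typical_potential :: "real \<Rightarrow> real \<Rightarrow> real \<Rightarrow> real \<Rightarrow> real \<Rightarrow> real \<Rightarrow> real \<Rightarrow> (int \<Rightarrow> real) \<Rightarrow> bool" where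
  "typical_potential t R B b D c L x \<longleftrightarrow>
     (\<forall>y. R < \<bar>real_of_int y\<bar> \<longrightarrow> x y \<le> c * \<bar>real_of_int y\<bar>) \<and>
     (\<exists>n\<in>{0..\<lfloor>L\<rfloor>}. 2 * b \<le> x n) \<and>
     (\<forall>i j. \<bar>real_of_int i\<bar> \<le> R \<longrightarrow> \<bar>real_of_int j\<bar> \<le> R \<longrightarrow> i \<noteq> j \<longrightarrow>
        b / 2 \<le> \<Psi> x t i \<longrightarrow> b / 2 \<le> \<Psi> x t j \<longrightarrow> D \<le> \<bar>\<Psi> x t i - \<Psi> x t j\<bar>) \<and>
     (\<forall>y. \<bar>real_of_int y\<bar> \<le> R \<longrightarrow> x y \<le> B) \<and>
     x 0 < b \<and>
     (\<forall>n\<in>{1..\<lfloor>R\<rfloor>}. \<not> (b \<le> x n \<and> b \<le> x (- n)))"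

text \<open>
The map \<open>x - s * ln x\<close> has derivative \<open>1 - s / x \<ge> 1 / 2\<close> where \<open>x \<ge> 2 * s\<close>.
\<close>

lemma score_expanding:
  fixes x y s m :: real
  assumes "0 \<le> s" "0 < m" "s \<le> m / 2" "m \<le> y" "y \<le> x"
  shows "x - y \<le> 2 * ((x - s * ln x) - (y - s * ln y))"
proof -
  have "ln x - ln y = ln (x / y)" using assms by (simp add: ln_div)
  also have "\<dots> \<le> x / y - 1" using assms by (intro ln_le_minus_one) auto
  also have "\<dots> = (x - y) / y" using assms by (simp add: field_simps)
  finally have "s * (ln x - ln y) \<le> s * ((x - y) / y)" using assms by (intro mult_left_mono) auto
  also have "\<dots> = (s / y) * (x - y)" by simp
  also have "\<dots> \<le> (1 / 2) * (x - y)"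
    using assms by (intro mult_right_mono) (auto simp: divide_le_eq)
  finally have "s * ln x - s * ln y \<le> (x - y) / 2" by (simp add: right_diff_distrib)
  moreover define p q where "p = s * ln x" and "q = s * ln y"
  ultimately have "p - q \<le> (x - y) / 2" by simp
  then have "x - y \<le> 2 * (x - p - (y - q))" by argo
  then show ?thesis by (simp only: p_def q_def)
qed

context duplicated_pareto
begin

text \<open>
A union bound over all sites beyond \<open>R\<close>; the sum of the tails converges since \<open>\<alpha> > 1\<close>.
\<close>

lemma prob_far_large_le:
  assumes \<alpha>: "1 < \<alpha>" and R: "1 \<le> R" and c: "0 < c" "1 \<le> c * R"
  shows "prob {\<omega> \<in> space M. \<exists>y. R < \<bar>real_of_int y\<bar> \<and> c * \<bar>real_of_int y\<bar> < \<xi>0 y \<omega>}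
    \<le> 2 * c powr (- \<alpha>) * (real (nat \<lfloor>R\<rfloor>) powr (1 - \<alpha>) / (\<alpha> - 1))"
proof -
  define N where "N = nat \<lfloor>R\<rfloor>"
  have N: "1 \<le> N" "R < real N + 1" using R unfolding N_def by linarith+
  define A where "A i = {\<omega> \<in> space M. c * real (N + 1 + i) < \<xi>0 (int (N + 1 + i)) \<omega>}
    \<union> {\<omega> \<in> space M. c * real (N + 1 + i) < \<xi>0 (- int (N + 1 + i)) \<omega>}" for i
  have A: "prob (A i) \<le> 2 * c powr (- \<alpha>) * real (N + 1 + i) powr (- \<alpha>)" for i
  proof -
    have "c * R \<le> c * real (N + 1 + i)" using c N by (intro mult_left_mono) auto
    then have ge: "1 \<le> c * real (N + 1 + i)" using c by linarith
    have "prob (A i) \<le> prob {\<omega> \<in> space M. c * real (N + 1 + i) < \<xi>0 (int (N + 1 + i)) \<omega>}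
       + prob {\<omega> \<in> space M. c * real (N + 1 + i) < \<xi>0 (- int (N + 1 + i)) \<omega>}"
      unfolding A_def by (intro measure_Un_le) auto
    also have "\<dots> = 2 * (c * real (N + 1 + i)) powr (- \<alpha>)"
      unfolding prob_pareto_greater[OF ge] by simp
    also have "\<dots> = 2 * c powr (- \<alpha>) * real (N + 1 + i) powr (- \<alpha>)"
      using c by (simp add: powr_mult)
    finally show ?thesis .
  qed
  note tail = powr_tail_sum[OF \<alpha> N(1)]
  have summ: "summable (\<lambda>i. prob (A i))"
  proof (rule summable_comparison_test')
    show "summable (\<lambda>i. 2 * c powr (- \<alpha>) * real (N + 1 + i) powr (- \<alpha>))"
      by (intro summable_mult tail(1))
    show "norm (prob (A i)) \<le> 2 * c powr (- \<alpha>) * real (N + 1 + i) powr (- \<alpha>)" if "0 \<le> i" for i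
      using A[of i] by simp
  qed
  have "prob {\<omega> \<in> space M. \<exists>y. R < \<bar>real_of_int y\<bar> \<and> c * \<bar>real_of_int y\<bar> < \<xi>0 y \<omega>} \<le> prob (\<Union>i. A i)"
  proof (rule finite_measure_mono)
    show "{\<omega> \<in> space M. \<exists>y. R < \<bar>real_of_int y\<bar> \<and> c * \<bar>real_of_int y\<bar> < \<xi>0 y \<omega>} \<subseteq> (\<Union>i. A i)"
    proof safe
      fix \<omega> y assume \<omega>: "\<omega> \<in> space M" and y: "R < \<bar>real_of_int y\<bar>" "c * \<bar>real_of_int y\<bar> < \<xi>0 y \<omega>"
      define i where "i = nat \<bar>y\<bar> - (N + 1)"
      have "int N < \<bar>y\<bar>" using y(1) R unfolding N_def by linarith
      then have i: "int (N + 1 + i) = \<bar>y\<bar>" by (simp add: i_def)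
      then have ir: "real (N + 1 + i) = \<bar>real_of_int y\<bar>" by linarith
      have "\<omega> \<in> A i" unfolding A_def i ir using \<omega> y by (cases "0 \<le> y") auto
      then show "\<omega> \<in> (\<Union>i. A i)" by blast
    qed
    show "(\<Union>i. A i) \<in> sets M" unfolding A_def by measurable
  qed
  also have "\<dots> \<le> (\<Sum>i. prob (A i))"
    by (rule finite_measure_subadditive_countably[OF _ summ]) (auto simp: A_def)
  also have "\<dots> \<le> (\<Sum>i. 2 * c powr (- \<alpha>) * real (N + 1 + i) powr (- \<alpha>))"
    by (rule suminf_le[OF A summ]) (intro summable_mult tail(1))
  also have "\<dots> = 2 * c powr (- \<alpha>) * (\<Sum>i. real (N + 1 + i) powr (- \<alpha>))"
    by (rule suminf_mult[OF tail(1)])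
  also have "\<dots> \<le> 2 * c powr (- \<alpha>) * (real N powr (1 - \<alpha>) / (\<alpha> - 1))"
    by (rule mult_left_mono[OF tail(2)]) simp
  finally show ?thesis by (simp add: N_def)
qed

lemma prob_no_large_near_le:
  assumes L: "0 \<le> L" and b: "1 \<le> b"
  shows "prob {\<omega> \<in> space M. \<forall>n\<in>{0..\<lfloor>L\<rfloor>}. \<xi>0 n \<omega> < b} \<le> exp (- L * b powr (- \<alpha>))"
proof -
  have "prob {\<omega> \<in> space M. \<forall>n\<in>{0..\<lfloor>L\<rfloor>}. \<xi>0 n \<omega> < b} \<le> prob {\<omega> \<in> space M. \<forall>n\<in>{0..\<lfloor>L\<rfloor>}. \<xi>0 n \<omega> \<in> {..b}}"
    by (intro finite_measure_mono) (auto simp: less_imp_le)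
  also have "\<dots> = (\<Prod>n\<in>{0..\<lfloor>L\<rfloor>}. prob {\<omega> \<in> space M. \<xi>0 n \<omega> \<in> {..b}})"
    using L by (intro indep_events_pareto) auto
  also have "\<dots> = (1 - b powr (- \<alpha>)) ^ nat (\<lfloor>L\<rfloor> + 1)"
    using pareto[OF b] by simp
  also have "\<dots> \<le> exp (- (b powr (- \<alpha>))) ^ nat (\<lfloor>L\<rfloor> + 1)"
  proof (rule power_mono)
    show "1 - b powr (- \<alpha>) \<le> exp (- (b powr (- \<alpha>)))"
      using exp_ge_add_one_self[of "- (b powr (- \<alpha>))"] by simp
    have "b powr (- \<alpha>) \<le> b powr 0" using b alpha_pos by (intro powr_mono) auto
    then show "0 \<le> 1 - b powr (- \<alpha>)" using b by simp
  qed
  also have "\<dots> = exp (- (real (nat (\<lfloor>L\<rfloor> + 1)) * b powr (- \<alpha>)))"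
    by (simp add: exp_of_nat_mult[symmetric])
  also have "\<dots> \<le> exp (- L * b powr (- \<alpha>))"
  proof -
    have "L \<le> real (nat (\<lfloor>L\<rfloor> + 1))" using L by linarith
    then have "L * b powr (- \<alpha>) \<le> real (nat (\<lfloor>L\<rfloor> + 1)) * b powr (- \<alpha>)"
      by (intro mult_right_mono) auto
    then show ?thesis by simp
  qed
  finally show ?thesis .
qed

lemma measurable_score [measurable]: "(\<lambda>\<omega>. \<Psi> (\<lambda>z. \<xi>0 z \<omega>) t i) \<in> borel_measurable M"
  unfolding \<Psi>_def by measurable

text \<open>
Given the second variable, closeness of the scores confines the first one to a set of diameter \<open>4 * D\<close>, since
the score is expanding in the value up to a factor 2.
\<close>

lemma prob_scores_close_le:
  assumes ij: "i \<noteq> j" "\<bar>real_of_int i\<bar> \<le> R" and t: "0 < t" and R: "R / t \<le> b / 4"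
    and b: "4 \<le> b" and D: "0 < D" "32 * D \<le> b"
  shows "prob {\<omega> \<in> space M. b / 2 \<le> \<Psi> (\<lambda>z. \<xi>0 z \<omega>) t i \<and> b / 2 \<le> \<Psi> (\<lambda>z. \<xi>0 z \<omega>) t j
      \<and> \<bar>\<Psi> (\<lambda>z. \<xi>0 z \<omega>) t i - \<Psi> (\<lambda>z. \<xi>0 z \<omega>) t j\<bar> < D}
    \<le> 16 * D * \<alpha> * (b / 4) powr (- \<alpha> - 1) * (b / 4) powr (- \<alpha>)"
proof -
  define f where "f k x = x - \<bar>real_of_int k\<bar> / t * ln x" for k and x :: real
  define A where "A = {(x, y). b / 2 \<le> x \<and> b / 2 \<le> y \<and> \<bar>f i x - f j y\<bar> < D}"
  have [measurable]: "f k \<in> borel_measurable borel" for k unfolding f_def by measurable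
  have A[measurable]: "A \<in> sets (borel \<Otimes>\<^sub>M borel)"
  proof -
    have "{p \<in> space (borel \<Otimes>\<^sub>M borel). b / 2 \<le> fst p \<and> b / 2 \<le> snd p \<and> \<bar>f i (fst p) - f j (snd p)\<bar> < D} \<in> sets (borel \<Otimes>\<^sub>M borel)"
      by measurable
    then show ?thesis by (simp add: A_def space_pair_measure case_prod_unfold)
  qed
  have s0: "0 \<le> \<bar>real_of_int i\<bar> / t" using t by simp
  have "\<bar>real_of_int i\<bar> / t \<le> R / t" using divide_right_mono[OF ij(2), of t] t by simp
  then have s1: "\<bar>real_of_int i\<bar> / t \<le> (b / 2) / 2" using R by linarith
  have mono: "x - x' \<le> 2 * (f i x - f i x')" if "b / 2 \<le> x'" "x' \<le> x" for x x'
    unfolding f_def by (rule score_expanding[OF s0 _ s1 that]) (use b in simp)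
  have expand: "\<bar>x - x'\<bar> \<le> 2 * \<bar>f i x - f i x'\<bar>" if "b / 2 \<le> x" "b / 2 \<le> x'" for x x'
  proof (cases "x' \<le> x")
    case True
    from mono[OF that(2) True] True show ?thesis by (smt (verit))
  next
    case False
    then have "x \<le> x'" by simp
    from mono[OF that(1) this] this show ?thesis by (smt (verit))
  qed
  have slice: "prob {\<omega> \<in> space M. (\<xi>0 i \<omega>, y) \<in> A} \<le> 16 * D * \<alpha> * (b / 4) powr (- \<alpha> - 1)" for y
  proof -
    have "prob {\<omega> \<in> space M. \<xi>0 i \<omega> \<in> {x. (x, y) \<in> A}} \<le> 4 * (4 * D) * \<alpha> * (b / 2 / 2) powr (- \<alpha> - 1)"
    proof (rule prob_pareto_short_set)
      fix x x' assume "x \<in> {x. (x, y) \<in> A}" "x' \<in> {x. (x, y) \<in> A}"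
      then show "\<bar>x - x'\<bar> \<le> 4 * D" using expand[of x x'] by (simp add: A_def) (smt (verit))
    qed (use D b in \<open>auto simp: A_def\<close>)
    then show ?thesis by simp
  qed
  have "prob {\<omega> \<in> space M. b / 2 \<le> \<Psi> (\<lambda>z. \<xi>0 z \<omega>) t i \<and> b / 2 \<le> \<Psi> (\<lambda>z. \<xi>0 z \<omega>) t j
      \<and> \<bar>\<Psi> (\<lambda>z. \<xi>0 z \<omega>) t i - \<Psi> (\<lambda>z. \<xi>0 z \<omega>) t j\<bar> < D} \<le> prob {\<omega> \<in> space M. (\<xi>0 i \<omega>, \<xi>0 j \<omega>) \<in> A}"
  proof (rule finite_measure_mono_AE)
    show "AE \<omega> in M. \<omega> \<in> {\<omega> \<in> space M. b / 2 \<le> \<Psi> (\<lambda>z. \<xi>0 z \<omega>) t i \<and> b / 2 \<le> \<Psi> (\<lambda>z. \<xi>0 z \<omega>) t j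
      \<and> \<bar>\<Psi> (\<lambda>z. \<xi>0 z \<omega>) t i - \<Psi> (\<lambda>z. \<xi>0 z \<omega>) t j\<bar> < D} \<longrightarrow> \<omega> \<in> {\<omega> \<in> space M. (\<xi>0 i \<omega>, \<xi>0 j \<omega>) \<in> A}"
      using AE_pareto_ge_1
    proof eventually_elim
      case (elim \<omega>)
      have le: "\<Psi> (\<lambda>z. \<xi>0 z \<omega>) t k \<le> \<xi>0 k \<omega>" for k
        using elim[rule_format, of k] t by (simp add: \<Psi>_def)
      have eq: "\<Psi> (\<lambda>z. \<xi>0 z \<omega>) t k = f k (\<xi>0 k \<omega>)" for k by (simp add: \<Psi>_def f_def)
      show ?case
        using le[of i] le[of j] by (auto simp: A_def eq)
    qed
  qed measurable
  also have "\<dots> \<le> 16 * D * \<alpha> * (b / 4) powr (- \<alpha> - 1) * prob {\<omega> \<in> space M. b / 2 \<le> \<xi>0 j \<omega>}"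
    by (rule prob_pareto_pair_le[OF ij(1) A slice]) (auto simp: A_def)
  also have "\<dots> \<le> 16 * D * \<alpha> * (b / 4) powr (- \<alpha> - 1) * (b / 4) powr (- \<alpha>)"
    using prob_pareto_ge[of "b / 2" j] b D alpha_pos by (intro mult_left_mono) auto
  finally show ?thesis .
qed

lemma prob_pair_large_le:
  assumes "2 \<le> b" "i \<noteq> j"
  shows "prob {\<omega> \<in> space M. b \<le> \<xi>0 i \<omega> \<and> b \<le> \<xi>0 j \<omega>} \<le> (b / 2) powr (- 2 * \<alpha>)"
proof -
  have "prob {\<omega> \<in> space M. \<forall>k\<in>{i, j}. \<xi>0 k \<omega> \<in> {b..}} = prob {\<omega> \<in> space M. b \<le> \<xi>0 i \<omega>} * prob {\<omega> \<in> space M. b \<le> \<xi>0 j \<omega>}"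
    using assms by (subst indep_events_pareto) auto
  also have "\<dots> \<le> (b / 2) powr (- \<alpha>) * (b / 2) powr (- \<alpha>)"
    using prob_pareto_ge[OF assms(1)] by (intro mult_mono) auto
  also have "\<dots> = (b / 2) powr (- 2 * \<alpha>)" by (simp add: powr_add[symmetric])
  finally show ?thesis by simp
qed

lemma measurable_typical [measurable]:
  "Measurable.pred M (\<lambda>\<omega>. typical_potential t R B b D c L (\<lambda>z. \<xi>0 z \<omega>))"
  unfolding typical_potential_def by measurable

lemma prob_not_typical_le:
  assumes \<alpha>: "1 < \<alpha>" and t: "0 < t" and R: "1 \<le> R" "R / t \<le> b / 4" and c: "0 < c" "1 \<le> c * R"
    and L: "0 \<le> L" and b: "4 \<le> b" and D: "0 < D" "32 * D \<le> b" and B: "1 \<le> B"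
  shows "prob {\<omega> \<in> space M. \<not> typical_potential t R B b D c L (\<lambda>z. \<xi>0 z \<omega>)} \<le>
    2 * c powr (- \<alpha>) * (real (nat \<lfloor>R\<rfloor>) powr (1 - \<alpha>) / (\<alpha> - 1))
    + exp (- L * (2 * b) powr (- \<alpha>))
    + (2 * R + 1)^2 * (16 * D * \<alpha> * (b / 4) powr (- \<alpha> - 1) * (b / 4) powr (- \<alpha>))
    + (2 * R + 1) * B powr (- \<alpha>)
    + (b / 2) powr (- \<alpha>)
    + R * (b / 2) powr (- 2 * \<alpha>)"
proof -
  let ?box = "{y::int. \<bar>real_of_int y\<bar> \<le> R}"
  let ?S = "\<lambda>\<omega> i. \<Psi> (\<lambda>z. \<xi>0 z \<omega>) t i"
  define A1 where "A1 = {\<omega> \<in> space M. \<exists>y. R < \<bar>real_of_int y\<bar> \<and> c * \<bar>real_of_int y\<bar> < \<xi>0 y \<omega>}"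
  define A2 where "A2 = {\<omega> \<in> space M. \<forall>n\<in>{0..\<lfloor>L\<rfloor>}. \<xi>0 n \<omega> < 2 * b}"
  define A3 where "A3 ij = {\<omega> \<in> space M. b / 2 \<le> ?S \<omega> (fst ij) \<and> b / 2 \<le> ?S \<omega> (snd ij)
      \<and> \<bar>?S \<omega> (fst ij) - ?S \<omega> (snd ij)\<bar> < D}" for ij
  define A4 where "A4 y = {\<omega> \<in> space M. B < \<xi>0 y \<omega>}" for y
  define A5 where "A5 = {\<omega> \<in> space M. b \<le> \<xi>0 0 \<omega>}"
  define A6 where "A6 n = {\<omega> \<in> space M. b \<le> \<xi>0 n \<omega> \<and> b \<le> \<xi>0 (- n) \<omega>}" for n
  define P where "P = (?box \<times> ?box) - Id"
  have [measurable]: "A1 \<in> sets M" "A2 \<in> sets M" "\<And>ij. A3 ij \<in> sets M" "\<And>y. A4 y \<in> sets M"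
    "A5 \<in> sets M" "\<And>n. A6 n \<in> sets M"
    unfolding A1_def A2_def A3_def A4_def A5_def A6_def by measurable
  have fin: "finite P" unfolding P_def by (intro finite_Diff finite_cartesian_product) auto
  have p1: "prob A1 \<le> 2 * c powr (- \<alpha>) * (real (nat \<lfloor>R\<rfloor>) powr (1 - \<alpha>) / (\<alpha> - 1))"
    unfolding A1_def by (rule prob_far_large_le[OF \<alpha> R(1) c])
  have p2: "prob A2 \<le> exp (- L * (2 * b) powr (- \<alpha>))"
    unfolding A2_def using b by (intro prob_no_large_near_le L) auto
  define K where "K = 16 * D * \<alpha> * (b / 4) powr (- \<alpha> - 1) * (b / 4) powr (- \<alpha>)"
  have K0: "0 \<le> K" using D alpha_pos by (simp add: K_def)
  have "prob (\<Union>ij\<in>P. A3 ij) \<le> (\<Sum>ij\<in>P. prob (A3 ij))"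
    by (rule finite_measure_subadditive_finite[OF fin]) auto
  also have "\<dots> \<le> (\<Sum>ij\<in>P. K)"
  proof (rule sum_mono)
    fix ij assume "ij \<in> P"
    then show "prob (A3 ij) \<le> K"
      unfolding A3_def K_def P_def using t R b D by (intro prob_scores_close_le) auto
  qed
  also have "\<dots> \<le> (2 * R + 1)^2 * K"
  proof -
    have "card P \<le> card (?box \<times> ?box)" unfolding P_def by (intro card_mono) auto
    then have "real (card P) \<le> real (card ?box) * real (card ?box)"
      by (simp add: card_cartesian_product flip: of_nat_mult)
    also have "\<dots> \<le> (2 * R + 1) * (2 * R + 1)"
      using card_int_box_le[of R] R by (intro mult_mono) auto
    finally show ?thesis using K0 by (simp add: power2_eq_square mult_right_mono)
  qed
  finally have p3: "prob (\<Union>ij\<in>P. A3 ij) \<le> (2 * R + 1)^2 * K" .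
  have "prob (\<Union>y\<in>?box. A4 y) \<le> (\<Sum>y\<in>?box. prob (A4 y))"
    by (rule finite_measure_subadditive_finite) auto
  also have "\<dots> = real (card ?box) * B powr (- \<alpha>)"
    unfolding A4_def using prob_pareto_greater[OF B] by simp
  also have "\<dots> \<le> (2 * R + 1) * B powr (- \<alpha>)"
    using card_int_box_le[of R] R by (intro mult_right_mono) auto
  finally have p4: "prob (\<Union>y\<in>?box. A4 y) \<le> (2 * R + 1) * B powr (- \<alpha>)" .
  have p5: "prob A5 \<le> (b / 2) powr (- \<alpha>)"
    unfolding A5_def using b by (intro prob_pareto_ge) auto
  have "prob (\<Union>n\<in>{1..\<lfloor>R\<rfloor>}. A6 n) \<le> (\<Sum>n\<in>{1..\<lfloor>R\<rfloor>}. prob (A6 n))"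
    by (rule finite_measure_subadditive_finite) auto
  also have "\<dots> \<le> (\<Sum>n\<in>{1..\<lfloor>R\<rfloor>}. (b / 2) powr (- 2 * \<alpha>))"
    unfolding A6_def using b by (intro sum_mono prob_pair_large_le) auto
  also have "\<dots> \<le> R * (b / 2) powr (- 2 * \<alpha>)"
    using R by (simp add: mult_right_mono)
  finally have p6: "prob (\<Union>n\<in>{1..\<lfloor>R\<rfloor>}. A6 n) \<le> R * (b / 2) powr (- 2 * \<alpha>)" .
  have sub: "{\<omega> \<in> space M. \<not> typical_potential t R B b D c L (\<lambda>z. \<xi>0 z \<omega>)}
    \<subseteq> A1 \<union> A2 \<union> (\<Union>ij\<in>P. A3 ij) \<union> (\<Union>y\<in>?box. A4 y) \<union> A5 \<union> (\<Union>n\<in>{1..\<lfloor>R\<rfloor>}. A6 n)" (is "_ \<subseteq> ?U")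
  proof
    fix \<omega> assume \<omega>: "\<omega> \<in> {\<omega> \<in> space M. \<not> typical_potential t R B b D c L (\<lambda>z. \<xi>0 z \<omega>)}"
    show "\<omega> \<in> ?U"
    proof (rule ccontr)
      assume n: "\<omega> \<notin> ?U"
      have sp: "\<omega> \<in> space M" using \<omega> by simp
      have "typical_potential t R B b D c L (\<lambda>z. \<xi>0 z \<omega>)"
        unfolding typical_potential_def
      proof (intro conjI allI impI)
        show "\<xi>0 y \<omega> \<le> c * \<bar>real_of_int y\<bar>" if "R < \<bar>real_of_int y\<bar>" for y
        proof (rule ccontr)
          assume "\<not> ?thesis"
          then have "\<omega> \<in> A1" unfolding A1_def using sp that by auto
          then show False using n by blast
        qed
        show "\<exists>n\<in>{0..\<lfloor>L\<rfloor>}. 2 * b \<le> \<xi>0 n \<omega>"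
          using n sp unfolding A2_def by (auto simp: not_less)
        show "D \<le> \<bar>?S \<omega> i - ?S \<omega> j\<bar>"
          if "\<bar>real_of_int i\<bar> \<le> R" "\<bar>real_of_int j\<bar> \<le> R" "i \<noteq> j" "b / 2 \<le> ?S \<omega> i" "b / 2 \<le> ?S \<omega> j" for i j
        proof -
          have "(i, j) \<in> P" using that by (auto simp: P_def)
          then have "\<omega> \<notin> A3 (i, j)" using n by blast
          then show ?thesis using sp that unfolding A3_def by auto
        qed
        show "\<xi>0 y \<omega> \<le> B" if "\<bar>real_of_int y\<bar> \<le> R" for y
          using n sp that unfolding A4_def by (auto simp: not_less)
        show "\<xi>0 0 \<omega> < b" using n sp unfolding A5_def by auto
        show "\<forall>n\<in>{1..\<lfloor>R\<rfloor>}. \<not> (b \<le> \<xi>0 n \<omega> \<and> b \<le> \<xi>0 (- n) \<omega>)"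
          using n sp unfolding A6_def by auto
      qed
      then show False using \<omega> by simp
    qed
  qed
  have "prob {\<omega> \<in> space M. \<not> typical_potential t R B b D c L (\<lambda>z. \<xi>0 z \<omega>)} \<le> prob ?U"
    by (rule finite_measure_mono[OF sub]) (auto intro!: sets.Un sets.finite_UN fin)
  also have "\<dots> \<le> prob A1 + prob A2 + prob (\<Union>ij\<in>P. A3 ij) + prob (\<Union>y\<in>?box. A4 y) + prob A5 + prob (\<Union>n\<in>{1..\<lfloor>R\<rfloor>}. A6 n)"
    by (intro order.trans[OF measure_Un_le] add_right_mono order.refl)
       (auto intro!: sets.Un sets.finite_UN fin)
  also have "\<dots> \<le> 2 * c powr (- \<alpha>) * (real (nat \<lfloor>R\<rfloor>) powr (1 - \<alpha>) / (\<alpha> - 1))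
    + exp (- L * (2 * b) powr (- \<alpha>))
    + (2 * R + 1)^2 * K
    + (2 * R + 1) * B powr (- \<alpha>)
    + (b / 2) powr (- \<alpha>)
    + R * (b / 2) powr (- 2 * \<alpha>)"
    by (intro add_mono p1 p2 p3 p4 p5 p6)
  finally show ?thesis by (simp add: K_def)
qed

end

section \<open>The maximisers in a typical potential\<close>

text \<open>
The index of the Pareto variable that is seen at the site \<open>z\<close>, when \<open>\<delta>\<close> tells which sites are duplicated.
\<close>

definition source :: "(nat \<Rightarrow> bool) \<Rightarrow> int \<Rightarrow> int" where
  "source \<delta> z = (if z < 0 \<and> \<delta> (nat (- z)) then - z else z)"

lemma abs_source [simp]: "\<bar>source \<delta> z\<bar> = \<bar>z\<bar>"
  by (simp add: source_def)

lemma abs_source_real [simp]: "\<bar>real_of_int (source \<delta> z)\<bar> = \<bar>real_of_int z\<bar>"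
  by (simp add: source_def)

lemma potential_eq_source: "potential \<xi>0 dup \<omega> z = \<xi>0 (source (\<lambda>n. dup n \<omega>) z) \<omega>"
  by (simp add: potential_def source_def)

text \<open>
The sites \<open>k\<close> and \<open>- k\<close> are left out of the comparison. For \<open>k \<noteq> 0\<close> this makes the event independent of
whether the pair is duplicated, and interchanging the variables at \<open>k\<close> and \<open>- k\<close> turns the event for \<open>k\<close>
into the one for \<open>- k\<close>.
\<close>

definition beats_outside :: "(int \<Rightarrow> real) \<Rightarrow> (nat \<Rightarrow> bool) \<Rightarrow> real \<Rightarrow> int \<Rightarrow> bool" where
  "beats_outside x \<delta> t k \<longleftrightarrow> (\<forall>m. \<bar>m\<bar> \<noteq> \<bar>k\<bar> \<longrightarrow> \<Psi> x t (source \<delta> m) < \<Psi> x t k)"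

lemma \<Psi>_source:
  assumes "\<And>z. \<xi> z = x (source \<delta> z)"
  shows "\<Psi> \<xi> t z = \<Psi> x t (source \<delta> z)"
  by (simp add: \<Psi>_def assms)

text \<open>
Both sites of a duplicated pair see the same variable, hence have the same score.
\<close>

lemma maximisers_duplicated:
  assumes \<xi>: "\<And>z. \<xi> z = x (source \<delta> z)" and n: "1 \<le> n" "\<delta> n" and E: "beats_outside x \<delta> t (int n)"
  shows "maximisers \<xi> t = {int n, - int n}"
proof -
  have P: "\<Psi> \<xi> t (int n) = \<Psi> x t (int n)" "\<Psi> \<xi> t (- int n) = \<Psi> x t (int n)"
    using n by (simp_all add: \<Psi>_source[of \<xi> x \<delta>, OF \<xi>] source_def)
  have out: "\<Psi> \<xi> t m < \<Psi> x t (int n)" if "m \<noteq> int n" "m \<noteq> - int n" for m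
    using E that unfolding beats_outside_def \<Psi>_source[of \<xi> x \<delta>, OF \<xi>] by auto
  show ?thesis
  proof (intro set_eqI iffI)
    fix z assume "z \<in> maximisers \<xi> t"
    then have "\<Psi> \<xi> t (int n) \<le> \<Psi> \<xi> t z" by (simp add: maximisers_def)
    then show "z \<in> {int n, - int n}" using out[of z] P by fastforce
  next
    fix z assume z: "z \<in> {int n, - int n}"
    have "\<Psi> \<xi> t y \<le> \<Psi> x t (int n)" for y
      using out[of y] P by (cases "y = int n \<or> y = - int n") (auto intro: less_imp_le)
    then show "z \<in> maximisers \<xi> t" using z P by (auto simp: maximisers_def)
  qed
qed

text \<open>
A typical potential with its duplication, together with the relations between the parameters that make the
clauses of typicality effective: \<open>c * t \<le> ln b\<close> lets the cost of distance outweigh the far values, and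
\<open>L / t * ln B \<le> b\<close> bounds the cost at the large value near the origin.
\<close>

locale typical_environment =
  fixes t R B b D c L :: real and x :: "int \<Rightarrow> real" and \<delta> :: "nat \<Rightarrow> bool" and \<xi> :: "int \<Rightarrow> real"
  assumes typical: "typical_potential t R B b D c L x"
    and x_ge: "\<And>z. 1 \<le> x z"
    and \<xi>_eq: "\<And>z. \<xi> z = x (source \<delta> z)"
    and t: "0 < t" and b: "1 \<le> b" and D: "0 < D" "2 * D \<le> b" and c: "c * t \<le> ln b"
    and L: "0 \<le> L" "L \<le> R" "L / t * ln B \<le> b"
begin

lemma \<Psi>_eq: "\<Psi> \<xi> t z = \<Psi> x t (source \<delta> z)"
  by (rule \<Psi>_source) (rule \<xi>_eq)

lemma \<Psi>_le: "\<Psi> x t z \<le> x z"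
  using x_ge[of z] t by (simp add: \<Psi>_def)

lemma \<xi>_ge: "1 \<le> \<xi> z"
  by (simp add: \<xi>_eq x_ge)

text \<open>
Far out a score of at least \<open>b\<close> would need a value \<open>x z \<ge> b\<close>, for which the cost \<open>\<bar>z\<bar> / t * ln b\<close> is already
as large as the linear bound on the value.
\<close>

lemma high_score_in_box:
  assumes "b \<le> \<Psi> x t z"
  shows "\<bar>real_of_int z\<bar> \<le> R"
proof (rule ccontr)
  assume "\<not> ?thesis"
  then have "x z \<le> c * \<bar>real_of_int z\<bar>" using typical by (simp add: typical_potential_def)
  moreover have "\<bar>real_of_int z\<bar> / t * (c * t) \<le> \<bar>real_of_int z\<bar> / t * ln (x z)"
  proof (rule mult_left_mono)
    have "b \<le> x z" using \<Psi>_le[of z] assms by linarith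
    then have "ln b \<le> ln (x z)" using b by simp
    then show "c * t \<le> ln (x z)" using c by linarith
  qed (use t in auto)
  moreover have "\<bar>real_of_int z\<bar> / t * (c * t) = c * \<bar>real_of_int z\<bar>" using t by simp
  ultimately have "\<Psi> x t z \<le> 0" unfolding \<Psi>_def by linarith
  then show False using assms b by linarith
qed

text \<open>
At the large value near the origin the cost is at most \<open>L / t * ln B \<le> b\<close>, hence at most half of the value. The site
has a nonnegative coordinate, so duplication does not touch it.
\<close>

lemma ex_high_score: "\<exists>n. b \<le> \<Psi> \<xi> t n"
proof -
  obtain n where n: "0 \<le> n" "n \<le> \<lfloor>L\<rfloor>" "2 * b \<le> x n"
    using typical by (auto simp: typical_potential_def)
  have nL: "real_of_int n \<le> L" using n(2) by linarith
  have "x n \<le> B" using typical n nL L by (auto simp: typical_potential_def)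
  then have lnB: "ln (x n) \<le> ln B" "0 \<le> ln (x n)" using x_ge[of n] by simp_all
  have "\<bar>real_of_int n\<bar> / t * ln (x n) \<le> L / t * ln B"
    using n nL lnB t L by (intro mult_mono divide_right_mono) auto
  then have "b \<le> \<Psi> x t n" using n(3) L(3) by (simp add: \<Psi>_def)
  moreover have "source \<delta> n = n" using n by (simp add: source_def)
  ultimately have "b \<le> \<Psi> \<xi> t n" by (simp add: \<Psi>_eq)
  then show ?thesis ..
qed

lemma maximisers_nonempty: "maximisers \<xi> t \<noteq> {}"
proof -
  define H where "H = {z. b \<le> \<Psi> \<xi> t z}"
  have fin: "finite H"
    by (rule finite_subset[OF _ finite_int_box[of R]])
       (auto simp: H_def \<Psi>_eq dest!: high_score_in_box)
  have "H \<noteq> {}" using ex_high_score by (auto simp: H_def)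
  then have "Max (\<Psi> \<xi> t ` H) \<in> \<Psi> \<xi> t ` H" using fin by (intro Max_in) auto
  then obtain z where z: "z \<in> H" "\<Psi> \<xi> t z = Max (\<Psi> \<xi> t ` H)" by auto
  have "\<Psi> \<xi> t y \<le> \<Psi> \<xi> t z" for y
  proof (cases "y \<in> H")
    case False
    then show ?thesis using z(1) by (simp add: H_def)
  next
    case True
    then show ?thesis using fin unfolding z(2) by (intro Max_ge) auto
  qed
  then have "z \<in> maximisers \<xi> t" by (simp add: maximisers_def)
  then show ?thesis by blast
qed

lemma maximiser_score: "z \<in> maximisers \<xi> t \<Longrightarrow> b \<le> \<Psi> \<xi> t z"
  using ex_high_score order.trans unfolding maximisers_def by blast

lemma maximiser_in_box: "z \<in> maximisers \<xi> t \<Longrightarrow> \<bar>real_of_int z\<bar> \<le> R"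
  using high_score_in_box[of "source \<delta> z"] maximiser_score[of z] by (simp add: \<Psi>_eq)

lemma finite_maximisers: "finite (maximisers \<xi> t)"
  by (rule finite_subset[OF _ finite_int_box[of R]]) (auto dest: maximiser_in_box)

text \<open>
A competitive score is separated from the best one by the gap; a score below \<open>b / 2\<close> is even further away.
\<close>

lemma score_gap:
  assumes "z \<in> maximisers \<xi> t" "\<bar>real_of_int y\<bar> \<le> R" "source \<delta> y \<noteq> source \<delta> z"
  shows "\<Psi> \<xi> t y \<le> \<Psi> \<xi> t z - D"
proof (cases "b / 2 \<le> \<Psi> \<xi> t y")
  case True
  have "b / 2 \<le> \<Psi> \<xi> t z" using maximiser_score[OF assms(1)] b by linarith
  then have "D \<le> \<bar>\<Psi> \<xi> t y - \<Psi> \<xi> t z\<bar>"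
    using typical True assms maximiser_in_box[OF assms(1)] unfolding typical_potential_def \<Psi>_eq by simp
  moreover have "\<Psi> \<xi> t y \<le> \<Psi> \<xi> t z" using assms(1) by (simp add: maximisers_def)
  ultimately show ?thesis by linarith
next
  case False
  then show ?thesis using maximiser_score[OF assms(1)] D by linarith
qed

text \<open>
Equal scores cannot come from different Pareto variables, by the gap.
\<close>

lemma source_maximisers:
  assumes "y \<in> maximisers \<xi> t" "z \<in> maximisers \<xi> t"
  shows "source \<delta> y = source \<delta> z"
proof (rule ccontr)
  assume "source \<delta> y \<noteq> source \<delta> z"
  then have "\<Psi> \<xi> t y \<le> \<Psi> \<xi> t z - D" using score_gap assms maximiser_in_box by blast
  moreover have "\<Psi> \<xi> t z \<le> \<Psi> \<xi> t y" using assms(1) by (simp add: maximisers_def)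
  ultimately show False using D by linarith
qed

lemma maximiser_if_same_source:
  assumes "z \<in> maximisers \<xi> t" "source \<delta> y = source \<delta> z"
  shows "y \<in> maximisers \<xi> t"
  using assms by (simp add: maximisers_def \<Psi>_eq)

lemma zero_not_maximiser: "0 \<notin> maximisers \<xi> t"
proof
  assume "0 \<in> maximisers \<xi> t"
  then have "b \<le> \<Psi> \<xi> t 0" by (rule maximiser_score)
  then have "b \<le> x 0" using \<Psi>_le[of 0] by (simp add: \<Psi>_eq source_def)
  then show False using typical by (simp add: typical_potential_def)
qed

lemma source_maximiser_beats_outside:
  assumes z: "z \<in> maximisers \<xi> t"
  shows "beats_outside x \<delta> t (source \<delta> z)"
  unfolding beats_outside_def
proof (intro allI impI)
  fix m assume m: "\<bar>m\<bar> \<noteq> \<bar>source \<delta> z\<bar>"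
  have "m \<notin> maximisers \<xi> t"
  proof
    assume "m \<in> maximisers \<xi> t"
    then have "source \<delta> m = source \<delta> z" using source_maximisers z by blast
    then have "\<bar>source \<delta> m\<bar> = \<bar>source \<delta> z\<bar>" by simp
    then show False using m by simp
  qed
  then obtain y where "\<not> \<Psi> \<xi> t y \<le> \<Psi> \<xi> t m" by (auto simp: maximisers_def)
  moreover have "\<Psi> \<xi> t y \<le> \<Psi> \<xi> t z" using z by (simp add: maximisers_def)
  ultimately show "\<Psi> x t (source \<delta> m) < \<Psi> x t (source \<delta> z)" by (simp add: \<Psi>_eq)
qed

text \<open>
The variable behind a maximiser wins outside its pair. It has a negative index only if the maximiser
is a site on the left that is not duplicated.
\<close>

lemma ex_beats_outside:
  "\<exists>n\<in>{1..nat \<lfloor>R\<rfloor>}. beats_outside x \<delta> t (int n) \<or> (\<not> \<delta> n \<and> beats_outside x \<delta> t (- int n))"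
proof -
  obtain z where z: "z \<in> maximisers \<xi> t" using maximisers_nonempty by blast
  define n where "n = nat \<bar>z\<bar>"
  have "1 \<le> n" using z zero_not_maximiser by (cases "z = 0") (auto simp: n_def)
  moreover have "n \<le> nat \<lfloor>R\<rfloor>" using maximiser_in_box[OF z] by (simp add: n_def le_floor_iff nat_mono)
  ultimately have n: "n \<in> {1..nat \<lfloor>R\<rfloor>}" by simp
  note E = source_maximiser_beats_outside[OF z]
  show ?thesis
  proof (cases "source \<delta> z = int n")
    case True then show ?thesis using E n by auto
  next
    case False
    then have "source \<delta> z = - int n" "\<not> \<delta> n"
      by (auto simp: source_def n_def split: if_splits)
    then show ?thesis using E n by auto
  qed
qed

text \<open>
Two maximisers see the same variable, so one of them is a duplicate of the other.
\<close>

lemma two_maximisers: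
  assumes "card (maximisers \<xi> t) = 2"
  shows "\<exists>n\<in>{1..nat \<lfloor>R\<rfloor>}. \<delta> n \<and> beats_outside x \<delta> t (int n)"
proof -
  obtain y z where yz: "maximisers \<xi> t = {y, z}" "y \<noteq> z" using assms by (auto simp: card_2_iff)
  have s: "source \<delta> y = source \<delta> z" using source_maximisers yz by blast
  have "\<exists>w. w \<in> maximisers \<xi> t \<and> w < 0 \<and> \<delta> (nat (- w))"
    using s yz by (auto simp: source_def split: if_splits)
  then obtain w where w: "w \<in> maximisers \<xi> t" "w < 0" "\<delta> (nat (- w))" by blast
  then have "source \<delta> w = int (nat (- w))" by (simp add: source_def)
  moreover have "nat (- w) \<le> nat \<lfloor>R\<rfloor>"
    using maximiser_in_box[OF w(1)] w(2) by (intro nat_mono) (simp add: le_floor_iff)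
  ultimately show ?thesis
    using source_maximiser_beats_outside[OF w(1)] w by (intro bexI[of _ "nat (- w)"]) auto
qed

text \<open>
If the variable at \<open>- n\<close> had at least the score of the winning one at \<open>n\<close>, both mirror sites would carry large
values, which is excluded in a typical potential.
\<close>

lemma no_high_pair:
  assumes n: "1 \<le> n" "\<delta> n" and E: "beats_outside x \<delta> t (int n)"
  shows "\<Psi> x t (- int n) < \<Psi> x t (int n)"
proof (rule ccontr)
  assume less: "\<not> ?thesis"
  have max: "int n \<in> maximisers \<xi> t"
    using maximisers_duplicated[OF \<xi>_eq n E] by simp
  have "b \<le> \<Psi> x t (int n)" using maximiser_score[OF max] by (simp add: \<Psi>_eq source_def)
  then have "b \<le> x (int n)" "b \<le> x (- int n)"
    using \<Psi>_le[of "int n"] \<Psi>_le[of "- int n"] less by linarith+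
  moreover have "int n \<in> {1..\<lfloor>R\<rfloor>}" using maximiser_in_box[OF max] n by (simp add: le_floor_iff)
  ultimately show False using typical unfolding typical_potential_def by blast
qed

end

section \<open>Independence and mirror symmetry\<close>

text \<open>
The flag \<open>c\<close> adds the condition that the mirror variable, which \<^const>\<open>beats_outside\<close> does not compare, is at least
as good. Both versions have the same independence and symmetry properties.
\<close>

definition wins :: "bool \<Rightarrow> (int \<Rightarrow> real) \<Rightarrow> (nat \<Rightarrow> bool) \<Rightarrow> real \<Rightarrow> int \<Rightarrow> bool" where
  "wins c x \<delta> t k \<longleftrightarrow> beats_outside x \<delta> t k \<and> (c \<longrightarrow> \<Psi> x t k \<le> \<Psi> x t (- k))"

text \<open>
Families of coordinates are indexed by the disjoint sum of the sites and the duplication indicators; this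
permutation of the index set interchanges the variables at \<open>n\<close> and \<open>- n\<close>.
\<close>

definition swap_sites :: "nat \<Rightarrow> int + nat \<Rightarrow> int + nat" where
  "swap_sites n = map_sum (\<lambda>z. if \<bar>z\<bar> = int n then - z else z) id"

abbreviation index_set :: "(int + nat) set" where
  "index_set \<equiv> UNIV <+> {1..}"

definition values_of :: "(int + nat \<Rightarrow> real) \<Rightarrow> int \<Rightarrow> real" where
  "values_of f z = f (Inl z)"

definition copies_of :: "(int + nat \<Rightarrow> real) \<Rightarrow> nat \<Rightarrow> bool" where
  "copies_of f n \<longleftrightarrow> f (Inr n) = 1"

text \<open>
The sites compared with \<open>k\<close> never consult the duplication of the pair of \<open>k\<close>.
\<close>

lemma beats_outside_cong:
  assumes "\<And>j. 1 \<le> j \<Longrightarrow> int j \<noteq> \<bar>k\<bar> \<Longrightarrow> \<delta> j = \<delta>' j"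
  shows "beats_outside x \<delta> t k = beats_outside x \<delta>' t k"
proof -
  have "source \<delta> m = source \<delta>' m" if "\<bar>m\<bar> \<noteq> \<bar>k\<bar>" for m
    using assms[of "nat (- m)"] that by (auto simp: source_def)
  then show ?thesis by (auto simp: beats_outside_def)
qed

lemma wins_cong:
  assumes "\<And>j. 1 \<le> j \<Longrightarrow> int j \<noteq> \<bar>k\<bar> \<Longrightarrow> \<delta> j = \<delta>' j"
  shows "wins c x \<delta> t k = wins c x \<delta>' t k"
  using beats_outside_cong[of k \<delta> \<delta>', OF assms] by (simp add: wins_def)

lemma \<Psi>_swap:
  "\<Psi> (values_of (\<lambda>i. f (swap_sites n i))) t z = \<Psi> (values_of f) t (if \<bar>z\<bar> = int n then - z else z)"
  by (simp add: \<Psi>_def values_of_def swap_sites_def)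

lemma beats_outside_swap:
  assumes "\<bar>k\<bar> = int n"
  shows "beats_outside (values_of (\<lambda>i. f (swap_sites n i))) (copies_of (\<lambda>i. f (swap_sites n i))) t k
    \<longleftrightarrow> beats_outside (values_of f) (copies_of f) t (- k)"
proof -
  have "copies_of (\<lambda>i. f (swap_sites n i)) = copies_of f"
    by (simp add: copies_of_def swap_sites_def fun_eq_iff)
  then show ?thesis
    unfolding beats_outside_def \<Psi>_swap using assms by simp
qed

lemma wins_swap:
  assumes "\<bar>k\<bar> = int n"
  shows "wins c (values_of (\<lambda>i. f (swap_sites n i))) (copies_of (\<lambda>i. f (swap_sites n i))) t k
    \<longleftrightarrow> wins c (values_of f) (copies_of f) t (- k)"
  using beats_outside_swap[OF assms] assms by (simp add: wins_def \<Psi>_swap)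

text \<open>
The event is measurable already with respect to the coordinates without the duplication indicator of the
pair; this is what yields independence of that indicator.
\<close>

lemma sets_beats_outside:
  assumes k: "\<bar>k\<bar> = int n" and J: "index_set - {Inr n} \<subseteq> J"
  shows "{f \<in> space (PiM J (\<lambda>_. borel)). beats_outside (values_of f) (copies_of f) t k} \<in> sets (PiM J (\<lambda>_. borel))"
proof -
  let ?N = "PiM J (\<lambda>_. borel :: real measure)"
  have Inl: "Inl z \<in> J" for z using J by auto
  have [measurable]: "(\<lambda>f. \<Psi> (values_of f) t z) \<in> borel_measurable ?N" for z
    unfolding \<Psi>_def values_of_def using Inl[of z] by measurable
  have "{f \<in> space ?N. \<bar>m\<bar> \<noteq> \<bar>k\<bar> \<longrightarrow> \<Psi> (values_of f) t (source (copies_of f) m) < \<Psi> (values_of f) t k} \<in> sets ?N" for m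
  proof (cases "\<bar>m\<bar> = \<bar>k\<bar>")
    case True then show ?thesis by simp
  next
    case False
    show ?thesis
    proof (cases "m < 0")
      case True
      then have "Inr (nat (- m)) \<in> J" using False k J by auto
      then have [measurable]: "Measurable.pred ?N (\<lambda>f. copies_of f (nat (- m)))"
        unfolding copies_of_def by measurable
      have "{f \<in> space ?N. if copies_of f (nat (- m)) then \<Psi> (values_of f) t (- m) < \<Psi> (values_of f) t k
          else \<Psi> (values_of f) t m < \<Psi> (values_of f) t k} \<in> sets ?N"
        by measurable
      also have "{f \<in> space ?N. if copies_of f (nat (- m)) then \<Psi> (values_of f) t (- m) < \<Psi> (values_of f) t k
          else \<Psi> (values_of f) t m < \<Psi> (values_of f) t k}
        = {f \<in> space ?N. \<bar>m\<bar> \<noteq> \<bar>k\<bar> \<longrightarrow> \<Psi> (values_of f) t (source (copies_of f) m) < \<Psi> (values_of f) t k}"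
        using True False by (auto simp: source_def)
      finally show ?thesis .
    next
      case nonneg: False
      have "{f \<in> space ?N. \<Psi> (values_of f) t m < \<Psi> (values_of f) t k} \<in> sets ?N"
        by measurable
      then show ?thesis using nonneg False by (simp add: source_def)
    qed
  qed
  then show ?thesis
    unfolding beats_outside_def by (rule sets.sets_Collect_countable_All)
qed

lemma sets_wins:
  assumes k: "\<bar>k\<bar> = int n" and J: "index_set - {Inr n} \<subseteq> J"
  shows "{f \<in> space (PiM J (\<lambda>_. borel)). wins c (values_of f) (copies_of f) t k} \<in> sets (PiM J (\<lambda>_. borel))"
proof -
  let ?N = "PiM J (\<lambda>_. borel :: real measure)"
  have Inl: "Inl z \<in> J" for z using J by auto
  have [measurable]: "(\<lambda>f. \<Psi> (values_of f) t z) \<in> borel_measurable ?N" for z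
    unfolding \<Psi>_def values_of_def using Inl[of z] by measurable
  have [measurable]: "Measurable.pred ?N (\<lambda>f. beats_outside (values_of f) (copies_of f) t k)"
    using sets_beats_outside[OF assms, of t] by (simp add: pred_def)
  have "{f \<in> space ?N. \<Psi> (values_of f) t k \<le> \<Psi> (values_of f) t (- k)} \<in> sets ?N"
    by measurable
  then have [measurable]: "Measurable.pred ?N (\<lambda>f. \<Psi> (values_of f) t k \<le> \<Psi> (values_of f) t (- k))"
    by (simp add: pred_def)
  show ?thesis unfolding wins_def by measurable
qed

context duplicated_pareto
begin

definition coordinate :: "int + nat \<Rightarrow> 'a \<Rightarrow> real" where
  "coordinate = case_sum \<xi>0 (\<lambda>n \<omega>. of_bool (dup n \<omega>))"

lemma indep_coordinate: "indep_vars (\<lambda>_. borel) coordinate index_set"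
  unfolding coordinate_def by (rule indep)

lemma measurable_coordinate:
  "i \<in> index_set \<Longrightarrow> coordinate i \<in> borel_measurable M"
  using indep_coordinate unfolding indep_vars_def by blast

lemma values_of_coordinate:
  "index_set - {Inr n} \<subseteq> J \<Longrightarrow> values_of (restrict (\<lambda>i. coordinate i \<omega>) J) = (\<lambda>z. \<xi>0 z \<omega>)"
  by (auto simp: values_of_def coordinate_def fun_eq_iff)

lemma copies_of_coordinate:
  "index_set - {Inr n} \<subseteq> J \<Longrightarrow> 1 \<le> j \<Longrightarrow> j \<noteq> n \<Longrightarrow> copies_of (restrict (\<lambda>i. coordinate i \<omega>) J) j = dup j \<omega>"
  by (auto simp: copies_of_def coordinate_def)

text \<open>
The distribution function is prescribed from 1 on, and at 1 it vanishes.
\<close>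

lemma distr_pareto_eq: "distr M borel (\<xi>0 i) = distr M borel (\<xi>0 j)"
proof (rule cdf_unique)
  show "real_distribution (distr M borel (\<xi>0 i))" "real_distribution (distr M borel (\<xi>0 j))"
    by (auto intro: real_distribution_distr)
  have zero: "prob {\<omega> \<in> space M. \<xi>0 z \<omega> \<le> x} = 0" if "x < 1" for z x
  proof -
    have "prob {\<omega> \<in> space M. \<xi>0 z \<omega> \<le> x} \<le> prob {\<omega> \<in> space M. \<xi>0 z \<omega> \<le> 1}"
      using that by (intro finite_measure_mono) auto
    also have "\<dots> = 0" using pareto[of 1 z] by simp
    finally show ?thesis by (simp add: measure_le_0_iff)
  qed
  have "cdf (distr M borel (\<xi>0 z)) x = (if 1 \<le> x then 1 - x powr (- \<alpha>) else 0)" for z x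
  proof -
    have "cdf (distr M borel (\<xi>0 z)) x = prob {\<omega> \<in> space M. \<xi>0 z \<omega> \<le> x}"
      unfolding cdf_def by (subst measure_distr) (auto simp: vimage_def Int_def conj_commute)
    then show ?thesis using pareto zero by auto
  qed
  then show "cdf (distr M borel (\<xi>0 i)) = cdf (distr M borel (\<xi>0 j))" by (simp add: fun_eq_iff)
qed

lemma restrict_swap:
  "restrict (\<lambda>i. coordinate (swap_sites n i) \<omega>) index_set =
   restrict (\<lambda>i. (restrict (\<lambda>i. coordinate i \<omega>) index_set) (swap_sites n i)) index_set"
  by (rule restrict_ext) (auto simp: swap_sites_def)

text \<open>
The joint law of the coordinates is a product measure whose factors are unchanged by the interchange.
\<close>

lemma prob_swap_invariant:
  assumes S: "S \<in> sets (PiM index_set (\<lambda>_. borel))"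
  shows "prob {\<omega> \<in> space M. restrict (\<lambda>i. coordinate (swap_sites n i) \<omega>) index_set \<in> S}
    = prob {\<omega> \<in> space M. restrict (\<lambda>i. coordinate i \<omega>) index_set \<in> S}"
proof -
  let ?I = index_set
  let ?D = "\<lambda>i. distr M borel (coordinate i)"
  let ?Z = "\<lambda>\<omega>. restrict (\<lambda>i. coordinate i \<omega>) ?I"
  let ?P = "PiM ?I (\<lambda>_. borel :: real measure)"
  let ?w = "\<lambda>f. \<lambda>i\<in>?I. f (swap_sites n i)"
  have w_in: "swap_sites n i \<in> ?I" if "i \<in> ?I" for i
    using that by (auto simp: swap_sites_def)
  have inj: "inj_on (swap_sites n) ?I"
    unfolding swap_sites_def by (intro inj_on_subset[OF sum.inj_map]) (auto simp: inj_on_def split: if_splits)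
  have D: "?D (swap_sites n i) = ?D i" for i
    by (cases i) (auto simp: swap_sites_def coordinate_def distr_pareto_eq)
  have Zm: "?Z \<in> M \<rightarrow>\<^sub>M ?P" by (rule measurable_restrict) (rule measurable_coordinate)
  have law: "distr M ?P ?Z = PiM ?I ?D"
    using indep_coordinate
    by (subst (asm) indep_vars_iff_distr_eq_PiM') (auto intro: measurable_coordinate)
  have wm: "?w \<in> ?P \<rightarrow>\<^sub>M ?P"
    by (intro measurable_restrict measurable_component_singleton w_in)
  have setsD: "sets (PiM ?I ?D) = sets ?P" by (intro sets_PiM_cong) auto
  have inv: "distr (PiM ?I ?D) (PiM ?I ?D) ?w = PiM ?I ?D"
    using distr_PiM_reindex[of ?I ?D "swap_sites n" ?I] inj w_in
    by (simp add: D prob_space_distr measurable_coordinate)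
  have "emeasure M {\<omega> \<in> space M. restrict (\<lambda>i. coordinate (swap_sites n i) \<omega>) ?I \<in> S}
    = emeasure M ((\<lambda>\<omega>. ?w (?Z \<omega>)) -` S \<inter> space M)"
    by (intro arg_cong[where f="emeasure M"])
       (simp only: restrict_swap vimage_def Int_def mem_Collect_eq conj_commute)
  also have "\<dots> = emeasure (distr M ?P (\<lambda>\<omega>. ?w (?Z \<omega>))) S"
    by (rule emeasure_distr[symmetric]) (use S measurable_compose[OF Zm wm] in auto)
  also have "distr M ?P (\<lambda>\<omega>. ?w (?Z \<omega>)) = distr (distr M ?P ?Z) ?P ?w"
    by (subst distr_distr[OF wm Zm]) (simp add: comp_def)
  also have "\<dots> = distr (PiM ?I ?D) (PiM ?I ?D) ?w"
    unfolding law by (rule distr_cong[OF refl setsD[symmetric] refl])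
  also have "\<dots> = distr M ?P ?Z" unfolding inv law ..
  also have "emeasure (distr M ?P ?Z) S = emeasure M {\<omega> \<in> space M. ?Z \<omega> \<in> S}"
    using S by (subst emeasure_distr[OF Zm]) (auto simp: vimage_def Int_def conj_commute)
  finally show ?thesis unfolding measure_def by (rule arg_cong)
qed

text \<open>
Grouping the family into the single coordinate \<open>Inr n\<close> and all others preserves independence.
\<close>

lemma prob_indep_dup:
  assumes n: "1 \<le> n" and S: "S \<in> sets (PiM (index_set - {Inr n}) (\<lambda>_. borel))"
  defines "A \<equiv> {\<omega> \<in> space M. restrict (\<lambda>i. coordinate i \<omega>) (index_set - {Inr n}) \<in> S}"
  shows "A \<in> sets M" "prob {\<omega> \<in> A. dup n \<omega>} = p * prob A" "prob {\<omega> \<in> A. \<not> dup n \<omega>} = (1 - p) * prob A"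
proof -
  let ?I = "index_set - {Inr n}"
  have Zm: "(\<lambda>\<omega>. restrict (\<lambda>i. coordinate i \<omega>) ?I) \<in> M \<rightarrow>\<^sub>M PiM ?I (\<lambda>_. borel)"
    by (rule measurable_restrict) (auto intro: measurable_coordinate)
  have Dm: "(\<lambda>\<omega>. restrict (\<lambda>i. coordinate i \<omega>) {Inr n}) \<in> M \<rightarrow>\<^sub>M PiM {Inr n} (\<lambda>_. borel)"
    using n by (intro measurable_restrict measurable_coordinate) auto
  show A: "A \<in> sets M"
    unfolding A_def using measurable_sets[OF Zm S] by (simp add: vimage_def Int_def conj_commute)
  define K where "K b = (if b then {Inr n} else ?I)" for b :: bool
  define X where "X b = (if b then {f \<in> space (PiM {Inr n} (\<lambda>_. borel)). f (Inr n) = (1::real)} else S)" for b :: bool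
  have X: "X b \<in> sets (PiM (K b) (\<lambda>_. borel))" for b
  proof (cases b)
    case True
    have "{f \<in> space (PiM {Inr n} (\<lambda>_. borel)). f (Inr n :: int + nat) = (1::real)} \<in> sets (PiM {Inr n} (\<lambda>_. borel))"
      by measurable
    then show ?thesis using True by (simp add: X_def K_def)
  qed (use S in \<open>simp add: X_def K_def\<close>)
  have ind: "indep_vars (\<lambda>b. PiM (K b) (\<lambda>_. borel)) (\<lambda>b \<omega>. restrict (\<lambda>i. coordinate i \<omega>) (K b)) UNIV"
    by (rule indep_vars_restrict[OF indep_coordinate]) (use n in \<open>auto simp: K_def disjoint_family_on_def\<close>)
  have "prob (\<Inter>b\<in>UNIV. (\<lambda>\<omega>. restrict (\<lambda>i. coordinate i \<omega>) (K b)) -` X b \<inter> space M)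
    = (\<Prod>b\<in>UNIV. prob ((\<lambda>\<omega>. restrict (\<lambda>i. coordinate i \<omega>) (K b)) -` X b \<inter> space M))"
    by (rule indep_varsD[OF ind]) (auto intro: X)
  moreover have T: "(\<lambda>\<omega>. restrict (\<lambda>i. coordinate i \<omega>) (K True)) -` X True \<inter> space M = {\<omega> \<in> space M. dup n \<omega>}"
    by (auto simp: K_def X_def coordinate_def space_PiM)
  moreover have F: "(\<lambda>\<omega>. restrict (\<lambda>i. coordinate i \<omega>) (K False)) -` X False \<inter> space M = A"
    by (auto simp: K_def X_def A_def)
  ultimately have "prob ({\<omega> \<in> space M. dup n \<omega>} \<inter> A) = prob {\<omega> \<in> space M. dup n \<omega>} * prob A"
    by (simp add: UNIV_bool Int_commute mult.commute)
  also have "{\<omega> \<in> space M. dup n \<omega>} \<inter> A = {\<omega> \<in> A. dup n \<omega>}" by (auto simp: A_def)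
  finally show 1: "prob {\<omega> \<in> A. dup n \<omega>} = p * prob A" using dup_prob[OF n] by simp
  have Dn: "{\<omega> \<in> space M. dup n \<omega>} \<in> sets M" using measurable_dup[OF n] by (simp add: pred_def)
  have "{\<omega> \<in> A. \<not> dup n \<omega>} = A - {\<omega> \<in> A. dup n \<omega>}" by auto
  moreover have "{\<omega> \<in> A. dup n \<omega>} \<in> sets M"
    using sets.Int[OF A Dn] by (rule back_subst[of "\<lambda>S. S \<in> sets M"]) (auto simp: A_def)
  ultimately have "prob {\<omega> \<in> A. \<not> dup n \<omega>} = prob A - prob {\<omega> \<in> A. dup n \<omega>}"
    using A by (simp add: finite_measure_Diff Collect_mono_iff subset_iff)
  then show "prob {\<omega> \<in> A. \<not> dup n \<omega>} = (1 - p) * prob A" using 1 by (simp add: algebra_simps)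
qed

definition win :: "bool \<Rightarrow> real \<Rightarrow> int \<Rightarrow> 'a set" where
  "win c t k = {\<omega> \<in> space M. wins c (\<lambda>z. \<xi>0 z \<omega>) (\<lambda>n. dup n \<omega>) t k}"

lemma wins_coordinate:
  assumes "\<bar>k\<bar> = int n" "index_set - {Inr n} \<subseteq> J"
  shows "wins c (values_of (restrict (\<lambda>i. coordinate i \<omega>) J)) (copies_of (restrict (\<lambda>i. coordinate i \<omega>) J)) t k
     \<longleftrightarrow> wins c (\<lambda>z. \<xi>0 z \<omega>) (\<lambda>n. dup n \<omega>) t k"
  unfolding values_of_coordinate[OF assms(2)]
  by (rule wins_cong) (use assms copies_of_coordinate[OF assms(2)] in auto)

lemma space_coordinate:
  "J \<subseteq> index_set \<Longrightarrow> restrict (\<lambda>i. coordinate i \<omega>) J \<in> space (PiM J (\<lambda>_. borel))"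
  by (simp add: space_PiM)

lemma win_indep_dup:
  assumes n: "1 \<le> n" and k: "\<bar>k\<bar> = int n"
  shows "win c t k \<in> sets M" "prob {\<omega> \<in> win c t k. dup n \<omega>} = p * prob (win c t k)"
    "prob {\<omega> \<in> win c t k. \<not> dup n \<omega>} = (1 - p) * prob (win c t k)"
proof -
  have sub: "index_set - {Inr n} \<subseteq> index_set - {Inr n}" by simp
  let ?S = "{f \<in> space (PiM (index_set - {Inr n}) (\<lambda>_. borel)). wins c (values_of f) (copies_of f) t k}"
  have eq: "{\<omega> \<in> space M. restrict (\<lambda>i. coordinate i \<omega>) (index_set - {Inr n}) \<in> ?S} = win c t k"
    using wins_coordinate[OF k sub] space_coordinate[of "index_set - {Inr n}"] by (auto simp: win_def)
  from prob_indep_dup[OF n sets_wins[OF k sub, of c t]]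
  show "win c t k \<in> sets M" "prob {\<omega> \<in> win c t k. dup n \<omega>} = p * prob (win c t k)"
    "prob {\<omega> \<in> win c t k. \<not> dup n \<omega>} = (1 - p) * prob (win c t k)"
    unfolding eq by auto
qed

lemma swap_coordinate:
  "values_of (restrict (\<lambda>i. f (swap_sites n i)) index_set) = values_of (\<lambda>i. f (swap_sites n i))"
  by (auto simp: values_of_def fun_eq_iff)

lemma prob_win_mirror:
  assumes k: "\<bar>k\<bar> = int n"
  shows "prob (win c t (- k)) = prob (win c t k)"
proof -
  have sub: "index_set - {Inr n} \<subseteq> index_set" by auto
  let ?S = "{f \<in> space (PiM index_set (\<lambda>_. borel)). wins c (values_of f) (copies_of f) t k}"
  have k': "\<bar>- k\<bar> = int n" using k by simp
  have *: "wins c (values_of (restrict (\<lambda>i. coordinate (swap_sites n i) \<omega>) index_set))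
      (copies_of (restrict (\<lambda>i. coordinate (swap_sites n i) \<omega>) index_set)) t k
     \<longleftrightarrow> wins c (\<lambda>z. \<xi>0 z \<omega>) (\<lambda>n. dup n \<omega>) t (- k)" for \<omega>
  proof -
    let ?f = "restrict (\<lambda>i. coordinate i \<omega>) index_set"
    have "wins c (values_of (restrict (\<lambda>i. coordinate (swap_sites n i) \<omega>) index_set))
      (copies_of (restrict (\<lambda>i. coordinate (swap_sites n i) \<omega>) index_set)) t k
      \<longleftrightarrow> wins c (values_of (\<lambda>i. ?f (swap_sites n i))) (copies_of (\<lambda>i. ?f (swap_sites n i))) t k"
      unfolding restrict_swap swap_coordinate by (rule wins_cong) (auto simp: copies_of_def)
    also have "\<dots> \<longleftrightarrow> wins c (values_of ?f) (copies_of ?f) t (- k)"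
      by (rule wins_swap[OF k])
    finally show ?thesis using wins_coordinate[OF k' sub] by simp
  qed
  have "prob (win c t (- k)) = prob {\<omega> \<in> space M. restrict (\<lambda>i. coordinate (swap_sites n i) \<omega>) index_set \<in> ?S}"
    using * by (auto simp: win_def space_PiM)
  also have "\<dots> = prob {\<omega> \<in> space M. restrict (\<lambda>i. coordinate i \<omega>) index_set \<in> ?S}"
    by (rule prob_swap_invariant[OF sets_wins[OF k sub]])
  also have "\<dots> = prob (win c t k)"
    using wins_coordinate[OF k sub] by (auto simp: win_def space_PiM)
  finally show ?thesis .
qed

end

section \<open>The probability of two maximisers\<close>

text \<open>
Two variables that are seen at their own sites cannot both beat the other one.
\<close>

lemma beats_outside_disjoint:
  assumes "beats_outside x \<delta> t k" "beats_outside x \<delta> t k'" "\<bar>k\<bar> \<noteq> \<bar>k'\<bar>"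
    and "source \<delta> k = k" "source \<delta> k' = k'"
  shows False
proof -
  have "\<Psi> x t k' < \<Psi> x t k" "\<Psi> x t k < \<Psi> x t k'"
    using assms unfolding beats_outside_def by metis+
  then show False by simp
qed

context duplicated_pareto
begin

lemma sets_win_dup:
  assumes n: "1 \<le> n" and k: "\<bar>k\<bar> = int n"
  shows "{\<omega> \<in> win c t k. dup n \<omega>} \<in> sets M" "{\<omega> \<in> win c t k. \<not> dup n \<omega>} \<in> sets M"
proof -
  note [measurable] = measurable_dup[OF n]
  have W: "win c t k \<in> sets M" by (rule win_indep_dup[OF n k])
  then have sub: "win c t k \<subseteq> space M" by (rule sets.sets_into_space)
  have "win c t k \<inter> {\<omega> \<in> space M. dup n \<omega>} \<in> sets M" "win c t k \<inter> {\<omega> \<in> space M. \<not> dup n \<omega>} \<in> sets M"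
    using W by (intro sets.Int; measurable)+
  moreover have "win c t k \<inter> {\<omega> \<in> space M. dup n \<omega>} = {\<omega> \<in> win c t k. dup n \<omega>}"
    "win c t k \<inter> {\<omega> \<in> space M. \<not> dup n \<omega>} = {\<omega> \<in> win c t k. \<not> dup n \<omega>}"
    using sub by auto
  ultimately show "{\<omega> \<in> win c t k. dup n \<omega>} \<in> sets M" "{\<omega> \<in> win c t k. \<not> dup n \<omega>} \<in> sets M"
    by auto
qed

text \<open>
Let \<open>q\<close> be the sum of the probabilities of \<open>win False t n\<close> over the pairs \<open>n\<close> in the box. On \<open>G\<close> some
variable wins, which gives \<open>1 - \<eta> \<le> (2 - p) * q\<close>, the weight \<open>2 - p\<close> being \<open>1\<close> for the index \<open>n\<close> and
\<open>1 - p\<close> for the index \<open>- n\<close>, which is seen only without duplication. In the other direction these events are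
disjoint, except that both variables of one pair may win. In that case one of the two events
\<open>win True\<close> occurs; these have small probability because on their intersection with duplication, an independent
event of probability \<open>p\<close>, the potential is not typical. The events of winning with duplication are disjoint, have
total probability \<open>p * q\<close>, and up to \<open>\<eta>\<close> are the event of two maximisers.
\<close>

theorem prob_two_maximisers_bounds:
  assumes G: "G \<in> sets M"
    and env: "AE \<omega> in M. \<omega> \<in> G \<longrightarrow> typical_environment t R B b D c L (\<lambda>z. \<xi>0 z \<omega>) (\<lambda>n. dup n \<omega>) (potential \<xi>0 dup \<omega>)"
    and C: "{\<omega> \<in> space M. card (maximisers (potential \<xi>0 dup \<omega>) t) = 2} \<in> sets M" (is "?C \<in> _")
  defines "\<eta> \<equiv> prob (space M - G)"
  shows "p * (1 - \<eta>) / (2 - p) \<le> prob ?C"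
    and "prob ?C \<le> (p + 2 * (1 - p) * \<eta>) / (2 - p) + \<eta>"
proof -
  define I where "I = {1..nat \<lfloor>R\<rfloor>}"
  have I: "finite I" "\<And>n. n \<in> I \<Longrightarrow> 1 \<le> n" by (auto simp: I_def)
  \<comment> \<open>A: the right variable wins; A2: it wins and is duplicated; B1: the left one wins and is seen; T2: the right one wins, is duplicated, and the left one is at least as good.\<close>
  define A where "A n = win False t (int n)" for n
  define A2 where "A2 n = {\<omega> \<in> win False t (int n). dup n \<omega>}" for n
  define B1 where "B1 n = {\<omega> \<in> win False t (- int n). \<not> dup n \<omega>}" for n
  define T2 where "T2 n = {\<omega> \<in> win True t (int n). dup n \<omega>}" for n
  define q where "q = (\<Sum>n\<in>I. prob (A n))"
  define l where "l = (\<Sum>n\<in>I. prob (win True t (int n)))"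
  have sp: "source \<delta> (int n) = int n" for \<delta> n by (simp add: source_def)
  have sm: "source \<delta> (- int n) = - int n" if "\<not> \<delta> n" for \<delta> n using that by (simp add: source_def)
  have beats: "beats_outside (\<lambda>z. \<xi>0 z \<omega>) (\<lambda>n. dup n \<omega>) t k" if "\<omega> \<in> win c' t k" for c' \<omega> k
    using that by (simp add: win_def wins_def)
  have sA: "A n \<in> sets M" if "n \<in> I" for n
    unfolding A_def using win_indep_dup(1)[of n "int n"] I(2)[OF that] by simp
  have sA2: "A2 n \<in> sets M" if "n \<in> I" for n
    unfolding A2_def using sets_win_dup(1)[of n "int n"] I(2)[OF that] by simp
  have sB1: "B1 n \<in> sets M" if "n \<in> I" for n
    unfolding B1_def using sets_win_dup(2)[of n "- int n"] I(2)[OF that] by simp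
  have sT2: "T2 n \<in> sets M" if "n \<in> I" for n
    unfolding T2_def using sets_win_dup(1)[of n "int n"] I(2)[OF that] by simp
  have pA2: "prob (A2 n) = p * prob (A n)" if "n \<in> I" for n
    unfolding A2_def A_def using win_indep_dup(2)[of n "int n"] I(2)[OF that] by simp
  have pT2: "prob (T2 n) = p * prob (win True t (int n))" if "n \<in> I" for n
    unfolding T2_def using win_indep_dup(2)[of n "int n"] I(2)[OF that] by simp
  have pB1: "prob (B1 n) = (1 - p) * prob (A n)" if "n \<in> I" for n
    unfolding B1_def A_def using win_indep_dup(3)[of n "- int n"] I(2)[OF that] prob_win_mirror[of "int n" n]
    by simp
  have disjA: "disjoint_family_on A I"
    unfolding disjoint_family_on_def A_def
    using beats_outside_disjoint[of _ _ t "int _" "int _", OF beats beats _ sp sp] by fastforce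
  have disjA2: "disjoint_family_on A2 I"
    by (rule disjoint_family_on_bisimulation[OF disjA]) (auto simp: A_def A2_def)
  have disjT2: "disjoint_family_on T2 I"
    by (rule disjoint_family_on_bisimulation[OF disjA]) (auto simp: A_def T2_def win_def wins_def)
  have disjAB: "disjoint_family_on (\<lambda>n. A n \<union> B1 n) I"
    unfolding disjoint_family_on_def
  proof (intro ballI impI)
    fix m n assume mn: "m \<in> I" "n \<in> I" "m \<noteq> n"
    show "(A m \<union> B1 m) \<inter> (A n \<union> B1 n) = {}"
    proof (rule ccontr)
      assume "\<not> ?thesis"
      then obtain \<omega> where \<omega>: "\<omega> \<in> A m \<union> B1 m" "\<omega> \<in> A n \<union> B1 n" by auto
      let ?\<delta> = "\<lambda>n. dup n \<omega>" and ?x = "\<lambda>z. \<xi>0 z \<omega>"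
      have k: "\<exists>k. \<bar>k\<bar> = int n \<and> source ?\<delta> k = k \<and> beats_outside ?x ?\<delta> t k" if "\<omega> \<in> A n \<union> B1 n" for n
      proof (cases "\<omega> \<in> A n")
        case True
        then show ?thesis using sp[of ?\<delta> n] beats[of \<omega> False "int n"]
          by (intro exI[of _ "int n"]) (simp add: A_def)
      next
        case False
        then have "\<omega> \<in> B1 n" using that by simp
        then show ?thesis using sm[of ?\<delta> n] beats[of \<omega> False "- int n"]
          by (intro exI[of _ "- int n"]) (simp add: B1_def)
      qed
      show False
        using k[OF \<omega>(1)] k[OF \<omega>(2)] mn(3) beats_outside_disjoint[of ?x ?\<delta> t] by (metis of_nat_eq_iff)
    qed
  qed
  have pp: "0 < p" "p < 1" by (rule p_range)+
  have \<eta>: "prob G = 1 - \<eta>" unfolding \<eta>_def using prob_compl[OF G] by simp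
  have q0: "0 \<le> q" unfolding q_def by (intro sum_nonneg) simp
  have "prob G \<le> prob (\<Union>n\<in>I. A n \<union> B1 n)"
  proof (rule finite_measure_mono_AE)
    show "AE \<omega> in M. \<omega> \<in> G \<longrightarrow> \<omega> \<in> (\<Union>n\<in>I. A n \<union> B1 n)"
      using env AE_space
    proof eventually_elim
      case (elim \<omega>)
      show ?case
      proof
        assume "\<omega> \<in> G"
        then interpret E: typical_environment t R B b D c L "\<lambda>z. \<xi>0 z \<omega>" "\<lambda>n. dup n \<omega>" "potential \<xi>0 dup \<omega>"
          using elim by blast
        from E.ex_beats_outside show "\<omega> \<in> (\<Union>n\<in>I. A n \<union> B1 n)"
          using elim(2) by (auto simp: A_def B1_def I_def win_def wins_def)
      qed
    qed
    show "(\<Union>n\<in>I. A n \<union> B1 n) \<in> sets M" using I sA sB1 by (intro sets.finite_UN sets.Un) auto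
  qed
  also have "\<dots> \<le> (\<Sum>n\<in>I. prob (A n \<union> B1 n))"
    by (rule finite_measure_subadditive_finite) (use I sA sB1 in auto)
  also have "\<dots> \<le> (\<Sum>n\<in>I. prob (A n) + prob (B1 n))"
    by (intro sum_mono measure_Un_le sA sB1)
  also have "\<dots> = (\<Sum>n\<in>I. (2 - p) * prob (A n))"
    by (intro sum.cong refl) (simp add: pB1 algebra_simps)
  also have "\<dots> = (2 - p) * q" by (simp add: q_def sum_distrib_left)
  finally have lower: "1 - \<eta> \<le> (2 - p) * q" using \<eta> by simp
  have "p * l = (\<Sum>n\<in>I. prob (T2 n))" by (simp add: l_def sum_distrib_left pT2)
  also have "\<dots> = prob (\<Union>n\<in>I. T2 n)"
    by (rule finite_measure_finite_Union[symmetric]) (use I sT2 disjT2 in auto)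
  also have "\<dots> \<le> prob (space M - G)"
  proof (rule finite_measure_mono_AE)
    show "AE \<omega> in M. \<omega> \<in> (\<Union>n\<in>I. T2 n) \<longrightarrow> \<omega> \<in> space M - G"
      using env AE_space
    proof eventually_elim
      case (elim \<omega>)
      have False if "\<omega> \<in> G" "n \<in> I" "\<omega> \<in> T2 n" for n
      proof -
        interpret E: typical_environment t R B b D c L "\<lambda>z. \<xi>0 z \<omega>" "\<lambda>n. dup n \<omega>" "potential \<xi>0 dup \<omega>"
          using elim that by blast
        show False using E.no_high_pair[of n] that I(2)[OF that(2)] by (auto simp: T2_def win_def wins_def)
      qed
      then show ?case using elim(2) by auto
    qed
  qed (use G in auto)
  finally have pl: "p * l \<le> \<eta>" by (simp add: \<eta>_def)
  have "(2 - p) * q = (\<Sum>n\<in>I. prob (A n) + prob (B1 n))"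
    unfolding q_def sum_distrib_left by (intro sum.cong refl) (simp add: pB1 algebra_simps)
  also have "\<dots> \<le> (\<Sum>n\<in>I. prob (A n \<union> B1 n) + 2 * (1 - p) * prob (win True t (int n)))"
  proof (rule sum_mono)
    fix n assume n: "n \<in> I"
    note n1 = I(2)[OF n]
    have "prob (A n \<inter> B1 n) \<le> prob ({\<omega> \<in> win True t (int n). \<not> dup n \<omega>} \<union> {\<omega> \<in> win True t (- int n). \<not> dup n \<omega>})"
    proof (rule finite_measure_mono)
      show "A n \<inter> B1 n \<subseteq> {\<omega> \<in> win True t (int n). \<not> dup n \<omega>} \<union> {\<omega> \<in> win True t (- int n). \<not> dup n \<omega>}"
        by (auto simp: A_def B1_def win_def wins_def)
      show "{\<omega> \<in> win True t (int n). \<not> dup n \<omega>} \<union> {\<omega> \<in> win True t (- int n). \<not> dup n \<omega>} \<in> sets M"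
        using sets_win_dup(2)[of n "int n"] sets_win_dup(2)[of n "- int n"] n1 by auto
    qed
    also have "\<dots> \<le> prob {\<omega> \<in> win True t (int n). \<not> dup n \<omega>} + prob {\<omega> \<in> win True t (- int n). \<not> dup n \<omega>}"
      by (rule measure_Un_le) (use sets_win_dup(2)[of n "int n"] sets_win_dup(2)[of n "- int n"] n1 in auto)
    also have "\<dots> = 2 * (1 - p) * prob (win True t (int n))"
      using win_indep_dup(3)[of n "int n"] win_indep_dup(3)[of n "- int n"] prob_win_mirror[of "int n" n] n1
      by simp
    finally have "prob (A n \<inter> B1 n) \<le> 2 * (1 - p) * prob (win True t (int n))" .
    moreover have "prob (A n \<union> B1 n) = prob (A n) + prob (B1 n) - prob (A n \<inter> B1 n)"
      using measure_Un3[of "A n" M "B1 n"] sA[OF n] sB1[OF n] by (simp add: fmeasurable_eq_sets)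
    ultimately show "prob (A n) + prob (B1 n) \<le> prob (A n \<union> B1 n) + 2 * (1 - p) * prob (win True t (int n))"
      by simp
  qed
  also have "\<dots> = (\<Sum>n\<in>I. prob (A n \<union> B1 n)) + 2 * (1 - p) * l"
    by (simp add: sum.distrib sum_distrib_left l_def)
  also have "(\<Sum>n\<in>I. prob (A n \<union> B1 n)) = prob (\<Union>n\<in>I. A n \<union> B1 n)"
    by (rule finite_measure_finite_Union[symmetric]) (use I sA sB1 disjAB in auto)
  also have "prob (\<Union>n\<in>I. A n \<union> B1 n) + 2 * (1 - p) * l \<le> 1 + 2 * (1 - p) * l"
    by simp
  finally have "(2 - p) * q \<le> 1 + 2 * (1 - p) * l" .
  then have "p * ((2 - p) * q) \<le> p * (1 + 2 * (1 - p) * l)" using pp by (intro mult_left_mono) auto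
  also have "\<dots> = p + 2 * (1 - p) * (p * l)" by (simp add: algebra_simps)
  also have "\<dots> \<le> p + 2 * (1 - p) * \<eta>" using pl pp by (intro add_left_mono mult_left_mono) auto
  finally have upper: "p * q \<le> (p + 2 * (1 - p) * \<eta>) / (2 - p)"
    using pp by (simp add: pos_le_divide_eq mult_ac)
  have "p * q = (\<Sum>n\<in>I. prob (A2 n))" by (simp add: q_def sum_distrib_left pA2)
  also have "\<dots> = prob (\<Union>n\<in>I. A2 n)"
    by (rule finite_measure_finite_Union[symmetric]) (use I sA2 disjA2 in auto)
  finally have pq: "p * q = prob (\<Union>n\<in>I. A2 n)" .
  have "prob (\<Union>n\<in>I. A2 n) \<le> prob ?C"
  proof (rule finite_measure_mono[OF _ C], rule subsetI)
    fix \<omega> assume "\<omega> \<in> (\<Union>n\<in>I. A2 n)"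
    then obtain n where n: "n \<in> I" "\<omega> \<in> A2 n" by auto
    have "maximisers (potential \<xi>0 dup \<omega>) t = {int n, - int n}"
      by (rule maximisers_duplicated[of _ "\<lambda>z. \<xi>0 z \<omega>" "\<lambda>n. dup n \<omega>"])
         (use n I in \<open>auto simp: potential_eq_source A2_def beats\<close>)
    then show "\<omega> \<in> ?C" using n I(2)[OF n(1)] by (auto simp: A2_def win_def)
  qed
  with pq lower pp show "p * (1 - \<eta>) / (2 - p) \<le> prob ?C"
  proof -
    have "p * (1 - \<eta>) \<le> p * ((2 - p) * q)" using lower pp by (intro mult_left_mono) auto
    then have "p * (1 - \<eta>) / (2 - p) \<le> p * q" using pp by (simp add: pos_divide_le_eq mult_ac)
    then show ?thesis using \<open>prob (\<Union>n\<in>I. A2 n) \<le> prob ?C\<close> pq by simp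
  qed
  have "prob ?C \<le> prob ((\<Union>n\<in>I. A2 n) \<union> (space M - G))"
  proof (rule finite_measure_mono_AE)
    show "AE \<omega> in M. \<omega> \<in> ?C \<longrightarrow> \<omega> \<in> (\<Union>n\<in>I. A2 n) \<union> (space M - G)"
      using env
    proof eventually_elim
      case (elim \<omega>)
      show ?case
      proof
        assume \<omega>: "\<omega> \<in> ?C"
        show "\<omega> \<in> (\<Union>n\<in>I. A2 n) \<union> (space M - G)"
        proof (cases "\<omega> \<in> G")
          case True
          then interpret E: typical_environment t R B b D c L "\<lambda>z. \<xi>0 z \<omega>" "\<lambda>n. dup n \<omega>" "potential \<xi>0 dup \<omega>"
            using elim by blast
          from E.two_maximisers \<omega> show ?thesis by (auto simp: A2_def I_def win_def wins_def)
        qed (use \<omega> in auto)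
      qed
    qed
    show "(\<Union>n\<in>I. A2 n) \<union> (space M - G) \<in> sets M" using I sA2 G by (intro sets.Un sets.finite_UN) auto
  qed
  also have "\<dots> \<le> p * q + \<eta>"
    unfolding pq \<eta>_def by (rule measure_Un_le) (use I sA2 G in \<open>auto intro!: sets.finite_UN\<close>)
  finally show "prob ?C \<le> (p + 2 * (1 - p) * \<eta>) / (2 - p) + \<eta>" using upper by linarith
qed

end

section \<open>The scales\<close>

text \<open>
The solution \<open>a\<close> of \<open>a powr (\<alpha> - 1) = t / ln t\<close>: values of size \<open>a\<close> occur within distance \<open>a powr \<alpha>\<close>, and a walk
to that distance costs \<open>a powr \<alpha> * ln a\<close>, which is of the order of the gain \<open>t * a\<close>.
\<close>

definition scale :: "real \<Rightarrow> real \<Rightarrow> real" where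
  "scale \<alpha> t = (t / ln t) powr (1 / (\<alpha> - 1))"

definition box_radius :: "real \<Rightarrow> real \<Rightarrow> real" where
  "box_radius \<alpha> t = ln (ln t) * scale \<alpha> t powr \<alpha>"

definition near_radius :: "real \<Rightarrow> real \<Rightarrow> real" where
  "near_radius \<alpha> t = (\<alpha> - 1) * scale \<alpha> t powr \<alpha> / ln (ln t)"

definition value_cap :: "real \<Rightarrow> real \<Rightarrow> real" where
  "value_cap \<alpha> t = ln (ln t) * scale \<alpha> t"

definition score_level :: "real \<Rightarrow> real \<Rightarrow> real" where
  "score_level \<alpha> t = scale \<alpha> t / ln (ln t)"

definition score_gap :: "real \<Rightarrow> real \<Rightarrow> real" where
  "score_gap \<alpha> t = scale \<alpha> t * ln (ln t) powr (- (2 * \<alpha> + 4))"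

definition far_slope :: "real \<Rightarrow> real \<Rightarrow> real" where
  "far_slope \<alpha> t = ln t / (2 * (\<alpha> - 1) * t)"

text \<open>
The inequalities between the scales that hold for all large \<open>t\<close>. From here on only algebra with
\<open>t * a = q * r\<close> is left.
\<close>

locale scaling =
  fixes \<alpha> t q l a r :: real
  assumes \<alpha>: "1 < \<alpha>" and t: "1 < t" and q: "q = ln t" and l: "l = ln q" and a: "a = scale \<alpha> t"
    and r: "r = a powr \<alpha>" and q1: "1 < q"
    and l_large: "32 \<le> l" "\<alpha> - 1 \<le> l" "2 * (\<alpha> - 1) \<le> l"
    and a_large: "4 * l \<le> a" "2 * (\<alpha> - 1) \<le> a" "q \<le> a"
    and gap_large: "16 \<le> a * l powr (- (2 * \<alpha> + 4))"
    and q_l: "4 * l\<^sup>2 \<le> q"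
    and ln_b: "q / (2 * (\<alpha> - 1)) \<le> (q - l) / (\<alpha> - 1) - ln l"
    and ln_B: "ln l \<le> l / (\<alpha> - 1)"
    and ln_far: "5 / 8 * q / (\<alpha> - 1) + 1 \<le> ln l + (q - l) / (\<alpha> - 1) - l - ln 2 - 1"
    and error: "l * ln (2 * exp 1 * l * q) + 1 + 3 * l + 2 + 1 \<le> 3 / 4 * q * l powr (- (2 * \<alpha> + 4))"
    and error2: "3 * l + 2 + 1 \<le> q / l"

lemma eventually_scaling:
  assumes \<alpha>: "1 < \<alpha>"
  shows "\<forall>\<^sub>F t in at_top. scaling \<alpha> t (ln t) (ln (ln t)) (scale \<alpha> t) (scale \<alpha> t powr \<alpha>)"
proof -
  define \<beta> where "\<beta> = 1 / (\<alpha> - 1)"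
  define m where "m = 2 * \<alpha> + 4"
  have \<beta>: "0 < \<beta>" using \<alpha> by (simp add: \<beta>_def)
  have q: "filterlim (\<lambda>t::real. ln t) at_top at_top" by real_asymp
  have l: "filterlim (\<lambda>t::real. ln (ln t)) at_top at_top" by real_asymp
  have a: "filterlim (\<lambda>t::real. (t / ln t) powr \<beta>) at_top at_top" using \<beta> by real_asymp
  have 1: "\<forall>\<^sub>F t in at_top. 4 * ln (ln t) \<le> (t / ln t) powr \<beta>" using \<beta> by real_asymp
  have 2: "\<forall>\<^sub>F t in at_top. ln t \<le> (t / ln t) powr \<beta>" using \<beta> by real_asymp
  have 3: "\<forall>\<^sub>F t in at_top. 16 \<le> (t / ln t) powr \<beta> * ln (ln t) powr (- m)" using \<beta> by real_asymp
  have 4: "\<forall>\<^sub>F t::real in at_top. 4 * (ln (ln t))\<^sup>2 \<le> ln t" by real_asymp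
  have 5: "\<forall>\<^sub>F t in at_top. (\<beta> / 2) * ln t \<le> \<beta> * (ln t - ln (ln t)) - ln (ln (ln t))" using \<beta> by real_asymp
  have 6: "\<forall>\<^sub>F t in at_top. ln (ln (ln t)) \<le> \<beta> * ln (ln t)" using \<beta> by real_asymp
  have 7: "\<forall>\<^sub>F t in at_top. (5 * \<beta> / 8) * ln t + 1 \<le> ln (ln (ln t)) + \<beta> * (ln t - ln (ln t)) - ln (ln t) - ln 2 - 1"
    using \<beta> by real_asymp
  have 8: "\<forall>\<^sub>F t in at_top. ln (ln t) * ln (2 * exp 1 * ln (ln t) * ln t) + 1 + 3 * ln (ln t) + 2 + 1
      \<le> 3 / 4 * ln t * ln (ln t) powr (- m)" by real_asymp
  have 9: "\<forall>\<^sub>F t::real in at_top. 3 * ln (ln t) + 2 + 1 \<le> ln t / ln (ln t)" by real_asymp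
  note ev = filterlim_at_top_dense[THEN iffD1, rule_format]
  show ?thesis
    using eventually_gt_at_top[of 1] ev[OF q, of 1] ev[OF l, of "max 32 (2 * (\<alpha> - 1))"]
      ev[OF a, of "2 * (\<alpha> - 1)"] 1 2 3 4 5 6 7 8 9
  proof eventually_elim
    case (elim t)
    have sc: "scale \<alpha> t = (t / ln t) powr \<beta>" by (simp add: scale_def \<beta>_def)
    show ?case
    proof
      have e: "ln t / (2 * (\<alpha> - 1)) = \<beta> / 2 * ln t" "5 / 8 * ln t / (\<alpha> - 1) = 5 * \<beta> / 8 * ln t"
        "(ln t - ln (ln t)) / (\<alpha> - 1) = \<beta> * (ln t - ln (ln t))"
        by (simp_all add: \<beta>_def)
      show "ln t / (2 * (\<alpha> - 1)) \<le> (ln t - ln (ln t)) / (\<alpha> - 1) - ln (ln (ln t))"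
        unfolding e by (rule elim(9))
      show "5 / 8 * ln t / (\<alpha> - 1) + 1 \<le> ln (ln (ln t)) + (ln t - ln (ln t)) / (\<alpha> - 1) - ln (ln t) - ln 2 - 1"
        unfolding e by (rule elim(11))
      show "ln (ln (ln t)) \<le> ln (ln t) / (\<alpha> - 1)" using elim(10) by (simp add: \<beta>_def)
    qed (use elim \<alpha> in \<open>auto simp: sc m_def\<close>)
  qed
qed

context scaling
begin

lemma pos: "0 < t" "0 < q" "0 < l" "0 < a" "0 < r"
  using t q1 l_large a_large by (auto simp: r)

lemma r_powr: "a * a powr (\<alpha> - 1) = r"
  using pos by (simp add: r powr_diff)

lemma t_eq: "t = q * a powr (\<alpha> - 1)"
  using pos \<alpha> by (simp add: a scale_def powr_powr q)

lemma ta: "t * a = q * r"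
  using t_eq r_powr by (metis mult.assoc mult.commute)

lemma ln_a: "ln a = (q - l) / (\<alpha> - 1)"
  using pos \<alpha> by (simp add: a scale_def ln_powr ln_div q[symmetric] l[symmetric])

lemma r_ge: "a \<le> r"
  using pos a_large l_large \<alpha> powr_mono[of 1 \<alpha> a] by (simp add: r)

lemma params:
  "box_radius \<alpha> t = l * r" "near_radius \<alpha> t = (\<alpha> - 1) * r / l" "value_cap \<alpha> t = l * a"
  "score_level \<alpha> t = a / l" "score_gap \<alpha> t = a * l powr (- (2 * \<alpha> + 4))" "far_slope \<alpha> t = q / (2 * (\<alpha> - 1) * t)"
  by (simp_all add: box_radius_def near_radius_def value_cap_def score_level_def score_gap_def far_slope_def q l a r)

lemma level_ge: "4 \<le> a / l" using pos a_large by (simp add: le_divide_eq)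

lemma radius_ge_1: "1 \<le> l * r"
  using pos r_ge a_large l_large mult_mono[of 1 l 1 r] by auto

lemma slope_pos: "0 < q / (2 * (\<alpha> - 1) * t)" using pos \<alpha> by simp

lemma slope_radius: "1 \<le> q / (2 * (\<alpha> - 1) * t) * (l * r)"
proof -
  have "q / (2 * (\<alpha> - 1) * t) * (l * r) = (l * (q * r)) / (2 * (\<alpha> - 1) * t)" by simp
  also have "\<dots> = l * a / (2 * (\<alpha> - 1))" using pos \<alpha> by (simp add: ta[symmetric] field_simps)
  finally show ?thesis using pos \<alpha> a_large l_large mult_mono[of 1 l "2 * (\<alpha> - 1)" a] by (simp add: le_divide_eq)
qed

lemma radius_over_t: "l * r / t = l * a / q"
  using pos ta by (simp add: field_simps)

lemma radius_t_level: "l * r / t \<le> a / l / 4"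
  unfolding radius_over_t using pos q_l by (simp add: field_simps power2_eq_square)

lemma gap_pos: "0 < a * l powr (- (2 * \<alpha> + 4))" using pos by simp

lemma gap_level: "32 * (a * l powr (- (2 * \<alpha> + 4))) \<le> a / l"
proof -
  have "l powr (- (2 * \<alpha> + 4)) \<le> l powr (- 2)" using l_large \<alpha> by (intro powr_mono) auto
  also have "\<dots> = 1 / (l * l)" using pos by (simp add: powr_minus powr_numeral power2_eq_square divide_inverse)
  also have "\<dots> \<le> 1 / (32 * l)" using pos l_large by (intro divide_left_mono mult_right_mono) auto
  finally have "a * l powr (- (2 * \<alpha> + 4)) \<le> a * (1 / (32 * l))" using pos by (intro mult_left_mono) auto
  then show ?thesis using pos by (simp add: field_simps)
qed

lemma near_nonneg: "0 \<le> (\<alpha> - 1) * r / l" using pos \<alpha> by simp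

lemma near_le: "(\<alpha> - 1) * r / l \<le> l * r"
proof -
  have "\<alpha> - 1 \<le> l * l" using l_large pos \<alpha> mult_mono[of 1 l "\<alpha> - 1" l] by simp
  then have "(\<alpha> - 1) * r \<le> l * l * r" using pos by (intro mult_right_mono) auto
  then show ?thesis using pos by (simp add: divide_le_eq mult_ac)
qed

lemma near_score: "(\<alpha> - 1) * r / l / t * ln (l * a) \<le> a / l"
proof -
  have "ln (l * a) = ln l + (q - l) / (\<alpha> - 1)" using pos by (simp add: ln_mult ln_a)
  also have "\<dots> \<le> q / (\<alpha> - 1)" using ln_B by (simp add: diff_divide_distrib)
  finally have "(\<alpha> - 1) * r / l / t * ln (l * a) \<le> (\<alpha> - 1) * r / l / t * (q / (\<alpha> - 1))"
    using pos \<alpha> by (intro mult_left_mono) auto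
  also have "\<dots> = (q * r) / (l * t)" using \<alpha> by simp
  also have "\<dots> = a / l" using pos by (simp add: ta[symmetric] field_simps)
  finally show ?thesis .
qed

lemma slope_level: "q / (2 * (\<alpha> - 1) * t) * t \<le> ln (a / l)"
  using ln_b pos by (simp add: ln_div ln_a)

lemma radius_le: "l * r \<le> t * (a / l)"
proof -
  have "l * l \<le> q" using q_l pos by (simp add: power2_eq_square)
  then have "l * l * r \<le> q * r" using pos by (intro mult_right_mono) auto
  then have "l * l * r \<le> t * a" by (simp only: ta)
  then show ?thesis using pos by (simp add: le_divide_eq mult_ac)
qed

lemma cap_ratio: "2 * exp 1 * (l * a) * t / r = 2 * exp 1 * l * q"
  using pos ta by (simp add: field_simps)

lemma cap_ratio_ge: "1 \<le> 2 * exp 1 * l * q"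
proof -
  have "1 * 1 \<le> l * q" using l_large q1 by (intro mult_mono) auto
  moreover have "1 * 1 \<le> 2 * exp (1::real)" by (intro mult_mono) auto
  ultimately have "1 * 1 \<le> (2 * exp 1) * (l * q)" by (intro mult_mono) auto
  then show ?thesis by (simp add: mult_ac)
qed

text \<open>
With slope \<open>1 / 2\<close> of the critical one, the value at a far site uses up half of the available \<open>q / (\<alpha> - 1)\<close> per
unit of distance and the tolerance an eighth of it, whereas the logarithm is at least five eighths of it plus 1.
\<close>

lemma far_bound:
  fixes x y :: real
  assumes y: "l * r < y" and x: "x \<le> q / (2 * (\<alpha> - 1) * t) * y"
  shows "t * x + t * (a * l powr (- (2 * \<alpha> + 4)) / 4) + y \<le> y * ln (y / (2 * exp 1 * t))"
proof -
  have y0: "0 < y" using y pos mult_pos_pos[of l r] by linarith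
  have "t * x \<le> t * (q / (2 * (\<alpha> - 1) * t) * y)" using x pos by (intro mult_left_mono) auto
  also have "\<dots> = y * (1 / 2 * q / (\<alpha> - 1))" using pos \<alpha> by simp
  finally have 1: "t * x \<le> y * (1 / 2 * q / (\<alpha> - 1))" .
  have "t * (a * l powr (- (2 * \<alpha> + 4)) / 4) = q * r / 4 * l powr (- (2 * \<alpha> + 4))"
    using ta by (simp add: mult.assoc[symmetric])
  also have "\<dots> \<le> q * r / 4 * l powr 0"
    using pos l_large \<alpha> by (intro mult_left_mono powr_mono) auto
  also have "\<dots> \<le> q * r / 4 * (l / (2 * (\<alpha> - 1)))"
    using pos l_large \<alpha> by (intro mult_left_mono) (auto simp: le_divide_eq)
  also have "\<dots> = (l * r) * (1 / 8 * q / (\<alpha> - 1))" by (simp add: field_simps)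
  also have "\<dots> \<le> y * (1 / 8 * q / (\<alpha> - 1))" using y pos \<alpha> by (intro mult_right_mono) auto
  finally have 2: "t * (a * l powr (- (2 * \<alpha> + 4)) / 4) \<le> y * (1 / 8 * q / (\<alpha> - 1))" .
  have "5 / 8 * q / (\<alpha> - 1) + 1 \<le> ln l + ln a - ln q - ln 2 - 1" using ln_far by (simp add: ln_a l)
  also have "\<dots> = ln (l * a / q / (2 * exp 1))" using pos by (simp add: ln_mult ln_div)
  also have "l * a / q / (2 * exp 1) = l * r / (2 * exp 1 * t)"
    using radius_over_t by (simp add: divide_divide_eq_left mult_ac) (metis divide_divide_eq_left mult.commute)
  also have "ln (l * r / (2 * exp 1 * t)) \<le> ln (y / (2 * exp 1 * t))"
    using y y0 pos by (subst ln_le_cancel_iff) (auto intro!: divide_right_mono)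
  finally have "y * (5 / 8 * q / (\<alpha> - 1) + 1) \<le> y * ln (y / (2 * exp 1 * t))"
    using y0 by (intro mult_left_mono) auto
  moreover have "y * (5 / 8 * q / (\<alpha> - 1) + 1) = y * (1 / 2 * q / (\<alpha> - 1)) + y * (1 / 8 * q / (\<alpha> - 1)) + y"
  proof -
    have e: "c * q / (\<alpha> - 1) = c * (q / (\<alpha> - 1))" for c by simp
    have "y * (5 / 8 * w + 1) = y * (1 / 2 * w) + y * (1 / 8 * w) + y" for w
      by (simp add: algebra_simps)
    then show ?thesis unfolding e .
  qed
  ultimately show ?thesis using 1 2 by linarith
qed

lemma t_le_r: "t \<le> r"
proof -
  have "q * t \<le> t * a" using pos a_large mult_left_mono[of q a t] by (simp add: mult.commute)
  then have "q * t \<le> q * r" by (simp only: ta)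
  then show ?thesis using pos by simp
qed

text \<open>
After division by \<open>r\<close> the term with the gap is \<open>q\<close> times a power of \<open>1 / l\<close>, while all others are
at most \<open>l * ln (l * q)\<close> up to constants; \<open>q\<close> is exponentially larger than \<open>l\<close>.
\<close>

lemma error_exponent:
  "- t * (a * l powr (- (2 * \<alpha> + 4))) + t * (a * l powr (- (2 * \<alpha> + 4)) / 4)
     + l * r * ln (2 * exp 1 * (l * a) * t / r) + r + 3 * (l * r) + 2 * t \<le> - r"
proof -
  define P where "P = l powr (- (2 * \<alpha> + 4))"
  define E where "E = ln (2 * exp 1 * l * q)"
  have "r * (l * E + 1 + 3 * l + 2 + 1) \<le> r * (3 / 4 * q * P)"
    unfolding P_def E_def using error pos by (intro mult_left_mono) auto
  also have "\<dots> = 3 / 4 * (q * r) * P" by simp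
  also have "\<dots> = 3 / 4 * (t * a) * P" by (simp only: ta)
  finally have "- t * (a * P) + t * (a * P / 4) + l * r * E + r + 3 * (l * r) + 2 * t \<le> - r"
    using t_le_r by (simp add: algebra_simps)
  then show ?thesis unfolding cap_ratio P_def E_def .
qed

lemma error_exponent2: "- t * (a / l) + 3 * (l * r) + 2 * t \<le> - r"
proof -
  have "r * (3 * l + 2 + 1) \<le> r * (q / l)" using error2 pos by (intro mult_left_mono) auto
  also have "\<dots> = (q * r) / l" by simp
  also have "\<dots> = t * (a / l)" by (simp add: ta[symmetric])
  finally show ?thesis using t_le_r by (simp add: algebra_simps)
qed

end

text \<open>
One term for each clause of typicality, in the same order. Only \<open>l\<close> is left after the powers of
\<open>a\<close>, \<open>r\<close> and \<open>q\<close> have been cancelled or estimated.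
\<close>

definition failure_bound :: "real \<Rightarrow> real \<Rightarrow> real" where
  "failure_bound \<alpha> l =
     2 * (2 * (\<alpha> - 1)) powr \<alpha> * 2 powr (\<alpha> - 1) / (\<alpha> - 1) * l powr (1 - \<alpha>)
     + exp (- ((\<alpha> - 1) * 2 powr (- \<alpha>) * l powr (\<alpha> - 1)))
     + 144 * \<alpha> * 4 powr (2 * \<alpha> + 1) * l powr (- 1)
     + 3 * l powr (1 - \<alpha>) + l powr (- \<alpha>) + 2 powr (2 * \<alpha>) * l powr (- 1)"

lemma failure_bound_tendsto:
  assumes "1 < \<alpha>"
  shows "(failure_bound \<alpha> \<longlongrightarrow> 0) at_top"
proof -
  have neg: "((\<lambda>l. K * l powr s) \<longlongrightarrow> K * 0) at_top" if "s < 0" for K s :: real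
    by (intro tendsto_mult tendsto_const tendsto_neg_powr that filterlim_ident)
  have "filterlim (\<lambda>l. (\<alpha> - 1) * 2 powr (- \<alpha>) * l powr (\<alpha> - 1)) at_top at_top"
    using assms by real_asymp
  then have "((\<lambda>l. exp (- ((\<alpha> - 1) * 2 powr (- \<alpha>) * l powr (\<alpha> - 1)))) \<longlongrightarrow> 0) at_top"
    by (intro filterlim_compose[OF exp_at_bot]) (simp add: filterlim_uminus_at_bot)
  then have "(failure_bound \<alpha> \<longlongrightarrow>
     2 * (2 * (\<alpha> - 1)) powr \<alpha> * 2 powr (\<alpha> - 1) / (\<alpha> - 1) * 0 + 0 + 144 * \<alpha> * 4 powr (2 * \<alpha> + 1) * 0
     + 3 * 0 + 1 * 0 + 2 powr (2 * \<alpha>) * 0) at_top"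
    unfolding failure_bound_def[abs_def]
    by (intro tendsto_add neg) (use assms neg[of "- \<alpha>" 1] in auto)
  then show ?thesis by simp
qed

lemma powr_minus_quotient:
  fixes x y s :: real
  assumes "0 < x" "0 < y"
  shows "(x / y) powr (- s) = y powr s / x powr s"
  using assms by (simp add: powr_minus powr_divide)

context scaling
begin

lemma powr_a_r: "a powr (- \<alpha>) = 1 / r" "a powr (2 * \<alpha>) = r * r"
  using pos by (simp_all add: r powr_minus powr_add[symmetric] divide_inverse)

lemma far_failure:
  "2 * (q / (2 * (\<alpha> - 1) * t)) powr (- \<alpha>) * (real (nat \<lfloor>l * r\<rfloor>) powr (1 - \<alpha>) / (\<alpha> - 1))
    \<le> 2 * (2 * (\<alpha> - 1)) powr \<alpha> * 2 powr (\<alpha> - 1) / (\<alpha> - 1) * l powr (1 - \<alpha>)"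
proof -
  define c where "c = q / (2 * (\<alpha> - 1) * t)"
  define R where "R = l * r"
  have c0: "0 < c" unfolding c_def by (rule slope_pos)
  have R1: "1 \<le> R" unfolding R_def by (rule radius_ge_1)
  have cR: "c * R = l * a / (2 * (\<alpha> - 1))"
  proof -
    have "c * R = l * (q * r) / (2 * (\<alpha> - 1) * t)" by (simp add: c_def R_def)
    also have "\<dots> = l * (t * a) / (2 * (\<alpha> - 1) * t)" by (simp only: ta)
    also have "\<dots> = l * a / (2 * (\<alpha> - 1))" using pos by simp
    finally show ?thesis .
  qed
  have "1 \<le> \<lfloor>R\<rfloor>" "R < of_int \<lfloor>R\<rfloor> + 1" using R1 by (auto simp: le_floor_iff)
  moreover from this have "real (nat \<lfloor>R\<rfloor>) = of_int \<lfloor>R\<rfloor>" by simp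
  ultimately have "R / 2 \<le> real (nat \<lfloor>R\<rfloor>)" by linarith
  then have "real (nat \<lfloor>R\<rfloor>) powr (1 - \<alpha>) \<le> (R / 2) powr (1 - \<alpha>)"
    using R1 \<alpha> by (intro powr_mono2') auto
  also have "\<dots> = 2 powr (\<alpha> - 1) * R powr (1 - \<alpha>)"
    using R1 by (simp add: powr_divide powr_diff field_simps)
  finally have "c powr (- \<alpha>) * real (nat \<lfloor>R\<rfloor>) powr (1 - \<alpha>) \<le> c powr (- \<alpha>) * (2 powr (\<alpha> - 1) * R powr (1 - \<alpha>))"
    by (intro mult_left_mono) auto
  also have "\<dots> = 2 powr (\<alpha> - 1) * ((c * R) powr (- \<alpha>) * R)"
    using c0 R1 by (simp add: powr_mult powr_diff powr_minus field_simps)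
  also have "(c * R) powr (- \<alpha>) * R = (2 * (\<alpha> - 1)) powr \<alpha> * l powr (1 - \<alpha>)"
  proof -
    have "(c * R) powr (- \<alpha>) = l powr (- \<alpha>) * a powr (- \<alpha>) * (2 * (\<alpha> - 1)) powr \<alpha>"
    proof -
      have "(c * R) powr (- \<alpha>) = (l * a) powr (- \<alpha>) / (2 * (\<alpha> - 1)) powr (- \<alpha>)"
        unfolding cR by (rule powr_divide)
      also have "(l * a) powr (- \<alpha>) = l powr (- \<alpha>) * a powr (- \<alpha>)" by (rule powr_mult)
      also have "l powr (- \<alpha>) * a powr (- \<alpha>) / (2 * (\<alpha> - 1)) powr (- \<alpha>) = l powr (- \<alpha>) * a powr (- \<alpha>) * (2 * (\<alpha> - 1)) powr \<alpha>"
        using powr_minus[of "2 * (\<alpha> - 1)" \<alpha>] by (simp only: divide_inverse inverse_inverse_eq)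
      finally show ?thesis .
    qed
    then have "(c * R) powr (- \<alpha>) * R = l powr (- \<alpha>) * (1 / r) * (2 * (\<alpha> - 1)) powr \<alpha> * R"
      by (simp only: powr_a_r)
    also have "\<dots> = (2 * (\<alpha> - 1)) powr \<alpha> * (l powr 1 * l powr (- \<alpha>))"
      using pos by (simp add: R_def)
    also have "l powr 1 * l powr (- \<alpha>) = l powr (1 - \<alpha>)"
      by (simp only: powr_add[symmetric]) simp
    finally show ?thesis .
  qed
  finally have "c powr (- \<alpha>) * real (nat \<lfloor>R\<rfloor>) powr (1 - \<alpha>) \<le> 2 powr (\<alpha> - 1) * ((2 * (\<alpha> - 1)) powr \<alpha> * l powr (1 - \<alpha>))" .
  then have "2 / (\<alpha> - 1) * (c powr (- \<alpha>) * real (nat \<lfloor>R\<rfloor>) powr (1 - \<alpha>))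
    \<le> 2 / (\<alpha> - 1) * (2 powr (\<alpha> - 1) * ((2 * (\<alpha> - 1)) powr \<alpha> * l powr (1 - \<alpha>)))"
    using \<alpha> by (intro mult_left_mono) auto
  then show ?thesis unfolding c_def[symmetric] R_def[symmetric] by (simp only: times_divide_eq_right times_divide_eq_left mult_ac)
qed

lemma near_failure:
  "exp (- ((\<alpha> - 1) * r / l) * (2 * (a / l)) powr (- \<alpha>)) = exp (- ((\<alpha> - 1) * 2 powr (- \<alpha>) * l powr (\<alpha> - 1)))"
proof -
  have "(2 * (a / l)) powr (- \<alpha>) = 2 powr (- \<alpha>) * (a / l) powr (- \<alpha>)"
    by (rule powr_mult)
  also have "(a / l) powr (- \<alpha>) = l powr \<alpha> / r"
    using powr_minus_quotient[of a l \<alpha>] pos by (simp add: r)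
  finally have "(2 * (a / l)) powr (- \<alpha>) = 2 powr (- \<alpha>) * (1 / r) * l powr \<alpha>" by simp
  then show ?thesis using pos by (simp add: powr_diff field_simps)
qed

lemma gap_failure:
  "(2 * (l * r) + 1)^2 * (16 * (a * l powr (- (2 * \<alpha> + 4))) * \<alpha> * (a / l / 4) powr (- \<alpha> - 1) * (a / l / 4) powr (- \<alpha>))
    \<le> 144 * \<alpha> * 4 powr (2 * \<alpha> + 1) * l powr (- 1)"
proof -
  have "(2 * (l * r) + 1)^2 \<le> (3 * (l * r))^2"
    using radius_ge_1 by (intro power_mono) auto
  also have "\<dots> = 9 * (l * l) * (r * r)" by (simp add: power2_eq_square)
  finally have sq: "(2 * (l * r) + 1)^2 \<le> 9 * (l * l) * (r * r)" .
  have "(a / l / 4) powr (- \<alpha> - 1) * (a / l / 4) powr (- \<alpha>) = (a / (l * 4)) powr (- (2 * \<alpha> + 1))"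
    by (simp add: powr_add[symmetric])
  also have "\<dots> = (l * 4) powr (2 * \<alpha> + 1) / a powr (2 * \<alpha> + 1)"
    using pos by (intro powr_minus_quotient) auto
  also have "\<dots> = l powr (2 * \<alpha> + 1) * 4 powr (2 * \<alpha> + 1) / (r * r * a)"
    using pos by (simp add: powr_mult powr_add powr_a_r)
  finally have pw: "(a / l / 4) powr (- \<alpha> - 1) * (a / l / 4) powr (- \<alpha>) = l powr (2 * \<alpha> + 1) * 4 powr (2 * \<alpha> + 1) / (r * r * a)" .
  have "(2 * (l * r) + 1)^2 * (16 * (a * l powr (- (2 * \<alpha> + 4))) * \<alpha> * ((a / l / 4) powr (- \<alpha> - 1) * (a / l / 4) powr (- \<alpha>)))
    \<le> 9 * (l * l) * (r * r) * (16 * (a * l powr (- (2 * \<alpha> + 4))) * \<alpha> * ((a / l / 4) powr (- \<alpha> - 1) * (a / l / 4) powr (- \<alpha>)))"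
    using sq pos \<alpha> by (intro mult_right_mono) auto
  also have "\<dots> = 144 * \<alpha> * 4 powr (2 * \<alpha> + 1) * (l * l * (l powr (- (2 * \<alpha> + 4)) * l powr (2 * \<alpha> + 1)))"
    unfolding pw using pos by (simp add: field_simps)
  also have "l * l * (l powr (- (2 * \<alpha> + 4)) * l powr (2 * \<alpha> + 1)) = l powr (- 1)"
  proof -
    have "l * l = l powr 2" using pos by (simp add: powr_numeral power2_eq_square)
    then show ?thesis by (simp add: powr_add[symmetric])
  qed
  finally show ?thesis by (simp only: mult.assoc)
qed

lemma cap_failure: "(2 * (l * r) + 1) * (l * a) powr (- \<alpha>) \<le> 3 * l powr (1 - \<alpha>)"
proof -
  have "(2 * (l * r) + 1) * (l * a) powr (- \<alpha>) \<le> 3 * (l * r) * (l * a) powr (- \<alpha>)"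
    using radius_ge_1 by (intro mult_right_mono) auto
  also have "\<dots> = 3 * (l powr 1 * l powr (- \<alpha>))"
    using pos unfolding powr_mult powr_a_r by simp
  also have "l powr 1 * l powr (- \<alpha>) = l powr (1 - \<alpha>)"
    by (simp only: powr_add[symmetric]) simp
  finally show ?thesis .
qed

lemma level_over: "l \<le> a / l / 2"
proof -
  have "4 * l\<^sup>2 \<le> a" using q_l a_large by linarith
  then show ?thesis using pos by (simp add: le_divide_eq power2_eq_square)
qed

lemma zero_failure: "(a / l / 2) powr (- \<alpha>) \<le> l powr (- \<alpha>)"
  using level_over pos \<alpha> by (intro powr_mono2') auto

lemma pair_failure: "l * r * (a / l / 2) powr (- 2 * \<alpha>) \<le> 2 powr (2 * \<alpha>) * l powr (- 1)"
proof -
  have "l powr (2 * \<alpha> + 4) \<le> a"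
  proof -
    have "1 * l powr (2 * \<alpha> + 4) \<le> (a * l powr (- (2 * \<alpha> + 4))) * l powr (2 * \<alpha> + 4)"
      using gap_large by (intro mult_right_mono) auto
    also have "\<dots> = a * (l powr (- (2 * \<alpha> + 4)) * l powr (2 * \<alpha> + 4))" by simp
    also have "\<dots> = a" using pos by (simp only: powr_add[symmetric]) simp
    finally show ?thesis by simp
  qed
  then have ge: "l powr (2 * \<alpha> + 4) \<le> r" using r_ge by linarith
  have "l * r * (a / l / 2) powr (- 2 * \<alpha>) = l * r * ((l * 2) powr (2 * \<alpha>) / a powr (2 * \<alpha>))"
    using powr_minus_quotient[of a "l * 2" "2 * \<alpha>"] pos by simp
  also have "\<dots> = l * r * ((l * 2) powr (2 * \<alpha>) / (r * r))" by (simp only: powr_a_r)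
  also have "\<dots> = 2 powr (2 * \<alpha>) * (l powr (2 * \<alpha> + 1) / r)"
    using pos by (simp add: powr_mult powr_add field_simps)
  also have "\<dots> \<le> 2 powr (2 * \<alpha>) * l powr (- 1)"
  proof (intro mult_left_mono)
    have "l powr (2 * \<alpha> + 1) / r \<le> l powr (2 * \<alpha> + 1) / l powr (2 * \<alpha> + 4)"
      using ge pos by (intro divide_left_mono) auto
    also have "\<dots> = l powr (- 3)" by (simp add: powr_diff[symmetric])
    also have "\<dots> \<le> l powr (- 1)" using l_large by (intro powr_mono) auto
    finally show "l powr (2 * \<alpha> + 1) / r \<le> l powr (- 1)" .
  qed simp
  finally show ?thesis .
qed

end

section \<open>The limit theorems\<close>

text \<open>
An infinite sum over the integers is an absolutely convergent series or 0, and the set where the series converges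
absolutely is measurable.
\<close>

lemma borel_measurable_infsum_int:
  fixes f :: "int \<Rightarrow> 'b \<Rightarrow> real"
  assumes f[measurable]: "\<And>z. f z \<in> borel_measurable N"
    and A[measurable]: "\<And>z. Measurable.pred N (\<lambda>x. z \<in> A x)"
  shows "(\<lambda>x. \<Sum>\<^sub>\<infinity>z\<in>A x. f z x) \<in> borel_measurable N"
proof -
  define g where "g n x = (if int_decode n \<in> A x then f (int_decode n) x else 0)" for n x
  have [measurable]: "g n \<in> borel_measurable N" for n unfolding g_def by measurable
  have eq: "(\<Sum>\<^sub>\<infinity>z\<in>A x. f z x) = (if summable (\<lambda>n. \<bar>g n x\<bar>) then (\<Sum>n. g n x) else 0)" for x
  proof -
    have "(\<Sum>\<^sub>\<infinity>z\<in>A x. f z x) = (\<Sum>\<^sub>\<infinity>z\<in>UNIV. if z \<in> A x then f z x else 0)"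
      by (rule infsum_cong_neutral) auto
    also have "\<dots> = (\<Sum>\<^sub>\<infinity>n\<in>UNIV. g n x)"
      unfolding g_def by (rule infsum_reindex_bij_betw[OF bij_int_decode, symmetric])
    also have "\<dots> = (if summable (\<lambda>n. \<bar>g n x\<bar>) then (\<Sum>n. g n x) else 0)"
    proof (cases "summable (\<lambda>n. \<bar>g n x\<bar>)")
      case True
      then have "(\<lambda>n. g n x) summable_on UNIV"
        by (intro norm_summable_imp_summable_on) simp
      then have "((\<lambda>n. g n x) has_sum (\<Sum>\<^sub>\<infinity>n\<in>UNIV. g n x)) UNIV" by (rule has_sum_infsum)
      then have "(\<lambda>n. g n x) sums (\<Sum>\<^sub>\<infinity>n\<in>UNIV. g n x)" by (rule has_sum_imp_sums)
      then show ?thesis using True by (simp add: sums_iff)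
    next
      case False
      then have "\<not> (\<lambda>n. g n x) summable_on UNIV"
        using summable_on_iff_abs_summable_on_real[of "\<lambda>n. g n x" UNIV]
          summable_on_UNIV_nonneg_real_iff[of "\<lambda>n. \<bar>g n x\<bar>"] by simp
      then show ?thesis using False by (simp add: infsum_not_exists)
    qed
    finally show ?thesis .
  qed
  have [measurable]: "Measurable.pred N (\<lambda>x. summable (\<lambda>n. \<bar>g n x\<bar>))"
    unfolding summable_iff_convergent Cauchy_convergent_iff[symmetric] pred_def
    by (rule sets_Collect_Cauchy) measurable
  show ?thesis unfolding eq by measurable
qed


context duplicated_pareto
begin

lemma measurable_potential [measurable]: "(\<lambda>\<omega>. potential \<xi>0 dup \<omega> z) \<in> borel_measurable M"
proof (cases "z < 0")
  case True
  then have "1 \<le> nat (- z)" by simp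
  note [measurable] = measurable_dup[OF this]
  show ?thesis unfolding potential_def by measurable
next
  case False
  then show ?thesis unfolding potential_def by simp
qed

lemma pred_maximiser [measurable]: "Measurable.pred M (\<lambda>\<omega>. z \<in> maximisers (potential \<xi>0 dup \<omega>) t)"
proof -
  have [measurable]: "(\<lambda>\<omega>. \<Psi> (potential \<xi>0 dup \<omega>) t y) \<in> borel_measurable M" for y
    unfolding \<Psi>_def by measurable
  show ?thesis unfolding maximisers_def mem_Collect_eq by measurable
qed

lemma sets_two_maximisers: "{\<omega> \<in> space M. card (maximisers (potential \<xi>0 dup \<omega>) t) = 2} \<in> sets M"
proof -
  have "card A = 2 \<longleftrightarrow> (\<exists>x y. x \<noteq> y \<and> (\<forall>z. z \<in> A \<longleftrightarrow> z = x \<or> z = y))" for A :: "int set"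
    by (auto simp: card_2_iff)
  moreover have "{\<omega> \<in> space M. \<exists>x y. x \<noteq> y \<and> (\<forall>z. z \<in> maximisers (potential \<xi>0 dup \<omega>) t \<longleftrightarrow> z = x \<or> z = y)} \<in> sets M"
    by measurable
  ultimately show ?thesis by simp
qed

lemma AE_potential_ge_1: "AE \<omega> in M. \<forall>z. 1 \<le> \<xi>0 z \<omega>"
  using AE_pareto_ge_1 by eventually_elim (auto intro: less_imp_le)

definition typical_event :: "real \<Rightarrow> 'a set" where
  "typical_event t = {\<omega> \<in> space M. typical_potential t (box_radius \<alpha> t) (value_cap \<alpha> t) (score_level \<alpha> t)
     (score_gap \<alpha> t) (far_slope \<alpha> t) (near_radius \<alpha> t) (\<lambda>z. \<xi>0 z \<omega>)}"

lemma sets_typical_event: "typical_event t \<in> sets M"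
  unfolding typical_event_def using measurable_typical by (simp add: pred_def)

lemma typical_environmentI:
  assumes "scaling \<alpha> t q l a r" "\<omega> \<in> typical_event t" "\<And>z. 1 \<le> \<xi>0 z \<omega>"
  shows "typical_environment t (box_radius \<alpha> t) (value_cap \<alpha> t) (score_level \<alpha> t) (score_gap \<alpha> t)
     (far_slope \<alpha> t) (near_radius \<alpha> t) (\<lambda>z. \<xi>0 z \<omega>) (\<lambda>n. dup n \<omega>) (potential \<xi>0 dup \<omega>)"
proof -
  interpret scaling \<alpha> t q l a r by fact
  show ?thesis
  proof
    show "typical_potential t (box_radius \<alpha> t) (value_cap \<alpha> t) (score_level \<alpha> t) (score_gap \<alpha> t)
       (far_slope \<alpha> t) (near_radius \<alpha> t) (\<lambda>z. \<xi>0 z \<omega>)"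
      using assms(2) by (simp add: typical_event_def)
    show "potential \<xi>0 dup \<omega> z = \<xi>0 (source (\<lambda>n. dup n \<omega>) z) \<omega>" for z
      by (rule potential_eq_source)
    show "1 \<le> score_level \<alpha> t" using level_ge by (simp add: params)
    show "2 * score_gap \<alpha> t \<le> score_level \<alpha> t" unfolding params using gap_level gap_pos by linarith
    show "far_slope \<alpha> t * t \<le> ln (score_level \<alpha> t)" unfolding params by (rule slope_level)
    show "near_radius \<alpha> t / t * ln (value_cap \<alpha> t) \<le> score_level \<alpha> t" unfolding params by (rule near_score)
    show "near_radius \<alpha> t \<le> box_radius \<alpha> t" unfolding params by (rule near_le)
    show "0 \<le> near_radius \<alpha> t" unfolding params by (rule near_nonneg)
    show "0 < score_gap \<alpha> t" unfolding params by (rule gap_pos)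
  qed (use pos assms in auto)
qed

lemma prob_atypical_le:
  assumes "scaling \<alpha> t q l a r"
  shows "prob (space M - typical_event t) \<le> failure_bound \<alpha> l"
proof -
  interpret scaling \<alpha> t q l a r by fact
  have "space M - typical_event t = {\<omega> \<in> space M. \<not> typical_potential t (l * r) (l * a) (a / l)
     (a * l powr (- (2 * \<alpha> + 4))) (q / (2 * (\<alpha> - 1) * t)) ((\<alpha> - 1) * r / l) (\<lambda>z. \<xi>0 z \<omega>)}"
    by (auto simp: typical_event_def params)
  also have "prob \<dots> \<le> 2 * (q / (2 * (\<alpha> - 1) * t)) powr (- \<alpha>) * (real (nat \<lfloor>l * r\<rfloor>) powr (1 - \<alpha>) / (\<alpha> - 1))
    + exp (- ((\<alpha> - 1) * r / l) * (2 * (a / l)) powr (- \<alpha>))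
    + (2 * (l * r) + 1)^2 * (16 * (a * l powr (- (2 * \<alpha> + 4))) * \<alpha> * (a / l / 4) powr (- \<alpha> - 1) * (a / l / 4) powr (- \<alpha>))
    + (2 * (l * r) + 1) * (l * a) powr (- \<alpha>)
    + (a / l / 2) powr (- \<alpha>)
    + l * r * (a / l / 2) powr (- 2 * \<alpha>)"
  proof -
    have "1 \<le> l * a" using l_large a_large mult_mono[of 1 l 1 a] by simp
    then show ?thesis
      by (rule prob_not_typical_le[OF \<alpha> pos(1) radius_ge_1 radius_t_level slope_pos slope_radius
            near_nonneg level_ge gap_pos gap_level])
  qed
  also have "\<dots> \<le> failure_bound \<alpha> l"
    unfolding failure_bound_def near_failure
    by (intro add_mono far_failure gap_failure cap_failure zero_failure pair_failure order.refl)
  finally show ?thesis .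
qed

text \<open>
The tolerance \<open>g\<close> is a quarter of the score gap: it tends to infinity, as the detours require, while
\<open>exp (t * g)\<close> does not use up the gain from the gap.
\<close>

lemma localisation_on_typical_event:
  assumes sc: "scaling \<alpha> t q l a r" and \<omega>: "\<omega> \<in> typical_event t" "\<And>z. 1 \<le> \<xi>0 z \<omega>"
    and fk: "feynman_kac (potential \<xi>0 dup \<omega>) u" and g: "2 < score_gap \<alpha> t / 4"
  shows "\<bar>1 / total_mass u t * (\<Sum>\<^sub>\<infinity>z\<in>maximisers (potential \<xi>0 dup \<omega>) t. u t z) - 1\<bar>
    \<le> (2 * r * r + 1) * exp (- r) + 4 * exp (- r) + 2 / (score_gap \<alpha> t / 4 - 2)"
proof -
  interpret scaling \<alpha> t q l a r by fact
  interpret E: typical_environment t "box_radius \<alpha> t" "value_cap \<alpha> t" "score_level \<alpha> t" "score_gap \<alpha> t"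
     "far_slope \<alpha> t" "near_radius \<alpha> t" "\<lambda>z. \<xi>0 z \<omega>" "\<lambda>n. dup n \<omega>" "potential \<xi>0 dup \<omega>"
    by (rule typical_environmentI[OF sc \<omega>])
  let ?\<xi> = "potential \<xi>0 dup \<omega>"
  let ?\<Omega> = "maximisers ?\<xi> t"
  define D where "D = a * l powr (- (2 * \<alpha> + 4))"
  have D: "score_gap \<alpha> t = D" by (simp add: D_def params)
  obtain z where z: "z \<in> ?\<Omega>" using E.maximisers_nonempty by blast
  have val: "?\<xi> y = \<xi>0 (source (\<lambda>n. dup n \<omega>) y) \<omega>" for y by (rule potential_eq_source)
  have box: "\<bar>real_of_int z\<bar> \<le> l * r" using E.maximiser_in_box[OF z] by (simp add: params)
  have level: "a / l \<le> \<Psi> ?\<xi> t z" using E.maximiser_score[OF z] by (simp add: params)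
  have "\<Psi> ?\<xi> t z \<le> ?\<xi> z" using E.\<Psi>_le[of "source (\<lambda>n. dup n \<omega>) z"] by (simp add: E.\<Psi>_eq val)
  then have "t * (a / l) \<le> t * ?\<xi> z" using level pos by (intro mult_left_mono) auto
  then have Rt: "l * r \<le> t * ?\<xi> z" using radius_le by linarith
  have "\<bar>1 / total_mass u t * (\<Sum>\<^sub>\<infinity>z\<in>?\<Omega>. u t z) - 1\<bar> \<le>
    (2 * (l * r) + 1) * exp (- t * D + t * (D / 4) + l * r * ln (2 * exp 1 * (l * a) * t / r) + r + 3 * (l * r) + 2 * t)
    + 4 * exp (- t * \<Psi> ?\<xi> t z + 3 * (l * r) + 2 * t) + 2 / (D / 4 - 2)"
  proof (rule localisation_in_environment[OF fk pos(1) E.\<xi>_ge E.finite_maximisers z _ box Rt])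
    show "?\<xi> y = ?\<xi> z" if "y \<in> ?\<Omega>" for y
      using E.source_maximisers[OF that z] by (simp add: val)
    show "\<Psi> ?\<xi> t y \<le> \<Psi> ?\<xi> t z - D" if "\<bar>real_of_int y\<bar> \<le> l * r" "y \<notin> ?\<Omega>" for y
      using E.score_gap[OF z, of y] E.maximiser_if_same_source[OF z, of y] that by (auto simp: params D_def)
    show "?\<xi> y \<le> l * a" if "\<bar>real_of_int y\<bar> \<le> l * r" for y
      using E.typical that by (simp add: val typical_potential_def params)
    show "t * ?\<xi> y + t * (D / 4) + \<bar>real_of_int y\<bar> \<le> \<bar>real_of_int y\<bar> * ln (\<bar>real_of_int y\<bar> / (2 * exp 1 * t))"
      if "l * r < \<bar>real_of_int y\<bar>" for y
    proof -
      let ?s = "source (\<lambda>n. dup n \<omega>) y"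
      have "l * r < \<bar>real_of_int ?s\<bar>" using that by simp
      then have "\<xi>0 ?s \<omega> \<le> q / (2 * (\<alpha> - 1) * t) * \<bar>real_of_int ?s\<bar>"
        using conjunct1[OF E.typical[unfolded typical_potential_def]] by (simp only: params)
      then show ?thesis unfolding D_def val using that by (intro far_bound) simp_all
    qed
    show "1 \<le> 2 * exp 1 * (l * a) * t / r" unfolding cap_ratio by (rule cap_ratio_ge)
    show "2 < D / 4" using g by (simp add: D)
  qed (rule pos)
  also have "\<dots> \<le> (2 * r * r + 1) * exp (- r) + 4 * exp (- r) + 2 / (D / 4 - 2)"
  proof -
    have "l \<le> r" using a_large r_ge pos by linarith
    then have box_le: "2 * (l * r) + 1 \<le> 2 * r * r + 1" using pos by simp
    have e1: "exp (- t * D + t * (D / 4) + l * r * ln (2 * exp 1 * (l * a) * t / r) + r + 3 * (l * r) + 2 * t) \<le> exp (- r)"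
      unfolding D_def using error_exponent by simp
    have "t * (a / l) \<le> t * \<Psi> ?\<xi> t z" using level pos by (intro mult_left_mono) auto
    then have "- t * \<Psi> ?\<xi> t z + 3 * (l * r) + 2 * t \<le> - r"
      using error_exponent2 by linarith
    then have e2: "exp (- t * \<Psi> ?\<xi> t z + 3 * (l * r) + 2 * t) \<le> exp (- r)" by simp
    have "0 \<le> 2 * r * r + 1" using pos by simp
    then show ?thesis
      by (intro add_right_mono add_mono mult_mono[OF box_le e1] mult_left_mono[OF e2]) auto
  qed
  finally show ?thesis by (simp add: D)
qed

lemma prob_atypical_tendsto:
  assumes "1 < \<alpha>"
  shows "((\<lambda>t. prob (space M - typical_event t)) \<longlongrightarrow> 0) at_top"
proof (rule tendsto_sandwich[OF _ _ tendsto_const])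
  show "((\<lambda>t. failure_bound \<alpha> (ln (ln t))) \<longlongrightarrow> 0) at_top"
    by (rule filterlim_compose[OF failure_bound_tendsto[OF assms]]) real_asymp
  show "\<forall>\<^sub>F t in at_top. prob (space M - typical_event t) \<le> failure_bound \<alpha> (ln (ln t))"
    using eventually_scaling[OF assms] by eventually_elim (rule prob_atypical_le)
qed simp

lemma localisation_error_tendsto:
  assumes "1 < \<alpha>"
  shows "((\<lambda>t. (2 * scale \<alpha> t powr \<alpha> * scale \<alpha> t powr \<alpha> + 1) * exp (- (scale \<alpha> t powr \<alpha>)) + 4 * exp (- (scale \<alpha> t powr \<alpha>))
    + 2 / (score_gap \<alpha> t / 4 - 2)) \<longlongrightarrow> 0) at_top" "filterlim (score_gap \<alpha>) at_top at_top"
proof -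
  define \<beta> where "\<beta> = 1 / (\<alpha> - 1)"
  define m where "m = 2 * \<alpha> + 4"
  have \<beta>: "0 < \<beta>" using assms by (simp add: \<beta>_def)
  have "filterlim (\<lambda>t. (t / ln t) powr \<beta> * ln (ln t) powr (- m)) at_top at_top" using \<beta> by real_asymp
  then show g: "filterlim (score_gap \<alpha>) at_top at_top"
    by (simp add: score_gap_def[abs_def] scale_def \<beta>_def m_def)
  have "filterlim (\<lambda>t. ((t / ln t) powr \<beta>) powr \<alpha>) at_top at_top" using \<beta> assms by real_asymp
  then have r: "filterlim (\<lambda>t. scale \<alpha> t powr \<alpha>) at_top at_top" by (simp add: scale_def \<beta>_def)
  have 1: "((\<lambda>r::real. (2 * r * r + 1) * exp (- r) + 4 * exp (- r)) \<longlongrightarrow> 0) at_top" by real_asymp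
  have 2: "((\<lambda>g::real. 2 / (g / 4 - 2)) \<longlongrightarrow> 0) at_top" by real_asymp
  show "((\<lambda>t. (2 * scale \<alpha> t powr \<alpha> * scale \<alpha> t powr \<alpha> + 1) * exp (- (scale \<alpha> t powr \<alpha>)) + 4 * exp (- (scale \<alpha> t powr \<alpha>))
    + 2 / (score_gap \<alpha> t / 4 - 2)) \<longlongrightarrow> 0) at_top"
    using tendsto_add[OF filterlim_compose[OF 1 r] filterlim_compose[OF 2 g]] by simp
qed

theorem mass_concentrates_on_maximisers:
  assumes \<alpha>: "1 < \<alpha>"
    and meas: "\<And>t z. t \<ge> 0 \<Longrightarrow> (\<lambda>\<omega>. u \<omega> t z) \<in> borel_measurable M"
    and fk: "AE \<omega> in M. feynman_kac (potential \<xi>0 dup \<omega>) (u \<omega>)"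
  shows "tendsto_in_prob M
    (\<lambda>t \<omega>. 1 / total_mass (u \<omega>) t * (\<Sum>\<^sub>\<infinity>z\<in>maximisers (potential \<xi>0 dup \<omega>) t. u \<omega> t z)) 1 at_top"
proof -
  define X where "X t \<omega> = 1 / total_mass (u \<omega>) t * (\<Sum>\<^sub>\<infinity>z\<in>maximisers (potential \<xi>0 dup \<omega>) t. u \<omega> t z)" for t \<omega>
  have X: "X t \<in> borel_measurable M" if t: "0 \<le> t" for t
  proof -
    note [measurable] = meas[OF t]
    have [measurable]: "(\<lambda>\<omega>. total_mass (u \<omega>) t) \<in> borel_measurable M"
      unfolding total_mass_def by (rule borel_measurable_infsum_int) auto
    have [measurable]: "(\<lambda>\<omega>. \<Sum>\<^sub>\<infinity>z\<in>maximisers (potential \<xi>0 dup \<omega>) t. u \<omega> t z) \<in> borel_measurable M"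
      by (rule borel_measurable_infsum_int) auto
    show ?thesis unfolding X_def[abs_def] by measurable
  qed
  have "((\<lambda>t. prob {\<omega> \<in> space M. \<epsilon> < \<bar>X t \<omega> - 1\<bar>}) \<longlongrightarrow> 0) at_top" if \<epsilon>: "0 < \<epsilon>" for \<epsilon>
  proof (rule tendsto_sandwich[OF _ _ tendsto_const prob_atypical_tendsto[OF \<alpha>]])
    show "\<forall>\<^sub>F t in at_top. prob {\<omega> \<in> space M. \<epsilon> < \<bar>X t \<omega> - 1\<bar>} \<le> prob (space M - typical_event t)"
      using eventually_scaling[OF \<alpha>] order_tendstoD(2)[OF localisation_error_tendsto(1)[OF \<alpha>] \<epsilon>]
        localisation_error_tendsto(2)[OF \<alpha>, THEN filterlim_at_top_dense[THEN iffD1, rule_format, of _ _ 8]]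
    proof eventually_elim
      case (elim t)
      note sc = elim(1) and err = elim(2) and gap = elim(3)
      show ?case
      proof (rule finite_measure_mono_AE)
        show "AE \<omega> in M. \<omega> \<in> {\<omega> \<in> space M. \<epsilon> < \<bar>X t \<omega> - 1\<bar>} \<longrightarrow> \<omega> \<in> space M - typical_event t"
          using fk AE_potential_ge_1
        proof eventually_elim
          case (elim \<omega>)
          have False if "\<omega> \<in> typical_event t" "\<epsilon> < \<bar>X t \<omega> - 1\<bar>"
          proof -
            have "2 < score_gap \<alpha> t / 4" using gap by simp
            from localisation_on_typical_event[OF sc that(1) elim(2)[rule_format] elim(1) this] that(2) err
            show False unfolding X_def by simp
          qed
          then show ?case by auto
        qed
        show "space M - typical_event t \<in> sets M" using sets_typical_event by auto
      qed
    qed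
  qed simp
  moreover have "\<forall>\<^sub>F t in at_top. X t \<in> borel_measurable M"
    using eventually_ge_at_top[of 0] by eventually_elim (rule X)
  ultimately show ?thesis
    unfolding tendsto_in_prob_def X_def[symmetric] by blast
qed

theorem prob_two_maximisers_tendsto:
  assumes \<alpha>: "1 < \<alpha>"
  shows "((\<lambda>t. prob {\<omega> \<in> space M. card (maximisers (potential \<xi>0 dup \<omega>) t) = 2}) \<longlongrightarrow> p / (2 - p)) at_top"
proof -
  let ?\<eta> = "\<lambda>t. prob (space M - typical_event t)"
  note lim = prob_atypical_tendsto[OF \<alpha>]
  have bounds: "\<forall>\<^sub>F t in at_top. p * (1 - ?\<eta> t) / (2 - p) \<le> prob {\<omega> \<in> space M. card (maximisers (potential \<xi>0 dup \<omega>) t) = 2}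
    \<and> prob {\<omega> \<in> space M. card (maximisers (potential \<xi>0 dup \<omega>) t) = 2} \<le> (p + 2 * (1 - p) * ?\<eta> t) / (2 - p) + ?\<eta> t"
    using eventually_scaling[OF \<alpha>]
  proof eventually_elim
    case (elim t)
    have "AE \<omega> in M. \<omega> \<in> typical_event t \<longrightarrow> typical_environment t (box_radius \<alpha> t) (value_cap \<alpha> t) (score_level \<alpha> t)
       (score_gap \<alpha> t) (far_slope \<alpha> t) (near_radius \<alpha> t) (\<lambda>z. \<xi>0 z \<omega>) (\<lambda>n. dup n \<omega>) (potential \<xi>0 dup \<omega>)"
      using AE_potential_ge_1 by eventually_elim (auto intro: typical_environmentI[OF elim])
    from prob_two_maximisers_bounds[OF sets_typical_event this sets_two_maximisers] show ?case by blast
  qed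
  have low: "((\<lambda>t. p * (1 - ?\<eta> t) / (2 - p)) \<longlongrightarrow> p * (1 - 0) / (2 - p)) at_top"
    using p_range by (intro tendsto_intros lim) auto
  have up: "((\<lambda>t. (p + 2 * (1 - p) * ?\<eta> t) / (2 - p) + ?\<eta> t) \<longlongrightarrow> (p + 2 * (1 - p) * 0) / (2 - p) + 0) at_top"
    using p_range by (intro tendsto_intros lim) auto
  show ?thesis
    by (rule tendsto_sandwich[of "\<lambda>t. p * (1 - ?\<eta> t) / (2 - p)" _ _ "\<lambda>t. (p + 2 * (1 - p) * ?\<eta> t) / (2 - p) + ?\<eta> t"])
       (use bounds low up in \<open>auto elim: eventually_mono\<close>)
qed

end

theorem theorem1p1:
  fixes M :: "'a measure" and p \<alpha> :: real
    and \<xi>0 :: "int \<Rightarrow> 'a \<Rightarrow> real" and dup :: "nat \<Rightarrow> 'a \<Rightarrow> bool"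
    and \<xi> :: "'a \<Rightarrow> int \<Rightarrow> real" and u :: "'a \<Rightarrow> real \<Rightarrow> int \<Rightarrow> real"
  assumes "duplicated_pareto M p \<alpha> \<xi>0 dup"
    and "\<xi> = potential \<xi>0 dup"
    and "\<alpha> > 1"
    and "\<And>t z. t \<ge> 0 \<Longrightarrow> (\<lambda>\<omega>. u \<omega> t z) \<in> borel_measurable M"
    and "AE \<omega> in M. parabolic_anderson_model (\<xi> \<omega>) (u \<omega>)"
  shows "tendsto_in_prob M
           (\<lambda>t \<omega>. 1 / total_mass (u \<omega>) t * (\<Sum>\<^sub>\<infinity>z\<in>maximisers (\<xi> \<omega>) t. u \<omega> t z)) 1 at_top
       \<and> ((\<lambda>t. measure M {\<omega> \<in> space M. card (maximisers (\<xi> \<omega>) t) = 2}) \<longlongrightarrow> p / (2 - p)) at_top"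
proof -
  interpret duplicated_pareto M p \<alpha> \<xi>0 dup by fact
  have "AE \<omega> in M. feynman_kac (potential \<xi>0 dup \<omega>) (u \<omega>)"
    using assms(5) by eventually_elim (simp add: assms(2) parabolic_anderson_model_def)
  with mass_concentrates_on_maximisers[of u] prob_two_maximisers_tendsto assms(3,4)
  show ?thesis unfolding assms(2) by blast
qed

end
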